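(* Each of the fifteen knots $11a43$, $11a44$, $11a47$, $11a57$, $11a231$, $11a263$, $11n71$, $11n72$, $11n73$, $11n74$, $11n75$, $11n76$, $11n77$, $11n78$, $11n81$ (given by the DT codes in the context) is a Montesinos knot with $r=4$, that is, with exactly four non-integer rational tangles.
   Context: DT code: choose a starting point on an oriented knot diagram in $S^2$ (not a crossing) and, proceeding along the orientation, label the crossings with consecutive integers $1,2,3,\dots$ as they are encountered, so that each crossing receives two labels, one odd and one even. An even label applied while passing under is given a negative sign. The DT code is the sequence of the (signed) even labels paired with the odd labels $1,3,5,\dots$ in ascending order. Knots are considered up to mirror image. The knots are given by the following DT codes: $11a43$: $(4,8,14,2,20,16,6,18,12,22,10)$; $11a44$: $(4,8,14,2,20,16,18,6,12,22,10)$; $11a47$: $(4,8,14,2,20,22,18,6,12,16,10)$; $11a57$: $(4,8,16,2,20,22,18,6,12,14,10)$; $11a231$: $(4,14,10,12,18,6,2,20,22,8,16)$; $11a263$: $(6,8,16,2,20,22,18,4,12,14,10)$; $11n71$: $(4,8,14,2,-20,16,6,18,12,-22,-10)$; $11n72$: $(4,8,-14,2,20,16,-6,18,12,22,10)$; $11n73$: $(4,8,-14,2,20,-16,-6,-18,-12,22,10)$; $11n74$: $(4,8,-14,2,-20,16,-6,18,12,-22,-10)$; $11n75$: $(4,8,-14,2,-20,-16,-6,-18,-12,-22,-10)$; $11n76$: $(4,8,14,2,-20,16,18,6,12,-22,-10)$; $11n77$: $(4,8,-14,2,20,-16,-18,-6,-12,22,10)$; $11n78$: $(4,8,-14,2,-20,-16,-18,-6,-12,-22,-10)$;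 $11n81$: $(4,8,-16,2,-20,-22,-18,-6,-12,-14,-10)$. Rational tangles: draw a tangle in a box with four endpoints NW, NE, SW, SE. A rational tangle is a two-string tangle obtained from two parallel unknotted arcs (the horizontal pair or the vertical pair) by a finite sequence of half twists of adjacent endpoints. It is determined up to isotopy fixing the boundary by its fraction in $\mathbb{Q}\cup\{\infty\}$, normalized so that the horizontal pair of arcs has fraction $0$, adding a (positive) half twist of the two right-hand endpoints adds $1$ to the fraction, and rotation by $90^\circ$ followed by mirror image inverts the fraction. An integer tangle is a rational tangle whose fraction is an integer $n$, i.e. a horizontal row of $|n|$ half twists. Montesinos knots: a Montesinos knot with $r$ rational tangles, written $(\alpha_0;\alpha_1/\beta_1,\dots,\alpha_r/\beta_r)$, is a knot admitting a diagram of the following form. Place an integer tangle of fraction $\alpha_0\in\mathbb{Z}$ and rational tangles of fractions $\alpha_1/\beta_1,\dots,\alpha_r/\beta_r\in\mathbb{Q}\setminus\mathbb{Z}$ (so none of these is an integer tangle) in boxes arranged in this cyclic order around an annulus. Join the two right-hand endpoints (NE, SE) of each box to the two left-hand endpoints (NW, SW, respectively) of the next box by two parallel strands without crossings, with the last box joined in the same way to the first. Here $r$ counts only the non-integer rational tangles. *)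

theory Defs
  imports Complex_Main "HOL-Library.Multiset"
begin

section \<open>Diagrams on the sphere\<close>

text \<open>
  A diagram is a list of pieces. \<open>Cross a b c d\<close> is a crossing whose four ends lie on the edges
  \<open>a\<close>, \<open>b\<close>, \<open>c\<close>, \<open>d\<close>, listed counterclockwise; \<open>a\<close> and \<open>c\<close> belong to the strand passing under,
  \<open>b\<close> and \<open>d\<close> to the strand passing over. \<open>Arc a b\<close> is a marked point on a strand, where the edges
  \<open>a\<close> and \<open>b\<close> meet. Thus \<open>[Arc a a]\<close> is a circle without crossings.
\<close>

datatype 'e piece = Cross 'e 'e 'e 'e | Arc 'e 'e

type_synonym diagram = "nat piece list"

fun piece_ends :: "'e piece \<Rightarrow> 'e list" where
  "piece_ends (Cross a b c d) = [a, b, c, d]"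
| "piece_ends (Arc a b) = [a, b]"

definition all_ends :: "diagram \<Rightarrow> nat list" where
  "all_ends D = concat (map piece_ends D)"

abbreviation edges :: "diagram \<Rightarrow> nat set" where
  "edges D \<equiv> set (all_ends D)"

definition closed_diagram :: "diagram \<Rightarrow> bool" where
  "closed_diagram D \<longleftrightarrow> (\<forall>a \<in> edges D. count_list (all_ends D) a = 2)"

fun strand_pairs :: "'e piece \<Rightarrow> ('e \<times> 'e) set" where
  "strand_pairs (Cross a b c d) = {(a, c), (c, a), (b, d), (d, b)}"
| "strand_pairs (Arc a b) = {(a, b), (b, a)}"

definition one_component :: "diagram \<Rightarrow> bool" where
  "one_component D \<longleftrightarrow>
     D \<noteq> [] \<and> (\<forall>a \<in> edges D. \<forall>b \<in> edges D. (a, b) \<in> (\<Union>p \<in> set D. strand_pairs p)\<^sup>*)"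

text \<open>
  A closed diagram, with the cyclic order of the ends around each piece, is a combinatorial map:
  it determines a cellular embedding of a 4-valent graph (with 2-valent marked points) in a closed
  oriented surface. The faces of the embedding are the orbits of the permutation of the darts that
  runs to the other end of an edge and then turns to the next end of the piece found there.
\<close>

definition darts :: "diagram \<Rightarrow> (nat \<times> nat) set" where
  "darts D = {(i, k). i < length D \<and> k < length (piece_ends (D ! i))}"

fun dart_edge :: "diagram \<Rightarrow> nat \<times> nat \<Rightarrow> nat" where
  "dart_edge D (i, k) = piece_ends (D ! i) ! k"

fun next_end :: "diagram \<Rightarrow> nat \<times> nat \<Rightarrow> nat \<times> nat" where
  "next_end D (i, k) = (i, Suc k mod length (piece_ends (D ! i)))"

definition face_step :: "diagram \<Rightarrow> ((nat \<times> nat) \<times> (nat \<times> nat)) set" where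
  "face_step D = {(x, next_end D y) | x y.
     x \<in> darts D \<and> y \<in> darts D \<and> x \<noteq> y \<and> dart_edge D x = dart_edge D y}"

definition num_faces :: "diagram \<Rightarrow> nat" where
  "num_faces D = card (darts D // (face_step D)\<^sup>*)"

text \<open>
  The last condition says that the Euler characteristic is 2, i.e. that the surface is the sphere
  (a diagram with one component is connected).
\<close>

definition knot_diagram :: "diagram \<Rightarrow> bool" where
  "knot_diagram D \<longleftrightarrow> closed_diagram D \<and> one_component D \<and>
     length D + num_faces D = card (edges D) + 2"


section \<open>Knots\<close>

text \<open>
  The rules \<open>reorder\<close> to \<open>unmark\<close> relate different descriptions of the same diagram up to
  homeomorphism of the oriented sphere; the others are the Reidemeister moves, in all variants.
  In \<open>R2\<close>, \<open>t\<close> and \<open>q\<close> are the sides of the bigon; in \<open>R3\<close> and \<open>R3'\<close>, \<open>x\<close>, \<open>y\<close>, \<open>z\<close> are the sides of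
  the triangle, on the bottom, middle and top strand respectively. The edges inside the move are
  not used elsewhere in the diagram because \<open>isotopic\<close> below requires both sides to be knot
  diagrams. Since both sides are also required to be spherical, the two strands in \<open>R2\<close> have to be
  adjacent to a common face.
\<close>

inductive diagram_step :: "diagram \<Rightarrow> diagram \<Rightarrow> bool" where
  reorder: "mset D = mset E \<Longrightarrow> diagram_step D E"
| relabel: "inj_on f (edges D) \<Longrightarrow> diagram_step D (map (map_piece f) D)"
| turn: "diagram_step (Cross a b c d # D) (Cross c d a b # D)"
| flip: "diagram_step (Arc a b # D) (Arc b a # D)"
| unmark: "a \<noteq> b \<Longrightarrow> diagram_step (Arc a b # D) (map (map_piece (id(b := a))) D)"
| R1: "diagram_step (Cross a b b c # D) (Arc a c # D)"
| R1': "diagram_step (Cross a a b c # D) (Arc b c # D)"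
| R2: "diagram_step (Cross p t q s # Cross q t r u # D) (Arc p r # Arc s u # D)"
| R3: "diagram_step
    (Cross b1 m1 x y # Cross x t2 b2 z # Cross y z m2 t1 # D)
    (Cross b1 z x t1 # Cross x y b2 m2 # Cross m1 t2 y z # D)"
| R3': "diagram_step
    (Cross b1 y x m1 # Cross x z b2 t2 # Cross y t1 m2 z # D)
    (Cross b1 t1 x z # Cross x m2 b2 y # Cross m1 z y t2 # D)"

definition isotopic :: "diagram \<Rightarrow> diagram \<Rightarrow> bool" where
  "isotopic = equivclp (\<lambda>D E. knot_diagram D \<and> knot_diagram E \<and> diagram_step D E)"

text \<open>
  Reversing the orientation of the sphere while keeping all over/under information gives a diagram
  of the mirror image.
\<close>

fun reflect_piece :: "'e piece \<Rightarrow> 'e piece" where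
  "reflect_piece (Cross a b c d) = Cross a d c b"
| "reflect_piece (Arc a b) = Arc a b"

definition mirror_image :: "diagram \<Rightarrow> diagram" where
  "mirror_image D = map reflect_piece D"

definition same_knot :: "diagram \<Rightarrow> diagram \<Rightarrow> bool" where
  "same_knot D E \<longleftrightarrow> isotopic D E \<or> isotopic D (mirror_image E)"


section \<open>DT codes\<close>

text \<open>
  Walking along the knot, \<open>e j\<close> is the edge on which one arrives at the passage labelled \<open>j\<close>, and
  \<open>e (j + 1)\<close> the one on which one leaves. \<open>dt_crossing e i x p\<close> says that the crossing \<open>p\<close> carries
  the odd label \<open>i\<close> and the even label \<open>\<bar>x\<bar>\<close>, the even passage being under iff \<open>x < 0\<close>.
\<close>

fun dt_crossing :: "(nat \<Rightarrow> nat) \<Rightarrow> nat \<Rightarrow> int \<Rightarrow> nat piece \<Rightarrow> bool" where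
  "dt_crossing e i x (Cross a b c d) \<longleftrightarrow>
     (let j = nat \<bar>x\<bar>; u = (if x < 0 then j else i); v = (if x < 0 then i else j)
      in even j \<and> {a, c} = {e u, e (u + 1)} \<and> {b, d} = {e v, e (v + 1)})"
| "dt_crossing e i x (Arc a b) \<longleftrightarrow> False"

definition has_dt_code :: "diagram \<Rightarrow> int list \<Rightarrow> bool" where
  "has_dt_code D c \<longleftrightarrow> knot_diagram D \<and>
     (\<exists>e E. inj_on e {1..2 * length c} \<and> e (2 * length c + 1) = e 1 \<and>
        mset E = mset D \<and> length E = length c \<and>
        (\<forall>i < length c. dt_crossing e (2 * i + 1) (c ! i) (E ! i)))"

definition K11a43 :: "int list" where "K11a43 = [4, 8, 14, 2, 20, 16, 6, 18, 12, 22, 10]"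
definition K11a44 :: "int list" where "K11a44 = [4, 8, 14, 2, 20, 16, 18, 6, 12, 22, 10]"
definition K11a47 :: "int list" where "K11a47 = [4, 8, 14, 2, 20, 22, 18, 6, 12, 16, 10]"
definition K11a57 :: "int list" where "K11a57 = [4, 8, 16, 2, 20, 22, 18, 6, 12, 14, 10]"
definition K11a231 :: "int list" where "K11a231 = [4, 14, 10, 12, 18, 6, 2, 20, 22, 8, 16]"
definition K11a263 :: "int list" where "K11a263 = [6, 8, 16, 2, 20, 22, 18, 4, 12, 14, 10]"
definition K11n71 :: "int list" where "K11n71 = [4, 8, 14, 2, -20, 16, 6, 18, 12, -22, -10]"
definition K11n72 :: "int list" where "K11n72 = [4, 8, -14, 2, 20, 16, -6, 18, 12, 22, 10]"
definition K11n73 :: "int list" where "K11n73 = [4, 8, -14, 2, 20, -16, -6, -18, -12, 22, 10]"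
definition K11n74 :: "int list" where "K11n74 = [4, 8, -14, 2, -20, 16, -6, 18, 12, -22, -10]"
definition K11n75 :: "int list" where "K11n75 = [4, 8, -14, 2, -20, -16, -6, -18, -12, -22, -10]"
definition K11n76 :: "int list" where "K11n76 = [4, 8, 14, 2, -20, 16, 18, 6, 12, -22, -10]"
definition K11n77 :: "int list" where "K11n77 = [4, 8, -14, 2, 20, -16, -18, -6, -12, 22, 10]"
definition K11n78 :: "int list" where "K11n78 = [4, 8, -14, 2, -20, -16, -18, -6, -12, -22, -10]"
definition K11n81 :: "int list" where "K11n81 = [4, 8, -16, 2, -20, -22, -18, -6, -12, -14, -10]"


section \<open>Rational tangles\<close>

text \<open>A tangle in a box: its pieces and the edges at the four endpoints.\<close>

datatype tangle = Tangle (pieces: diagram) (NW: nat) (NE: nat) (SW: nat) (SE: nat)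

text \<open>
  The ends of the inner box become inner edges, and \<open>n\<close>, \<open>s\<close> are the new right-hand endpoints. In
  a positive half twist the overcrossing strand has positive slope, in a negative one it has
  negative slope.
\<close>

fun pos_twist :: "nat \<Rightarrow> nat \<Rightarrow> tangle \<Rightarrow> tangle" where
  "pos_twist n s (Tangle D nw ne sw se) = Tangle (Cross ne se s n # D) nw n sw s"

fun neg_twist :: "nat \<Rightarrow> nat \<Rightarrow> tangle \<Rightarrow> tangle" where
  "neg_twist n s (Tangle D nw ne sw se) = Tangle (Cross se s n ne # D) nw n sw s"

text \<open>Counterclockwise rotation by a right angle, followed by the exchange of over and under.\<close>

fun switch_piece :: "'e piece \<Rightarrow> 'e piece" where
  "switch_piece (Cross a b c d) = Cross b c d a"
| "switch_piece (Arc a b) = Arc a b"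

fun rotate_mirror :: "tangle \<Rightarrow> tangle" where
  "rotate_mirror (Tangle D nw ne sw se) = Tangle (map switch_piece D) ne se nw sw"

text \<open>Fractions in the rationals extended by infinity, which is represented by \<open>None\<close>.\<close>

fun invert_fraction :: "rat option \<Rightarrow> rat option" where
  "invert_fraction None = Some 0"
| "invert_fraction (Some q) = (if q = 0 then None else Some (1 / q))"

text \<open>
  \<open>rational_tangle T q\<close>: \<open>T\<close> is a diagram, built from two parallel arcs by half twists, of the
  rational tangle with fraction \<open>q\<close>. Conjugating right-hand half twists with powers of
  \<open>rotate_mirror\<close> gives the half twists on the other three sides.
\<close>

inductive rational_tangle :: "tangle \<Rightarrow> rat option \<Rightarrow> bool" where
  horizontal: "distinct [nw, ne, sw, se] \<Longrightarrow>
    rational_tangle (Tangle [Arc nw ne, Arc sw se] nw ne sw se) (Some 0)"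
| pos_twist: "rational_tangle T q \<Longrightarrow> n \<noteq> s \<Longrightarrow> {n, s} \<inter> edges (pieces T) = {} \<Longrightarrow>
    rational_tangle (pos_twist n s T) (map_option (\<lambda>x. x + 1) q)"
| neg_twist: "rational_tangle T q \<Longrightarrow> n \<noteq> s \<Longrightarrow> {n, s} \<inter> edges (pieces T) = {} \<Longrightarrow>
    rational_tangle (neg_twist n s T) (map_option (\<lambda>x. x - 1) q)"
| rotate_mirror: "rational_tangle T q \<Longrightarrow>
    rational_tangle (rotate_mirror T) (invert_fraction q)"


section \<open>Montesinos knots\<close>

fun disjoint_tangles :: "tangle list \<Rightarrow> bool" where
  "disjoint_tangles [] \<longleftrightarrow> True"
| "disjoint_tangles (T # Ts) \<longleftrightarrow>
     (\<forall>U \<in> set Ts. edges (pieces T) \<inter> edges (pieces U) = {}) \<and> disjoint_tangles Ts"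

definition join_boxes :: "tangle \<Rightarrow> tangle \<Rightarrow> diagram" where
  "join_boxes T U = [Arc (NE T) (NW U), Arc (SE T) (SW U)]"

definition annular_closure :: "tangle list \<Rightarrow> diagram" where
  "annular_closure Ts = concat (map pieces Ts) @ concat (map2 join_boxes Ts (rotate1 Ts))"

definition montesinos_diagram :: "int \<Rightarrow> rat list \<Rightarrow> diagram \<Rightarrow> bool" where
  "montesinos_diagram \<alpha>\<^sub>0 qs M \<longleftrightarrow>
     (\<forall>q \<in> set qs. q \<notin> \<int>) \<and>
     (\<exists>T\<^sub>0 Ts. rational_tangle T\<^sub>0 (Some (of_int \<alpha>\<^sub>0)) \<and>
        list_all2 (\<lambda>T q. rational_tangle T (Some q)) Ts qs \<and>
        disjoint_tangles (T\<^sub>0 # Ts) \<and>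
        M = annular_closure (T\<^sub>0 # Ts) \<and> knot_diagram M)"

definition montesinos_knot :: "nat \<Rightarrow> diagram \<Rightarrow> bool" where
  "montesinos_knot r D \<longleftrightarrow>
     (\<exists>\<alpha>\<^sub>0 qs M. length qs = r \<and> montesinos_diagram \<alpha>\<^sub>0 qs M \<and> same_knot D M)"

end

theory Submission
  imports Defs "HOL-Combinatorics.Permutations"
begin

text \<open>
  Removing the marked points from a suitable annular closure of one trivial and four rational
  tangles leaves a diagram with the given DT code, so no Reidemeister move is needed. It remains to
  see that all diagrams with this code agree up to mirror image. The code leaves open, for each
  crossing, on which side the even passage enters. On the sphere every cycle of edges modulo 2
  bounds a set of faces, so a loop of the knot has two sides, and following the sides along the knot
  fixes the crossings where the loop meets the rest of the knot relative to its base point. The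
  loops at a few crossings connect all crossings, so only a simultaneous change of all of them, that
  is, a reflection, is possible.
\<close>


section \<open>Darts\<close>

text \<open>That cycles bound is obtained by counting. With n crossings there are n + 2 faces, so at
  least 2^(n+2) sets of faces. Taking boundaries is at most two-to-one, and there are at most
  2^(n+1) cycles, so every cycle is hit. A set of faces bounded by a loop colours the sphere. The
  rest of the knot changes colour exactly where it meets the loop, and the colour on the left of the
  loop changes exactly where the loop crosses itself. Both can be read off the code. So the
  direction of every meeting is known once it is known on which side of the loop the rest of the
  knot lies near the base, and this is the sign of the base crossing. Sphericity does not see over
  and under. The absolute values of the nine non-alternating codes are those of three alternating
  ones, so only six projections have to be analysed. The long preliminaries are due to
  \<open>isotopic\<close>: both sides of each step must be knot diagrams, so every change of
  description must be shown to preserve the number of faces.\<close>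

lemma length_piece_ends: "length (piece_ends p) = 2 \<or> length (piece_ends p) = 4"
  by (cases p) auto

lemma darts_eq_Sigma: "darts D = (SIGMA i:{..<length D}. {..<length (piece_ends (D ! i))})"
  by (auto simp: darts_def)

lemma finite_darts [simp]: "finite (darts D)"
  by (simp add: darts_eq_Sigma)

lemma next_end_in_darts: "x \<in> darts D \<Longrightarrow> next_end D x \<in> darts D"
  by (cases x) (auto simp: darts_def intro!: mod_less_divisor)

lemma inj_on_next_end: "inj_on (next_end D) (darts D)"
proof (rule inj_onI)
  fix x y assume xy: "x \<in> darts D" "y \<in> darts D" "next_end D x = next_end D y"
  obtain i k where x: "x = (i, k)" by (cases x)
  obtain i' k' where y: "y = (i', k')" by (cases y)
  show "x = y"
    using xy by (auto simp: x y darts_def mod_Suc split: if_splits)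
qed

lemma card_darts_on_edge: "card {x \<in> darts D. dart_edge D x = a} = count_list (all_ends D) a"
proof -
  have "count_list (all_ends D) a = sum_list (map (\<lambda>p. count_list (piece_ends p) a) D)"
    unfolding all_ends_def by (induction D) auto
  also have "\<dots> = (\<Sum>i<length D. count_list (piece_ends (D ! i)) a)"
    by (simp add: sum_list_sum_nth atLeast0LessThan)
  also have "\<dots> = (\<Sum>i<length D. card {k. k < length (piece_ends (D ! i)) \<and> piece_ends (D ! i) ! k = a})"
    by (simp add: count_list_eq_length_filter length_filter_conv_card eq_commute)
  also have "\<dots> = card (SIGMA i:{..<length D}. {k. k < length (piece_ends (D ! i)) \<and> piece_ends (D ! i) ! k = a})"
    by (subst card_SigmaI) auto
  also have "(SIGMA i:{..<length D}. {k. k < length (piece_ends (D ! i)) \<and> piece_ends (D ! i) ! k = a})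
      = {x \<in> darts D. dart_edge D x = a}"
    by (auto simp: darts_def)
  finally show ?thesis ..
qed

lemma edges_eq_image_darts: "edges D = dart_edge D ` darts D"
proof (rule set_eqI)
  fix a
  have "a \<in> edges D \<longleftrightarrow> count_list (all_ends D) a \<noteq> 0"
    by (simp add: count_list_0_iff)
  also have "\<dots> \<longleftrightarrow> {x \<in> darts D. dart_edge D x = a} \<noteq> {}"
    by (simp flip: card_darts_on_edge)
  also have "\<dots> \<longleftrightarrow> a \<in> dart_edge D ` darts D"
    by blast
  finally show "a \<in> edges D \<longleftrightarrow> a \<in> dart_edge D ` darts D" .
qed

lemma closed_diagram_iff_card:
  "closed_diagram D \<longleftrightarrow> (\<forall>a \<in> edges D. card {x \<in> darts D. dart_edge D x = a} = 2)"
  by (simp add: closed_diagram_def card_darts_on_edge)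

text \<open>In a closed diagram this is the edge involution of the combinatorial map; it has no
  fixed points, and its orbits are the edges.\<close>

definition other_dart :: "diagram \<Rightarrow> nat \<times> nat \<Rightarrow> nat \<times> nat" where
  "other_dart D x = (THE y. y \<in> darts D \<and> y \<noteq> x \<and> dart_edge D y = dart_edge D x)"

lemma ex1_other_dart:
  assumes "closed_diagram D" "x \<in> darts D"
  shows "\<exists>!y. y \<in> darts D \<and> y \<noteq> x \<and> dart_edge D y = dart_edge D x"
proof -
  let ?A = "{y \<in> darts D. dart_edge D y = dart_edge D x}"
  have "card ?A = 2"
    using assms by (auto simp: closed_diagram_iff_card edges_eq_image_darts)
  then obtain u v where "?A = {u, v}" "u \<noteq> v"
    by (meson card_2_iff)
  moreover have "x \<in> ?A"
    using assms by simp
  ultimately have "x = u \<or> x = v" "?A = {u, v}" "?A = {v, u}" "u \<noteq> v"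
    by (simp_all only: insert_iff empty_iff simp_thms insert_commute)
  then obtain w where w: "?A = {x, w}" "w \<noteq> x"
    using that by metis
  then have "w \<in> ?A" "\<And>z. z \<in> ?A \<Longrightarrow> z = x \<or> z = w"
    by auto
  with w(2) show ?thesis
    by (intro ex1I[of _ w]) blast+
qed

lemma other_dart:
  assumes "closed_diagram D" "x \<in> darts D"
  shows "other_dart D x \<in> darts D" "other_dart D x \<noteq> x"
    "dart_edge D (other_dart D x) = dart_edge D x"
  unfolding other_dart_def using theI'[OF ex1_other_dart[OF assms]] by blast+

lemma other_dart_eqI:
  assumes "closed_diagram D" "x \<in> darts D" "y \<in> darts D" "x \<noteq> y" "dart_edge D y = dart_edge D x"
  shows "other_dart D x = y"
  unfolding other_dart_def
  by (rule the1_equality[OF ex1_other_dart[OF assms(1,2)]]) (use assms in auto)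

lemma other_dart_other_dart:
  assumes "closed_diagram D" "x \<in> darts D"
  shows "other_dart D (other_dart D x) = x"
  by (rule other_dart_eqI) (use assms other_dart[OF assms] in simp_all)

text \<open>Every dart has exactly one partner on its edge, so the relation is the graph of a map:
  the edge involution followed by the turn about the piece.\<close>

lemma face_step_eq:
  assumes "closed_diagram D"
  shows "face_step D = {(x, next_end D (other_dart D x)) | x. x \<in> darts D}"
proof (intro equalityI subrelI)
  fix u v assume "(u, v) \<in> face_step D"
  then obtain y where y: "v = next_end D y" "u \<in> darts D" "y \<in> darts D" "u \<noteq> y"
      "dart_edge D u = dart_edge D y"
    unfolding face_step_def by blast
  then have "other_dart D u = y"
    by (intro other_dart_eqI[OF assms]) simp_all
  with y show "(u, v) \<in> {(x, next_end D (other_dart D x)) | x. x \<in> darts D}" by blast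
next
  fix u v assume "(u, v) \<in> {(x, next_end D (other_dart D x)) | x. x \<in> darts D}"
  then have u: "u \<in> darts D" and v: "v = next_end D (other_dart D u)" by blast+
  show "(u, v) \<in> face_step D"
    unfolding face_step_def mem_Collect_eq
    by (rule exI[of _ u], rule exI[of _ "other_dart D u"])
      (use other_dart[OF assms u] u v in \<open>simp del: next_end.simps dart_edge.simps\<close>)
qed

lemma face_step_subset: "face_step D \<subseteq> darts D \<times> darts D"
proof
  fix z assume "z \<in> face_step D"
  then obtain x y where "z = (x, next_end D y)" "x \<in> darts D" "y \<in> darts D"
    unfolding face_step_def by blast
  then show "z \<in> darts D \<times> darts D"
    by (simp only: mem_Sigma_iff next_end_in_darts)
qed

section \<open>Faces\<close>

text \<open>The orbits of a permutation of a finite set are cycles, so going forward long enough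
  leads back.\<close>

lemma inj_graph_rtrancl_sym:
  assumes "finite A" "p ` A \<subseteq> A" "inj_on p A"
  shows "sym ({(x, p x) | x. x \<in> A}\<^sup>*)" (is "sym (?R\<^sup>*)")
proof -
  have p_step: "(p x, x) \<in> ?R\<^sup>*" if "x \<in> A" for x
  proof -
    define U where "U = ?R\<^sup>* `` {x}"
    define W where "W = ?R\<^sup>* `` {p x}"
    have WU: "W \<subseteq> U"
      using that by (auto simp: U_def W_def intro: converse_rtrancl_into_rtrancl)
    have "y \<in> A" if "(x, y) \<in> ?R\<^sup>*" for y
      using that \<open>x \<in> A\<close> assms(2) by (induction rule: rtrancl_induct) auto
    then have UA: "U \<subseteq> A"
      by (auto simp: U_def)
    have pU: "p ` U \<subseteq> W"
    proof
      fix z assume "z \<in> p ` U"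
      then obtain y where y: "(x, y) \<in> ?R\<^sup>*" "z = p y"
        by (auto simp: U_def)
      from y(1) have "(p x, p y) \<in> ?R\<^sup>*"
        using assms(2) that
      proof (induction rule: rtrancl_induct)
        case (step y z)
        have "(p y, p z) \<in> ?R"
          using step.hyps(2) assms(2) by auto
        with step show ?case
          by (meson rtrancl.rtrancl_into_rtrancl)
      qed auto
      then show "z \<in> W"
        by (simp add: W_def y)
    qed
    have fin: "finite U"
      using UA assms(1) by (rule finite_subset)
    \<comment> \<open>The forward orbit \<open>W\<close> of \<open>p x\<close> lies in the orbit
      \<open>U\<close> of \<open>x\<close> and contains the image of \<open>U\<close>. By
      injectivity it is no smaller, so both coincide and \<open>p x\<close> leads back to
      \<open>x\<close>.\<close>
    have "card U = card (p ` U)"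
      using assms(3) UA by (metis card_image inj_on_subset)
    also have "\<dots> \<le> card W"
      using pU fin WU by (meson card_mono finite_subset)
    finally have "W = U"
      using WU fin by (simp add: card_seteq)
    moreover have "x \<in> U"
      by (simp add: U_def)
    ultimately have "x \<in> ?R\<^sup>* `` {p x}"
      unfolding W_def by simp
    then show ?thesis by blast
  qed
  show ?thesis
  proof (rule symI)
    fix x y assume "(x, y) \<in> ?R\<^sup>*"
    then show "(y, x) \<in> ?R\<^sup>*"
    proof (induction rule: rtrancl_induct)
      case (step y z)
      then have "(z, y) \<in> ?R\<^sup>*"
        using p_step by auto
      with step.IH show ?case by simp
    qed simp
  qed
qed

lemma sym_face_step_rtrancl:
  assumes "closed_diagram D"
  shows "sym ((face_step D)\<^sup>*)"
proof -
  let ?p = "\<lambda>x. next_end D (other_dart D x)"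
  have "inj_on ?p (darts D)"
  proof (rule inj_onI)
    fix x y assume xy: "x \<in> darts D" "y \<in> darts D" "?p x = ?p y"
    then have "other_dart D x = other_dart D y"
      using inj_on_next_end other_dart(1)[OF assms] by (metis inj_onD)
    then show "x = y"
      using other_dart_other_dart[OF assms] xy by metis
  qed
  then show ?thesis
    unfolding face_step_eq[OF assms]
    by (intro inj_graph_rtrancl_sym) (auto simp: next_end_in_darts other_dart[OF assms])
qed

lemma rtrancl_map:
  assumes "(x, y) \<in> R\<^sup>*" "\<And>u v. (u, v) \<in> R \<Longrightarrow> (f u, f v) \<in> S\<^sup>*"
  shows "(f x, f y) \<in> S\<^sup>*"
  using assms(1) by (induction rule: rtrancl_induct) (auto dest: assms(2))

text \<open>Maps in both directions that respect the relations and are mutually inverse up to them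
  induce inverse bijections of the classes. The underlying sets may differ in size, as they do when
  a marked point is removed.\<close>

lemma card_quotient_rtrancl_eq:
  assumes "finite A" "finite B" "f ` A \<subseteq> B" "g ` B \<subseteq> A"
    and R: "sym (R\<^sup>*)" and S: "sym (S\<^sup>*)"
    and f: "\<And>x y. (x, y) \<in> R \<Longrightarrow> (f x, f y) \<in> S\<^sup>*"
    and g: "\<And>x y. (x, y) \<in> S \<Longrightarrow> (g x, g y) \<in> R\<^sup>*"
    and gf: "\<And>x. x \<in> A \<Longrightarrow> (g (f x), x) \<in> R\<^sup>*"
    and fg: "\<And>x. x \<in> B \<Longrightarrow> (f (g x), x) \<in> S\<^sup>*"
  shows "card (A // R\<^sup>*) = card (B // S\<^sup>*)"
proof -
  \<comment> \<open>One inequality, for arbitrary data so that it can be used in both directions: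
    \<open>g\<close> induces a map from the classes of \<open>S\<close> that reaches every class of
    \<open>R\<close>.\<close>
  have *: "card (A // R\<^sup>*) \<le> card (B // S\<^sup>*)"
    if "finite B" "f ` A \<subseteq> B" and R: "sym (R\<^sup>*)" and S: "sym (S\<^sup>*)"
    and f: "\<And>x y. (x, y) \<in> R \<Longrightarrow> (f x, f y) \<in> S\<^sup>*"
    and g: "\<And>x y. (x, y) \<in> S \<Longrightarrow> (g x, g y) \<in> R\<^sup>*"
    and gf: "\<And>x. x \<in> A \<Longrightarrow> (g (f x), x) \<in> R\<^sup>*"
    for A :: "'c set" and B :: "'d set" and R S f g
  proof -
    have eqR: "equiv UNIV (R\<^sup>*)" and eqS: "equiv UNIV (S\<^sup>*)"
      using R S by (auto simp: equiv_def refl_rtrancl trans_rtrancl)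
    let ?h = "\<lambda>Y. R\<^sup>* `` (g ` Y)"
    have h: "?h (S\<^sup>* `` {f x}) = R\<^sup>* `` {x}" if "x \<in> A" for x
    proof (intro equalityI subsetI)
      fix y assume "y \<in> ?h (S\<^sup>* `` {f x})"
      then obtain u where u: "(f x, u) \<in> S\<^sup>*" "(g u, y) \<in> R\<^sup>*" by auto
      then have "(g (f x), g u) \<in> R\<^sup>*" using g by (metis rtrancl_map)
      with u gf[OF that] R show "y \<in> R\<^sup>* `` {x}"
        by (simp, meson rtrancl_trans symD)
    next
      fix y assume "y \<in> R\<^sup>* `` {x}"
      then have "(g (f x), y) \<in> R\<^sup>*"
        using gf[OF that] by auto
      then show "y \<in> ?h (S\<^sup>* `` {f x})" by auto
    qed
    have "A // R\<^sup>* \<subseteq> ?h ` (B // S\<^sup>*)"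
    proof
      fix X assume "X \<in> A // R\<^sup>*"
      then obtain x where x: "x \<in> A" "X = R\<^sup>* `` {x}" by (auto elim: quotientE)
      then have "S\<^sup>* `` {f x} \<in> B // S\<^sup>*" using that(2) by (auto intro: quotientI)
      with h[OF x(1)] x(2) show "X \<in> ?h ` (B // S\<^sup>*)" by blast
    qed
    moreover have "finite (B // S\<^sup>*)"
      using \<open>finite B\<close> by (simp add: quotient_def)
    ultimately show ?thesis
      by (meson surj_card_le)
  qed
  show ?thesis
    using *[of B f A R S g] *[of A g B S R f] assms by fastforce
qed

text \<open>Half a turn about the piece: two places at a crossing, one at a marked point. In both
  cases this is the other end of the same strand.\<close>

definition opposite_end :: "diagram \<Rightarrow> nat \<times> nat \<Rightarrow> nat \<times> nat" where
  "opposite_end D x = (fst x,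
     (snd x + length (piece_ends (D ! fst x)) div 2) mod length (piece_ends (D ! fst x)))"

lemma opposite_end_in_darts: "x \<in> darts D \<Longrightarrow> opposite_end D x \<in> darts D"
  using length_piece_ends[of "D ! fst x"] unfolding opposite_end_def darts_def
  by (cases x) (simp del: length_0_conv length_greater_0_conv add: mod_less_divisor)

lemma UN_set_nth: "(\<Union>p \<in> set D. f p) = (\<Union>i<length D. f (D ! i))"
  by (auto simp: set_conv_nth)

lemma UN_image_eq: "(\<Union>i\<in>I. h i ` A i) = (\<lambda>(i, k). h i k) ` (SIGMA i:I. A i)"
  by force

lemma strand_pairs_eq_image: "strand_pairs p =
  (\<lambda>k. (piece_ends p ! k,
    piece_ends p ! ((k + length (piece_ends p) div 2) mod length (piece_ends p))))
   ` {..<length (piece_ends p)}"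
proof (cases p)
  case (Cross a b c d)
  then show ?thesis
    by (simp add: lessThan_Suc) auto
next
  case (Arc a b)
  then show ?thesis
    by (simp add: lessThan_Suc insert_commute)
qed

lemma Union_strand_pairs:
  "(\<Union>p \<in> set D. strand_pairs p) =
    {(dart_edge D x, dart_edge D (opposite_end D x)) | x. x \<in> darts D}" (is "?L = ?R")
proof -
  let ?h = "\<lambda>i k. (piece_ends (D ! i) ! k, piece_ends (D ! i) !
      ((k + length (piece_ends (D ! i)) div 2) mod length (piece_ends (D ! i))))"
  have "?L = (\<Union>i<length D. strand_pairs (D ! i))"
    by (rule UN_set_nth)
  also have "\<dots> = (\<Union>i<length D. ?h i ` {..<length (piece_ends (D ! i))})"
    by (simp only: strand_pairs_eq_image)
  also have "\<dots> = (\<lambda>(i, k). ?h i k) ` darts D"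
    unfolding darts_eq_Sigma by (rule UN_image_eq)
  also have "(\<lambda>(i, k). ?h i k) = (\<lambda>x. (dart_edge D x, dart_edge D (opposite_end D x)))"
    by (simp add: opposite_end_def fun_eq_iff)
  finally show ?thesis by blast
qed

declare dart_edge.simps [simp del] next_end.simps [simp del] split_paired_all split_paired_All split_paired_Ex [simp del]

lemma face_step_iff:
  assumes "closed_diagram D"
  shows "(x, y) \<in> face_step D \<longleftrightarrow> x \<in> darts D \<and> y = next_end D (other_dart D x)"
  unfolding face_step_eq[OF assms] by auto

section \<open>Isomorphic diagrams\<close>

text \<open>Edges and strands are matched, but the cyclic order of the ends is left out on purpose:
  the same notion then serves isomorphisms that keep the order and reflections that reverse
  it.\<close>

definition dart_iso :: "(nat \<times> nat \<Rightarrow> nat \<times> nat) \<Rightarrow> (nat \<Rightarrow> nat) \<Rightarrow> diagram \<Rightarrow> diagram \<Rightarrow> bool" where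
  "dart_iso \<phi> h D E \<longleftrightarrow> length D = length E \<and> bij_betw \<phi> (darts D) (darts E) \<and> inj_on h (edges D) \<and>
     (\<forall>x \<in> darts D. dart_edge E (\<phi> x) = h (dart_edge D x) \<and>
        \<phi> (opposite_end D x) = opposite_end E (\<phi> x))"

lemma dart_isoD:
  assumes "dart_iso \<phi> h D E"
  shows "length D = length E" "bij_betw \<phi> (darts D) (darts E)" "inj_on h (edges D)"
    "\<And>x. x \<in> darts D \<Longrightarrow> \<phi> x \<in> darts E"
    "\<And>x. x \<in> darts D \<Longrightarrow> dart_edge E (\<phi> x) = h (dart_edge D x)"
    "\<And>x. x \<in> darts D \<Longrightarrow> opposite_end E (\<phi> x) = \<phi> (opposite_end D x)"
  using assms bij_betwE by (auto simp: dart_iso_def)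

lemma dart_in_edges: "x \<in> darts D \<Longrightarrow> dart_edge D x \<in> edges D"
  unfolding edges_eq_image_darts by (rule imageI)

lemma dart_iso_edges:
  assumes "dart_iso \<phi> h D E"
  shows "edges E = h ` edges D"
proof -
  have "edges E = dart_edge E ` \<phi> ` darts D"
    using dart_isoD(2)[OF assms] by (simp add: edges_eq_image_darts bij_betw_imp_surj_on)
  also have "\<dots> = h ` dart_edge D ` darts D"
    using dart_isoD(5)[OF assms] by (auto simp: image_image simp del: dart_edge.simps)
  finally show ?thesis
    by (simp add: edges_eq_image_darts)
qed

lemma dart_iso_closed_diagram_iff:
  assumes "dart_iso \<phi> h D E"
  shows "closed_diagram E \<longleftrightarrow> closed_diagram D"
proof -
  have "card {y \<in> darts E. dart_edge E y = h a} = card {x \<in> darts D. dart_edge D x = a}"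
    if "a \<in> edges D" for a
  proof -
    have eq: "dart_edge E (\<phi> x) = h a \<longleftrightarrow> dart_edge D x = a" if "x \<in> darts D" for x
      using dart_isoD(5)[OF assms that]
        inj_on_eq_iff[OF dart_isoD(3)[OF assms] dart_in_edges[OF that] \<open>a \<in> edges D\<close>] by simp
    have "bij_betw \<phi> {x \<in> darts D. dart_edge D x = a} {y \<in> darts E. dart_edge E y = h a}"
      by (rule bij_betw_Collect[OF dart_isoD(2)[OF assms]]) (rule eq)
    then show ?thesis
      by (rule bij_betw_same_card[symmetric])
  qed
  then show ?thesis
    by (simp add: closed_diagram_iff_card dart_iso_edges[OF assms])
qed

lemma one_component_iff_darts:
  "one_component D \<longleftrightarrow> D \<noteq> [] \<and> (\<forall>x \<in> darts D. \<forall>y \<in> darts D.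
     (dart_edge D x, dart_edge D y) \<in>
       {(dart_edge D x, dart_edge D (opposite_end D x)) | x. x \<in> darts D}\<^sup>*)"
  unfolding one_component_def Union_strand_pairs by (simp add: edges_eq_image_darts)

lemma dart_iso_one_component:
  assumes "dart_iso \<phi> h D E" "one_component D"
  shows "one_component E"
proof -
  note iso = dart_isoD[OF assms(1)]
  let ?R = "\<lambda>D. {(dart_edge D x, dart_edge D (opposite_end D x)) | x. x \<in> darts D}"
  have step: "(h a, h b) \<in> (?R E)\<^sup>*" if ab: "(a, b) \<in> ?R D" for a b
  proof -
    from ab obtain x where x: "x \<in> darts D" "a = dart_edge D x" "b = dart_edge D (opposite_end D x)"
      by auto
    then have "h a = dart_edge E (\<phi> x)" "h b = dart_edge E (opposite_end E (\<phi> x))" "\<phi> x \<in> darts E"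
      using iso(4-6)[OF x(1)] iso(5)[OF opposite_end_in_darts[OF x(1)]] by simp_all
    then have "(h a, h b) \<in> ?R E"
      by (intro CollectI exI[of _ "\<phi> x"]) simp
    then show ?thesis ..
  qed
  have "(dart_edge E y, dart_edge E y') \<in> (?R E)\<^sup>*" if "y \<in> darts E" "y' \<in> darts E" for y y'
  proof -
    have "y \<in> \<phi> ` darts D" "y' \<in> \<phi> ` darts D"
      using iso(2) that by (simp_all only: bij_betw_def)
    then obtain x x' where x: "x \<in> darts D" "x' \<in> darts D" "y = \<phi> x" "y' = \<phi> x'"
      by (elim imageE)
    have "(dart_edge D x, dart_edge D x') \<in> (?R D)\<^sup>*"
      using assms(2) x(1,2) by (simp only: one_component_iff_darts)
    then have "(h (dart_edge D x), h (dart_edge D x')) \<in> (?R E)\<^sup>*"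
      by (rule rtrancl_map) (rule step)
    then show ?thesis
      using iso(5) x by simp
  qed
  moreover have "E \<noteq> []"
    using assms(2) iso(1) by (auto simp: one_component_def)
  ultimately show ?thesis
    by (simp only: one_component_iff_darts) simp
qed

lemma dart_iso_other_dart:
  assumes "dart_iso \<phi> h D E" "closed_diagram D" "x \<in> darts D"
  shows "other_dart E (\<phi> x) = \<phi> (other_dart D x)"
proof (rule other_dart_eqI)
  note iso = dart_isoD[OF assms(1)] and x' = other_dart[OF assms(2,3)]
  show "closed_diagram E"
    using assms by (simp add: dart_iso_closed_diagram_iff)
  show "\<phi> x \<in> darts E" "\<phi> (other_dart D x) \<in> darts E"
    using iso(4) x' assms(3) by simp_all
  show "\<phi> x \<noteq> \<phi> (other_dart D x)"
    using iso(2) x' assms(3) by (metis bij_betw_inv_into_left)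
  show "dart_edge E (\<phi> (other_dart D x)) = dart_edge E (\<phi> x)"
    using iso(5) x' assms(3) by simp
qed

text \<open>Steps may be matched in either direction, because a face is the same orbit when
  traversed backwards; this is what reflections require.\<close>

lemma num_faces_eqI:
  assumes "closed_diagram D" "closed_diagram E" and f: "bij_betw f (darts D) (darts E)"
    and step: "\<And>x. x \<in> darts D \<Longrightarrow> (f x, f (next_end D (other_dart D x))) \<in> face_step E \<or>
      (f (next_end D (other_dart D x)), f x) \<in> face_step E"
    and step': "\<And>y z. (y, z) \<in> face_step E \<Longrightarrow> \<exists>u v. ((u, v) \<in> face_step D \<or> (v, u) \<in> face_step D) \<and>
      y = f u \<and> z = f v"
  shows "num_faces D = num_faces E"
  unfolding num_faces_def
proof (rule card_quotient_rtrancl_eq[where f = f and g = "inv_into (darts D) f"])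
  note R = sym_face_step_rtrancl[OF assms(1)] and S = sym_face_step_rtrancl[OF assms(2)]
  show "sym ((face_step D)\<^sup>*)" "sym ((face_step E)\<^sup>*)"
    by fact+
  show "f ` darts D \<subseteq> darts E" "inv_into (darts D) f ` darts E \<subseteq> darts D"
    using f bij_betw_inv_into by (auto simp: bij_betw_def inv_into_into)
  show "(inv_into (darts D) f (f x), x) \<in> (face_step D)\<^sup>*" if "x \<in> darts D" for x
    using f that by (simp add: bij_betw_inv_into_left)
  show "(f (inv_into (darts D) f y), y) \<in> (face_step E)\<^sup>*" if "y \<in> darts E" for y
    using f that by (simp add: bij_betw_inv_into_right)
  show "(f x, f y) \<in> (face_step E)\<^sup>*" if "(x, y) \<in> face_step D" for x y
  proof -
    have "x \<in> darts D" "y = next_end D (other_dart D x)"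
      using that by (simp_all add: face_step_iff[OF assms(1)])
    then show ?thesis
      using step S by (meson r_into_rtrancl symD)
  qed
  show "(inv_into (darts D) f y, inv_into (darts D) f z) \<in> (face_step D)\<^sup>*"
    if yz: "(y, z) \<in> face_step E" for y z
  proof -
    obtain u v where uv: "(u, v) \<in> face_step D \<or> (v, u) \<in> face_step D" "y = f u" "z = f v"
      using step'[OF yz] by blast
    then have "u \<in> darts D" "v \<in> darts D"
      using face_step_subset by blast+
    then have "inv_into (darts D) f y = u" "inv_into (darts D) f z = v"
      using f uv by (auto simp: bij_betw_inv_into_left)
    then show ?thesis
      using uv(1) R by (meson r_into_rtrancl symD)
  qed
qed simp_all

lemma dart_iso_knot_diagram:
  assumes iso: "dart_iso \<phi> h D E" and "num_faces D = num_faces E" and "knot_diagram D"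
  shows "knot_diagram E"
proof -
  have "card (edges E) = card (edges D)"
    using dart_isoD(3)[OF iso] by (simp add: dart_iso_edges[OF iso] card_image)
  then show ?thesis
    using assms dart_isoD(1)[OF iso] dart_iso_one_component[OF iso]
    by (simp add: knot_diagram_def dart_iso_closed_diagram_iff[OF iso])
qed

lemma knot_diagram_orientation_preserving:
  assumes iso: "dart_iso \<phi> h D E"
    and next_end: "\<And>x. x \<in> darts D \<Longrightarrow> next_end E (\<phi> x) = \<phi> (next_end D x)"
    and D: "knot_diagram D"
  shows "knot_diagram E"
proof (rule dart_iso_knot_diagram[OF iso _ D])
  have cD: "closed_diagram D" and cE: "closed_diagram E"
    using D dart_iso_closed_diagram_iff[OF iso] by (auto simp: knot_diagram_def)
  have *: "next_end E (other_dart E (\<phi> x)) = \<phi> (next_end D (other_dart D x))" if "x \<in> darts D" for x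
    using dart_iso_other_dart[OF iso cD that] next_end other_dart(1)[OF cD that] by simp
  show "num_faces D = num_faces E"
  proof (rule num_faces_eqI[OF cD cE dart_isoD(2)[OF iso]])
    show "(\<phi> x, \<phi> (next_end D (other_dart D x))) \<in> face_step E \<or>
        (\<phi> (next_end D (other_dart D x)), \<phi> x) \<in> face_step E" if "x \<in> darts D" for x
      using *[OF that] dart_isoD(4)[OF iso that] by (simp add: face_step_iff[OF cE])
    fix y z assume yz: "(y, z) \<in> face_step E"
    then have "y \<in> \<phi> ` darts D"
      using face_step_subset[of E] dart_isoD(2)[OF iso] by (simp only: bij_betw_def) blast
    then obtain x where x: "x \<in> darts D" "y = \<phi> x"
      by blast
    moreover have "z = next_end E (other_dart E y)"
      using yz by (simp add: face_step_iff[OF cE])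
    ultimately show "\<exists>u v. ((u, v) \<in> face_step D \<or> (v, u) \<in> face_step D) \<and> y = \<phi> u \<and> z = \<phi> v"
      using * by (intro exI[of _ x] exI[of _ "next_end D (other_dart D x)"])
        (simp add: face_step_iff[OF cD])
  qed
qed

text \<open>Reversing all cyclic orders turns the face permutation into a conjugate of its inverse.
  The conjugating map is \<phi> after the edge involution, since a face traversed backwards meets
  each of its edges at the other end.\<close>

lemma knot_diagram_orientation_reversing:
  assumes iso: "dart_iso \<phi> h D E"
    and next_end: "\<And>x. x \<in> darts D \<Longrightarrow> next_end E (\<phi> (next_end D x)) = \<phi> x"
    and D: "knot_diagram D"
  shows "knot_diagram E"
proof (rule dart_iso_knot_diagram[OF iso _ D])
  have cD: "closed_diagram D" and cE: "closed_diagram E"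
    using D dart_iso_closed_diagram_iff[OF iso] by (auto simp: knot_diagram_def)
  let ?p = "\<lambda>x. next_end D (other_dart D x)"
  let ?f = "\<lambda>x. \<phi> (other_dart D x)"
  have p: "?p x \<in> darts D" if "x \<in> darts D" for x
    using that cD by (simp add: next_end_in_darts other_dart)
  have "bij_betw (other_dart D) (darts D) (darts D)"
    by (rule bij_betw_byWitness[where f' = "other_dart D"])
      (use other_dart_other_dart[OF cD] other_dart(1)[OF cD] in auto)
  then have f: "bij_betw ?f (darts D) (darts E)"
    using bij_betw_trans[OF _ dart_isoD(2)[OF iso]] by (simp add: comp_def)
  have step: "(?f (?p x), ?f x) \<in> face_step E" if "x \<in> darts D" for x
  proof -
    have "?f x = next_end E (other_dart E (?f (?p x)))"
      using dart_iso_other_dart[OF iso cD] other_dart[OF cD] other_dart_other_dart[OF cD] p that next_end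
      by simp
    moreover have "?f (?p x) \<in> darts E"
      using f p[OF that] bij_betwE by blast
    ultimately show ?thesis
      by (simp add: face_step_iff[OF cE])
  qed
  have surj_p: "?p ` darts D = darts D"
  proof (rule endo_inj_surj)
    show "inj_on ?p (darts D)"
      by (rule comp_inj_on[OF inj_on_inverseI[of _ "other_dart D" "other_dart D"], unfolded comp_def])
        (use inj_on_next_end[of D] other_dart(1)[OF cD] other_dart_other_dart[OF cD] in
          \<open>auto simp: inj_on_def\<close>)
  qed (use p in auto)
  show "num_faces D = num_faces E"
  proof (rule num_faces_eqI[OF cD cE f])
    show "(?f x, ?f (?p x)) \<in> face_step E \<or> (?f (?p x), ?f x) \<in> face_step E" if "x \<in> darts D" for x
      using step[OF that] ..
    fix y z assume yz: "(y, z) \<in> face_step E"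
    then have "y \<in> ?f ` darts D"
      using f face_step_subset[of E] by (simp only: bij_betw_def) blast
    then have "y \<in> ?f ` ?p ` darts D"
      by (simp only: surj_p)
    then obtain x where x: "x \<in> darts D" "y = ?f (?p x)"
      by blast
    moreover have "z = ?f x"
      using step[OF x(1)] yz x(2) by (simp add: face_step_iff[OF cE])
    ultimately show "\<exists>u v. ((u, v) \<in> face_step D \<or> (v, u) \<in> face_step D) \<and> y = ?f u \<and> z = ?f v"
      by (intro exI[of _ "?p x"] exI[of _ x]) (simp add: face_step_iff[OF cD])
  qed
qed

section \<open>Changes of description that preserve knot diagrams\<close>

lemma dart_edge_eq: "dart_edge D x = piece_ends (D ! fst x) ! snd x"
  by (cases x) (simp add: dart_edge.simps)

lemma next_end_eq: "next_end D x = (fst x, Suc (snd x) mod length (piece_ends (D ! fst x)))"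
  by (cases x) (simp add: next_end.simps)

lemma in_darts_iff: "x \<in> darts D \<longleftrightarrow> fst x < length D \<and> snd x < length (piece_ends (D ! fst x))"
  by (cases x) (simp add: darts_def)

lemma piece_ends_map_piece [simp]: "piece_ends (map_piece f p) = map f (piece_ends p)"
  by (cases p) auto

lemma all_ends_map_piece: "all_ends (map (map_piece f) D) = map f (all_ends D)"
  by (simp add: all_ends_def map_concat comp_def)

lemma piece_ends_subset_edges: "p \<in> set D \<Longrightarrow> set (piece_ends p) \<subseteq> edges D"
  by (auto simp: all_ends_def)

lemma map_piece_cong_edges:
  assumes "\<And>a. a \<in> edges D \<Longrightarrow> f a = g a"
  shows "map (map_piece f) D = map (map_piece g) D"
proof (rule map_cong[OF refl])
  fix p assume "p \<in> set D"
  then have "f a = g a" if "a \<in> set (piece_ends p)" for a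
    using assms piece_ends_subset_edges that by blast
  then show "map_piece f p = map_piece g p"
    by (cases p) auto
qed

lemma knot_diagram_reorder:
  assumes "mset D = mset E" "knot_diagram D"
  shows "knot_diagram E"
proof -
  obtain p where p: "p permutes {..<length E}" "permute_list p E = D"
    using mset_eq_permutation[OF assms(1)] by blast
  let ?\<phi> = "\<lambda>x. (p (fst x), snd x)"
  have len: "length D = length E"
    using p(2) by auto
  have nth: "D ! i = E ! p i" if "i < length E" for i
    using p that by (metis permute_list_nth)
  have dart: "x \<in> darts D \<longleftrightarrow> fst x < length E \<and> snd x < length (piece_ends (E ! p (fst x)))" for x
    using nth len by (cases x) (auto simp: darts_def)
  have bij: "bij_betw ?\<phi> (darts D) (darts E)"
  proof (rule bij_betw_imageI)
    show "inj_on ?\<phi> (darts D)"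
      using permutes_inj[OF p(1)] by (auto simp: inj_on_def prod_eq_iff)
    show "?\<phi> ` darts D = darts E"
    proof (intro equalityI subsetI)
      fix y assume "y \<in> ?\<phi> ` darts D"
      then show "y \<in> darts E"
        using permutes_in_image[OF p(1)] dart by (auto simp: darts_def)
    next
      fix y assume y: "y \<in> darts E"
      have "p (inv p (fst y)) = fst y" "inv p (fst y) < length E"
        using permutes_inverses(1)[OF p(1)] permutes_in_image[OF permutes_inv[OF p(1)]] y
        by (auto simp: darts_def)
      then have "(inv p (fst y), snd y) \<in> darts D" "y = ?\<phi> (inv p (fst y), snd y)"
        using y dart by (auto simp: darts_def)
      then show "y \<in> ?\<phi> ` darts D"
        by blast
    qed
  qed
  have iso: "dart_iso ?\<phi> id D E"
    unfolding dart_iso_def using len bij dart nth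
    by (auto simp: dart_edge_eq opposite_end_def)
  show ?thesis
  proof (rule knot_diagram_orientation_preserving[OF iso _ assms(2)])
    fix x assume "x \<in> darts D"
    then show "next_end E (?\<phi> x) = ?\<phi> (next_end D x)"
      using dart nth by (simp add: next_end_eq)
  qed
qed

lemma knot_diagram_relabel:
  assumes f: "inj_on f (edges D)" and D: "knot_diagram D"
  shows "knot_diagram (map (map_piece f) D)" (is "knot_diagram ?E")
proof -
  have len: "length (piece_ends (?E ! i)) = length (piece_ends (D ! i))" if "i < length D" for i
    using that by simp
  have "darts ?E = darts D"
    by (auto simp: darts_def)
  then have iso: "dart_iso (\<lambda>x. x) f D ?E"
    using f by (auto simp: dart_iso_def bij_betw_def dart_edge_eq opposite_end_def in_darts_iff)
  show ?thesis
  proof (rule knot_diagram_orientation_preserving[OF iso _ D])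
    fix x assume "x \<in> darts D"
    then show "next_end ?E x = next_end D x"
      by (auto simp: next_end_eq in_darts_iff)
  qed
qed

lemma knot_diagram_relabel_iff:
  assumes f: "inj_on f (edges D)"
  shows "knot_diagram (map (map_piece f) D) \<longleftrightarrow> knot_diagram D"
proof
  let ?g = "inv_into (edges D) f"
  assume "knot_diagram (map (map_piece f) D)"
  moreover have "inj_on ?g (edges (map (map_piece f) D))"
    by (simp add: all_ends_map_piece inj_on_inv_into)
  ultimately have "knot_diagram (map (map_piece ?g) (map (map_piece f) D))"
    by (rule knot_diagram_relabel[rotated])
  also have "map (map_piece ?g) (map (map_piece f) D) = map (map_piece id) D"
    unfolding map_map comp_def piece.map_comp
    by (rule map_piece_cong_edges) (simp add: f)
  finally show "knot_diagram D"
    by (simp add: piece.map_id0 list.map_id)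
qed (rule knot_diagram_relabel[OF f])

lemma add_mod_eqD:
  fixes a b r l :: nat
  assumes "(a + r) mod l = (b + r) mod l" "a < l" "b < l"
  shows "a = b"
proof -
  have "int (a + r) mod int l = int (b + r) mod int l"
    using assms(1) by (metis zmod_int)
  then have "(int (a + r) - int r) mod int l = (int (b + r) - int r) mod int l"
    by (rule mod_diff_cong) simp
  then show ?thesis
    using assms(2,3) by simp
qed

text \<open>Turning each piece by its own amount preserves edges, strands and cyclic orders. A
  quarter turn of a crossing exchanges over and under, so this also covers crossing changes.\<close>

lemma knot_diagram_rotate:
  assumes DE: "list_all2 (\<lambda>p q. \<exists>r. piece_ends q = rotate r (piece_ends p)) D E" and E: "knot_diagram E"
  shows "knot_diagram D"
proof -
  have len: "length D = length E"
    using DE by (simp add: list_all2_lengthD)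
  have "\<forall>i\<in>{..<length E}. \<exists>r. piece_ends (E ! i) = rotate r (piece_ends (D ! i))"
    using DE by (simp add: list_all2_conv_all_nth)
  then obtain r where r: "\<forall>i\<in>{..<length E}. piece_ends (E ! i) = rotate (r i) (piece_ends (D ! i))"
    by (rule bchoice[THEN exE])
  let ?l = "\<lambda>i. length (piece_ends (D ! i))"
  let ?\<phi> = "\<lambda>x. (fst x, (snd x + r (fst x)) mod ?l (fst x))"
  have l: "length (piece_ends (E ! i)) = ?l i" if "i < length E" for i
    using r that by simp
  have l0: "?l i > 0" for i
    using length_piece_ends[of "D ! i"] by (auto simp del: length_greater_0_conv)
  have nth: "piece_ends (E ! i) ! k = piece_ends (D ! i) ! ((k + r i) mod ?l i)" if "i < length E" "k < ?l i" for i k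
    using r that by (simp add: nth_rotate add.commute)
  have darts_eq: "darts E = darts D"
    using l len by (auto simp: darts_def)
  have inj: "inj_on ?\<phi> (darts D)"
  proof (rule inj_onI)
    fix x y assume x: "x \<in> darts D" and y: "y \<in> darts D" and xy: "?\<phi> x = ?\<phi> y"
    then show "x = y"
      using add_mod_eqD[of "snd x" "r (fst x)" "?l (fst x)" "snd y"] by (auto simp: in_darts_iff prod_eq_iff)
  qed
  have "?\<phi> ` darts D \<subseteq> darts D"
    using l0 by (auto simp: darts_eq_Sigma)
  then have bij: "bij_betw ?\<phi> (darts E) (darts D)"
    unfolding darts_eq using inj by (simp add: bij_betw_def endo_inj_surj)
  have iso: "dart_iso ?\<phi> id E D"
    unfolding dart_iso_def
  proof (intro conjI ballI bij)
    fix x assume "x \<in> darts E"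
    then have x: "fst x < length E" "snd x < ?l (fst x)"
      using l by (auto simp: darts_def)
    then show "dart_edge D (?\<phi> x) = id (dart_edge E x)"
      using nth by (simp add: dart_edge_eq)
    show "?\<phi> (opposite_end E x) = opposite_end D (?\<phi> x)"
      using x l by (simp add: opposite_end_def mod_simps add_ac)
  qed (simp_all add: len)
  show ?thesis
  proof (rule knot_diagram_orientation_preserving[OF iso _ E])
    fix x assume "x \<in> darts E"
    then have x: "fst x < length E" "snd x < ?l (fst x)"
      using l by (auto simp: darts_def)
    then show "next_end D (?\<phi> x) = ?\<phi> (next_end E x)"
      using l by (simp add: next_end_eq mod_simps)
  qed
qed

lemma length_piece_ends_reflect [simp]: "length (piece_ends (reflect_piece p)) = length (piece_ends p)"
  by (cases p) auto

lemma knot_diagram_mirror_image: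
  assumes D: "knot_diagram D"
  shows "knot_diagram (mirror_image D)" (is "knot_diagram ?E")
proof -
  let ?l = "\<lambda>i. length (piece_ends (D ! i))"
  \<comment> \<open>Reflection fixes the first end of a piece and reverses the cyclic order, so
    position k goes to minus k modulo the valence; the outer \<open>mod\<close> keeps 0 at
    0.\<close>
  let ?\<phi> = "\<lambda>x. (fst x, (?l (fst x) - snd x) mod ?l (fst x))"
  have len: "length ?E = length D" and nth: "\<And>i. i < length D \<Longrightarrow> ?E ! i = reflect_piece (D ! i)"
    by (auto simp: mirror_image_def)
  have darts_eq: "darts ?E = darts D"
    using len nth by (auto simp: darts_def)
  have cases4: "k = 0 \<or> k = 1 \<or> k = 2 \<or> k = 3" if "k < 4" for k :: nat
    using that by auto
  have cases2: "k = 0 \<or> k = 1" if "k < 2" for k :: nat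
    using that by auto
  have reflect: "piece_ends (reflect_piece p) ! ((length (piece_ends p) - k) mod length (piece_ends p)) = piece_ends p ! k"
    if "k < length (piece_ends p)" for p :: "nat piece" and k
  proof (cases p)
    case (Cross a b c d)
    then have "k = 0 \<or> k = 1 \<or> k = 2 \<or> k = 3"
      using that cases4 by simp
    then show ?thesis
      by (elim disjE) (simp_all add: Cross)
  next
    case (Arc a b)
    then have "k = 0 \<or> k = 1"
      using that cases2 by simp
    then show ?thesis
      by (elim disjE) (simp_all add: Arc)
  qed
  have inverse: "(l - (l - k) mod l) mod l = k" if "k < l" for l k :: nat
    using that by (cases "k = 0") auto
  have pos: "?l i > 0" for i
    using length_piece_ends[of "D ! i"] by (auto simp del: length_greater_0_conv)
  have bij: "bij_betw ?\<phi> (darts D) (darts ?E)"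
    unfolding darts_eq
    by (rule bij_betw_byWitness[where f' = ?\<phi>]) (use pos inverse in \<open>auto simp: darts_eq_Sigma\<close>)
  have opp: "(l - (k + l div 2) mod l) mod l = ((l - k) mod l + l div 2) mod l" if "k < l" "l = 2 \<or> l = 4" for k l :: nat
    using that(2)
  proof
    assume "l = 2"
    with that(1) cases2[of k] show ?thesis by auto
  next
    assume "l = 4"
    with that(1) cases4[of k] show ?thesis by auto
  qed
  have nxt: "Suc ((l - Suc k mod l) mod l) mod l = (l - k) mod l" if "k < l" for k l :: nat
    using that by (cases "Suc k = l") (auto simp: Suc_diff_Suc)
  have iso: "dart_iso ?\<phi> id D ?E"
    unfolding dart_iso_def
  proof (intro conjI ballI bij)
    fix x assume "x \<in> darts D"
    then have x: "fst x < length D" "snd x < ?l (fst x)"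
      by (auto simp: darts_def)
    then show "dart_edge ?E (?\<phi> x) = id (dart_edge D x)"
      using nth reflect by (simp add: dart_edge_eq)
    show "?\<phi> (opposite_end D x) = opposite_end ?E (?\<phi> x)"
      using x nth opp length_piece_ends[of "D ! fst x"] by (simp add: opposite_end_def)
  qed (simp_all add: len)
  show ?thesis
  proof (rule knot_diagram_orientation_reversing[OF iso _ D])
    fix x assume "x \<in> darts D"
    then have x: "fst x < length D" "snd x < ?l (fst x)"
      by (auto simp: darts_def)
    then show "next_end ?E (?\<phi> (next_end D x)) = ?\<phi> x"
      using nth nxt by (simp add: next_end_eq)
  qed
qed

section \<open>Removing marked points\<close>

lemma count_list_map_merge:
  "count_list (map (id(b := a)) xs) c =
    (if c = a then count_list xs a + (if a = b then 0 else count_list xs b) else if c = b then 0 else count_list xs c)"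
  by (induction xs) auto

lemma all_ends_Cons: "all_ends (p # D) = piece_ends p @ all_ends D"
  by (simp add: all_ends_def)

context
  fixes a b :: nat and D E :: diagram
  assumes closed: "closed_diagram (Arc a b # D)" and ab: "a \<noteq> b"
  defines "E \<equiv> map (map_piece (id(b := a))) D"
begin

lemma unmark_count: "count_list (all_ends D) a = 1" "count_list (all_ends D) b = 1"
  using closed ab by (auto simp: closed_diagram_def all_ends_Cons)

lemma unmark_mem_edges: "a \<in> edges D" "b \<in> edges D"
  using unmark_count count_notin by (metis zero_neq_one)+

lemma unmark_edges: "edges E = edges (Arc a b # D) - {b}"
  using unmark_mem_edges ab by (auto simp: E_def all_ends_map_piece all_ends_Cons)

lemma closed_unmark: "closed_diagram E"
  unfolding closed_diagram_def
proof
  fix c assume c: "c \<in> edges E"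
  then have "c \<in> edges (Arc a b # D)" "c \<noteq> b"
    by (auto simp: unmark_edges)
  then show "count_list (all_ends E) c = 2"
    using unmark_count closed ab unfolding E_def all_ends_map_piece count_list_map_merge
    by (auto simp: closed_diagram_def all_ends_Cons split: if_splits)
qed

lemma one_component_unmark_iff: "one_component E \<longleftrightarrow> one_component (Arc a b # D)"
proof -
  let ?f = "id(b := a)"
  let ?R = "\<Union>p \<in> set D. strand_pairs p"
  let ?RD = "\<Union>p \<in> set (Arc a b # D). strand_pairs p" and ?RE = "\<Union>p \<in> set E. strand_pairs p"
  have RD: "?RD = {(a, b), (b, a)} \<union> ?R"
    by auto
  have "strand_pairs (map_piece ?f p) = map_prod ?f ?f ` strand_pairs p" for p
    by (cases p) auto
  then have RE: "?RE = map_prod ?f ?f ` ?R"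
    by (simp add: E_def image_UN)
  have edgesE: "edges E = ?f ` edges (Arc a b # D)"
    using unmark_mem_edges ab by (auto simp: E_def all_ends_map_piece all_ends_Cons)
  have "(?f u, ?f v) \<in> ?RE\<^sup>*" if "(u, v) \<in> ?RD\<^sup>*" for u v
    using that
  proof (rule rtrancl_map)
    fix u v assume "(u, v) \<in> ?RD"
    then consider "?f u = ?f v" | "(u, v) \<in> ?R"
      unfolding RD by (cases "u = a \<and> v = b \<or> u = b \<and> v = a") auto
    then show "(?f u, ?f v) \<in> ?RE\<^sup>*"
    proof cases
      case 2
      then have "map_prod ?f ?f (u, v) \<in> ?RE"
        unfolding RE by (rule imageI)
      then show ?thesis
        unfolding map_prod_simp ..
    qed simp
  qed
  moreover have f: "(u, ?f u) \<in> ?RD\<^sup>*" "(?f u, u) \<in> ?RD\<^sup>*" for u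
    unfolding RD by (auto intro!: r_into_rtrancl)
  have "(u, v) \<in> ?RD\<^sup>*" if "(?f u, ?f v) \<in> ?RE\<^sup>*" for u v
  proof -
    have "(u', v') \<in> ?RD\<^sup>*" if uv: "(u', v') \<in> ?RE" for u' v'
    proof -
      obtain w where w: "w \<in> ?R" "(u', v') = map_prod ?f ?f w"
        using uv unfolding RE by (elim imageE)
      have "w \<in> ?RD"
        using w(1) unfolding RD by (rule UnI2)
      then have "(fst w, snd w) \<in> ?RD\<^sup>*"
        by (intro r_into_rtrancl) (simp only: prod.collapse)
      then have "(?f (fst w), ?f (snd w)) \<in> ?RD\<^sup>*"
        using f by (meson rtrancl_trans)
      then show ?thesis
        using w(2) by (cases w) (simp only: map_prod_simp prod.inject fst_conv snd_conv)
    qed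
    then have "(?f u, ?f v) \<in> ?RD\<^sup>*"
      using rtrancl_map[OF that, of "\<lambda>x. x" ?RD] by (simp only:)
    then show ?thesis
      using f by (meson rtrancl_trans)
  qed
  ultimately have "(?f u, ?f v) \<in> ?RE\<^sup>* \<longleftrightarrow> (u, v) \<in> ?RD\<^sup>*" for u v
    by blast
  moreover have "E \<noteq> []"
    using unmark_mem_edges by (auto simp: E_def all_ends_def)
  ultimately show ?thesis
    unfolding one_component_def edgesE by (simp del: fun_upd_apply)
qed

text \<open>A marked point subdivides an edge. It adds one dart to the face boundary on each side of
  that edge and creates no face.\<close>

lemma num_faces_unmark: "num_faces (Arc a b # D) = num_faces E"
proof -
  let ?D = "Arc a b # D"
  \<comment> \<open>The marked point is the head of the list, so piece i of \<open>E\<close> is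
    piece i + 1 of \<open>?D\<close>.\<close>
  let ?up = "\<lambda>z :: nat \<times> nat. (Suc (fst z), snd z)" and ?down = "\<lambda>z :: nat \<times> nat. (fst z - 1, snd z)"
  note cE = closed_unmark
  have len: "length E = length D"
    by (simp add: E_def)
  have dart_up: "?up z \<in> darts ?D \<longleftrightarrow> z \<in> darts E" for z
    by (auto simp: in_darts_iff E_def)
  have darts_cases: "u = (0, 0) \<or> u = (0, 1) \<or> (\<exists>z \<in> darts E. u = ?up z)" if "u \<in> darts ?D" for u
  proof (cases "fst u")
    case 0
    then show ?thesis
      using that by (auto simp: in_darts_iff less_Suc_eq prod_eq_iff)
  next
    case (Suc i)
    then have "u = ?up (i, snd u)"
      by (simp add: prod_eq_iff)
    then show ?thesis
      using that dart_up by metis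
  qed
  have d0: "(0, 0) \<in> darts ?D" "(0, 1) \<in> darts ?D" "dart_edge ?D (0, 0) = a" "dart_edge ?D (0, 1) = b"
    "next_end ?D (0, 0) = (0, 1)" "next_end ?D (0, 1) = (0, 0)"
    by (auto simp: in_darts_iff dart_edge_eq next_end_eq)
  have edge_up: "dart_edge E z = (id(b := a)) (dart_edge ?D (?up z))" if "z \<in> darts E" for z
    using that by (auto simp add: dart_edge_eq E_def in_darts_iff)
  have next_up: "next_end ?D (?up z) = ?up (next_end E z)" if "z \<in> darts E" for z
    using that by (auto simp add: next_end_eq E_def in_darts_iff)
  obtain x where x: "x \<in> darts E" "other_dart ?D (0, 0) = ?up x"
    using darts_cases[OF other_dart(1)[OF closed d0(1)]] other_dart(2,3)[OF closed d0(1)] d0 ab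
    by metis
  obtain y where y: "y \<in> darts E" "other_dart ?D (0, 1) = ?up y"
    using darts_cases[OF other_dart(1)[OF closed d0(2)]] other_dart(2,3)[OF closed d0(2)] d0 ab
    by metis
  have ux: "dart_edge ?D (?up x) = a" "other_dart ?D (?up x) = (0, 0)"
    using other_dart(3)[OF closed d0(1)] other_dart_other_dart[OF closed d0(1)] x d0 by auto
  have uy: "dart_edge ?D (?up y) = b" "other_dart ?D (?up y) = (0, 1)"
    using other_dart(3)[OF closed d0(2)] other_dart_other_dart[OF closed d0(2)] y d0 by auto
  have xy: "x \<noteq> y"
    using ux uy ab by auto
  have ox: "other_dart E x = y"
    using ux uy xy ab x y edge_up by (intro other_dart_eqI[OF cE]) auto
  have oy: "other_dart E y = x"
    using ox other_dart_other_dart[OF cE x(1)] by simp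
  have other_up: "other_dart ?D (?up z) = ?up (other_dart E z)"
    if z: "z \<in> darts E" "z \<noteq> x" "z \<noteq> y" for z
  proof -
    let ?w = "other_dart ?D (?up z)"
    have uz: "?up z \<in> darts ?D"
      using z dart_up by simp
    have w: "?w \<in> darts ?D" "?w \<noteq> ?up z" "dart_edge ?D ?w = dart_edge ?D (?up z)"
      using other_dart[OF closed uz] by auto
    have "?w \<noteq> (0, 0)"
    proof
      assume "?w = (0, 0)"
      then have "?up z = ?up x"
        using other_dart_other_dart[OF closed uz] x by simp
      with z show False
        by (simp add: prod_eq_iff)
    qed
    moreover have "?w \<noteq> (0, 1)"
    proof
      assume "?w = (0, 1)"
      then have "?up z = ?up y"
        using other_dart_other_dart[OF closed uz] y by simp
      with z show False
        by (simp add: prod_eq_iff)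
    qed
    ultimately obtain v where v: "v \<in> darts E" "?w = ?up v"
      using darts_cases[OF w(1)] by blast
    have "other_dart E z = v"
      using v w z edge_up by (intro other_dart_eqI[OF cE]) auto
    with v show ?thesis by simp
  qed
  \<comment> \<open>Each dart of the marked point goes to the dart preceding it on its face:
    \<open>R1\<close> shows that \<open>?up y\<close> steps to (0, 0) and \<open>?up x\<close> to
    (0, 1).\<close>
  let ?f = "\<lambda>u :: nat \<times> nat. if u = (0, 0) then y else if u = (0, 1) then x else ?down u"
  have f_up: "?f (?up z) = z" for z
    by simp
  have f0: "?f (0, 0) = y" "?f (0, 1) = x"
    by simp_all
  have R0: "((0, 0), ?up (next_end E x)) \<in> face_step ?D" "((0, 1), ?up (next_end E y)) \<in> face_step ?D"
    using x y d0 next_up by (simp_all add: face_step_iff[OF closed])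
  have R1: "(?up x, (0, 1)) \<in> face_step ?D" "(?up y, (0, 0)) \<in> face_step ?D"
    using x y ux uy dart_up d0 by (simp_all add: face_step_iff[OF closed])
  show ?thesis
    unfolding num_faces_def
  proof (rule card_quotient_rtrancl_eq[where f = ?f and g = ?up])
    show "sym ((face_step ?D)\<^sup>*)" "sym ((face_step E)\<^sup>*)"
      by (rule sym_face_step_rtrancl[OF closed] sym_face_step_rtrancl[OF cE])+
    show "?up ` darts E \<subseteq> darts ?D"
      using dart_up by blast
    show "?f ` darts ?D \<subseteq> darts E"
    proof (rule image_subsetI)
      fix u assume "u \<in> darts ?D"
      then show "?f u \<in> darts E"
        using darts_cases[of u] x(1) y(1) by auto
    qed
    show "(?f (?up z), z) \<in> (face_step E)\<^sup>*" for z
      unfolding f_up ..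
    show "(?up (?f u), u) \<in> (face_step ?D)\<^sup>*" if "u \<in> darts ?D" for u
      using darts_cases[OF that]
    proof (elim disjE bexE)
      assume "u = (0, 0)"
      then show ?thesis
        using R1(2) f0(1) by (simp only: r_into_rtrancl)
    next
      assume "u = (0, 1)"
      then show ?thesis
        using R1(1) f0(2) by (simp only: r_into_rtrancl)
    next
      fix z assume "u = ?up z"
      then show ?thesis
        by simp
    qed
    show "(?f u, ?f v) \<in> (face_step E)\<^sup>*" if uv: "(u, v) \<in> face_step ?D" for u v
    proof -
      have u: "u \<in> darts ?D" and v: "v = next_end ?D (other_dart ?D u)"
        using uv by (simp_all add: face_step_iff[OF closed])
      show ?thesis
        using darts_cases[OF u]
      proof (elim disjE bexE)
        assume u: "u = (0, 0)"
        then have "v = ?up (next_end E x)"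
          using v x next_up by simp
        moreover have "(y, next_end E x) \<in> face_step E"
          using y oy by (simp add: face_step_iff[OF cE])
        ultimately show ?thesis
          using u f0 f_up by (simp only: r_into_rtrancl)
      next
        assume u: "u = (0, 1)"
        then have "v = ?up (next_end E y)"
          using v y next_up by simp
        moreover have "(x, next_end E y) \<in> face_step E"
          using x ox by (simp add: face_step_iff[OF cE])
        ultimately show ?thesis
          using u f0 f_up by (simp only: r_into_rtrancl)
      next
        fix z assume z: "z \<in> darts E" "u = ?up z"
        consider "z = x" | "z = y" | "z \<noteq> x" "z \<noteq> y" by blast
        then show ?thesis
        proof cases
          case 1
          then have "v = (0, 1)"
            using v z ux d0 by simp
          then show ?thesis
            using 1 z f0 f_up by (simp only: rtrancl.rtrancl_refl)
        next
          case 2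
          then have "v = (0, 0)"
            using v z uy d0 by simp
          then show ?thesis
            using 2 z f0 f_up by (simp only: rtrancl.rtrancl_refl)
        next
          case 3
          then have "v = ?up (next_end E (other_dart E z))"
            using v z other_up next_up other_dart(1)[OF cE z(1)] by simp
          moreover have "(z, next_end E (other_dart E z)) \<in> face_step E"
            using z by (simp add: face_step_iff[OF cE])
          ultimately show ?thesis
            using z f_up by (simp only: r_into_rtrancl)
        qed
      qed
    qed
    show "(?up u, ?up v) \<in> (face_step ?D)\<^sup>*" if uv: "(u, v) \<in> face_step E" for u v
    proof -
      have u: "u \<in> darts E" and v: "v = next_end E (other_dart E u)"
        using uv by (simp_all add: face_step_iff[OF cE])
      consider "u = x" | "u = y" | "u \<noteq> x" "u \<noteq> y" by blast
      then show ?thesis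
      proof cases
        case 1
        then show ?thesis
          using R1(1) R0(2) v ox by (simp add: converse_rtrancl_into_rtrancl r_into_rtrancl)
      next
        case 2
        then show ?thesis
          using R1(2) R0(1) v oy by (simp add: converse_rtrancl_into_rtrancl r_into_rtrancl)
      next
        case 3
        then have "(?up u, ?up v) \<in> face_step ?D"
          using u v other_up next_up dart_up other_dart(1)[OF cE u] by (simp add: face_step_iff[OF closed])
        then show ?thesis ..
      qed
    qed
  qed simp_all
qed

text \<open>One piece and one edge disappear and the faces remain, so the Euler characteristic does
  not change.\<close>

lemma knot_diagram_unmark_iff: "knot_diagram E \<longleftrightarrow> knot_diagram (Arc a b # D)"
proof -
  have "b \<in> edges (Arc a b # D)"
    by (simp add: all_ends_Cons)
  then have "card (edges (Arc a b # D)) = Suc (card (edges E))"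
    unfolding unmark_edges by (rule card.remove[OF finite_set])
  moreover have "length E = length D"
    by (simp add: E_def)
  ultimately show ?thesis
    using closed closed_unmark by (auto simp: knot_diagram_def one_component_unmark_iff num_faces_unmark)
qed

end

section \<open>Isotopies\<close>

lemma isotopic_refl: "isotopic D D"
  by (simp add: isotopic_def)

lemma isotopic_sym: "isotopic D E \<Longrightarrow> isotopic E D"
  unfolding isotopic_def by (rule equivclp_sym)

lemma isotopic_trans [trans]: "isotopic D E \<Longrightarrow> isotopic E F \<Longrightarrow> isotopic D F"
  unfolding isotopic_def by (rule equivclp_trans)

lemma diagram_step_imp_isotopic:
  "diagram_step D E \<Longrightarrow> knot_diagram D \<Longrightarrow> knot_diagram E \<Longrightarrow> isotopic D E"
  unfolding isotopic_def by (rule r_into_equivclp) simp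

lemma isotopic_reorder: "mset D = mset E \<Longrightarrow> knot_diagram D \<Longrightarrow> isotopic D E"
  using diagram_step_imp_isotopic[OF diagram_step.reorder _ knot_diagram_reorder] by blast

text \<open>The ambiguity of the notation for a piece: a crossing can be written down from either of
  its two under ends.\<close>

fun turn_piece :: "'e piece \<Rightarrow> 'e piece" where
  "turn_piece (Cross a b c d) = Cross c d a b"
| "turn_piece (Arc a b) = Arc b a"

lemma piece_ends_turn_piece: "piece_ends (turn_piece p) = rotate (length (piece_ends p) div 2) (piece_ends p)"
proof -
  have "rotate 2 xs = rotate1 (rotate1 xs)" for xs :: "'a list"
    by (simp add: rotate_def numeral_2_eq_2)
  then show ?thesis
    by (cases p) (simp_all add: rotate_def)
qed

lemma turn_piece_turn_piece [simp]: "turn_piece (turn_piece p) = p"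
  by (cases p) auto

lemma knot_diagram_turns:
  assumes "list_all2 (\<lambda>p q. q = p \<or> q = turn_piece p) D E" "knot_diagram D"
  shows "knot_diagram E"
proof (rule knot_diagram_rotate[OF _ assms(2)])
  have "\<exists>r. piece_ends q = rotate r (piece_ends p)" if "p = q \<or> p = turn_piece q" for p q :: "nat piece"
    using that
  proof
    assume "p = q"
    then show ?thesis
      by (intro exI[of _ 0]) simp
  next
    assume "p = turn_piece q"
    then have "q = turn_piece p"
      by simp
    then show ?thesis
      using piece_ends_turn_piece by blast
  qed
  then show "list_all2 (\<lambda>p q. \<exists>r. piece_ends q = rotate r (piece_ends p)) E D"
    using assms(1) by (subst list_all2_conv_all_nth) (auto simp: list_all2_conv_all_nth)
qed

lemma isotopic_turn_piece:
  assumes "knot_diagram (xs @ p # ys)"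
  shows "isotopic (xs @ p # ys) (xs @ turn_piece p # ys)"
proof -
  have "list_all2 (\<lambda>p q. q = p \<or> q = turn_piece p) (xs @ p # ys) (xs @ turn_piece p # ys)"
    by (auto intro!: list_all2_appendI list.rel_refl)
  then have turned: "knot_diagram (xs @ turn_piece p # ys)"
    using assms knot_diagram_turns by blast
  have "diagram_step (p # xs @ ys) (turn_piece p # xs @ ys)"
    by (cases p) (auto intro: diagram_step.turn diagram_step.flip)
  moreover have "knot_diagram (p # xs @ ys)" "knot_diagram (turn_piece p # xs @ ys)"
    by (rule knot_diagram_reorder[OF _ assms], simp) (rule knot_diagram_reorder[OF _ turned], simp)
  ultimately have "isotopic (p # xs @ ys) (turn_piece p # xs @ ys)"
    by (rule diagram_step_imp_isotopic)
  moreover have "isotopic (xs @ p # ys) (p # xs @ ys)"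
    by (rule isotopic_reorder[OF _ assms]) simp
  moreover have "isotopic (turn_piece p # xs @ ys) (xs @ turn_piece p # ys)"
    by (rule isotopic_sym, rule isotopic_reorder[OF _ turned]) simp
  ultimately show ?thesis
    by (meson isotopic_trans)
qed

lemma isotopic_knot_diagram:
  assumes "isotopic D E" "knot_diagram D"
  shows "knot_diagram E"
  using assms unfolding isotopic_def by (induction rule: equivclp_induct) auto

lemma isotopic_turns:
  assumes "list_all2 (\<lambda>p q. q = p \<or> q = turn_piece p) D E" "knot_diagram D"
  shows "isotopic D E"
proof -
  \<comment> \<open>The prefix \<open>xs\<close> collects the pieces already treated; it is needed
    because every intermediate list must be a knot diagram as a whole.\<close>
  have "isotopic (xs @ D) (xs @ E)" if "knot_diagram (xs @ D)" for xs
    using assms(1) that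
  proof (induction arbitrary: xs rule: list_all2_induct)
    case Nil
    show ?case by (simp add: isotopic_refl)
  next
    case (Cons p ps q qs)
    have pq: "isotopic (xs @ p # ps) (xs @ q # ps)"
      using Cons.hyps(1) isotopic_turn_piece[OF Cons.prems] isotopic_refl by auto
    then have "knot_diagram ((xs @ [q]) @ ps)"
      using isotopic_knot_diagram Cons.prems by fastforce
    then have "isotopic ((xs @ [q]) @ ps) ((xs @ [q]) @ qs)"
      by (rule Cons.IH)
    with pq show ?case
      by (auto intro: isotopic_trans)
  qed
  from this[of "[]"] assms(2) show ?thesis by simp
qed

lemma isotopic_relabel: "inj_on f (edges D) \<Longrightarrow> knot_diagram D \<Longrightarrow> isotopic D (map (map_piece f) D)"
  using diagram_step_imp_isotopic[OF diagram_step.relabel _ knot_diagram_relabel] by blast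

lemma piece_ends_reflect_piece: "set (piece_ends (reflect_piece p)) = set (piece_ends p)"
  by (cases p) auto

lemma edges_mirror_image [simp]: "edges (mirror_image D) = edges D"
  by (simp add: mirror_image_def all_ends_def piece_ends_reflect_piece)

lemma reflect_piece_map_piece: "reflect_piece (map_piece f p) = map_piece f (reflect_piece p)"
  by (cases p) auto

lemma mirror_image_map_piece: "mirror_image (map (map_piece f) D) = map (map_piece f) (mirror_image D)"
  by (simp add: mirror_image_def reflect_piece_map_piece)

lemma mirror_image_Nil [simp]: "mirror_image [] = []"
  and mirror_image_Cons [simp]: "mirror_image (p # D) = reflect_piece p # mirror_image D"
  and mset_mirror_image: "mset (mirror_image D) = image_mset reflect_piece (mset D)"
  by (simp_all add: mirror_image_def)

text \<open>Up to half turns of pieces every rule reflects to a rule: \<open>R1\<close> and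
  \<open>R1'\<close> are exchanged, likewise \<open>R3\<close> and \<open>R3'\<close>, and
  \<open>R2\<close> reflects to itself with its two crossings in the other order.\<close>

lemma isotopic_mirror_step:
  assumes "diagram_step D E" "knot_diagram D" "knot_diagram E"
  shows "isotopic (mirror_image D) (mirror_image E)"
proof -
  let ?turns = "list_all2 (\<lambda>p q. q = p \<or> q = turn_piece p)"
  have refl: "?turns F F" for F :: diagram
    by (simp add: list.rel_refl)
  have D': "knot_diagram (mirror_image D)" and E': "knot_diagram (mirror_image E)"
    using assms by (simp_all add: knot_diagram_mirror_image)
  have step: ?thesis if "diagram_step (mirror_image D) (mirror_image E)"
    using that D' E' by (rule diagram_step_imp_isotopic)
  have via: ?thesis
    if "isotopic (mirror_image D) D1" "diagram_step D1 E1" "isotopic (mirror_image E) E1" for D1 E1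
  proof -
    have "isotopic D1 E1"
      using that D' E' isotopic_knot_diagram by (blast intro: diagram_step_imp_isotopic)
    with that show ?thesis
      by (meson isotopic_trans isotopic_sym)
  qed
  show ?thesis
    using assms(1)
  proof (cases rule: diagram_step.cases)
    case reorder
    then show ?thesis
      by (intro step diagram_step.reorder) (simp add: mset_mirror_image)
  next
    case (relabel f)
    then show ?thesis
      by (intro step) (simp add: mirror_image_map_piece diagram_step.relabel)
  next
    case turn
    then show ?thesis
      by (intro step) (simp add: diagram_step.turn)
  next
    case flip
    then show ?thesis
      by (intro step) (simp add: diagram_step.flip)
  next
    case unmark
    then show ?thesis
      by (intro step) (simp add: mirror_image_map_piece diagram_step.unmark del: mirror_image_def)
  next
    case (R1 a b c F)
    have "isotopic (mirror_image D) (Cross b b a c # mirror_image F)"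
      using R1 refl by (intro isotopic_turns D') simp
    then show ?thesis
      by (rule via[OF _ diagram_step.R1']) (simp add: R1 isotopic_refl)
  next
    case (R1' a b c F)
    have "isotopic (mirror_image D) (Cross b a a c # mirror_image F)"
      using R1' refl by (intro isotopic_turns D') simp
    then show ?thesis
      by (rule via[OF _ diagram_step.R1]) (simp add: R1' isotopic_refl)
  next
    case (R2 p t q s r u F)
    have t: "isotopic (mirror_image D) (Cross q t p s # Cross r t q u # mirror_image F)"
      using R2 refl by (intro isotopic_turns D') simp
    have "isotopic (Cross q t p s # Cross r t q u # mirror_image F)
        (Cross r t q u # Cross q t p s # mirror_image F)"
      using isotopic_knot_diagram[OF t D'] by (intro isotopic_reorder) simp_all
    with t have "isotopic (mirror_image D) (Cross r t q u # Cross q t p s # mirror_image F)"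
      by (rule isotopic_trans)
    then show ?thesis
      by (rule via[OF _ diagram_step.R2]) (use R2 refl in \<open>intro isotopic_turns E', simp\<close>)
  next
    case R3
    then show ?thesis
      by (intro step) (simp add: diagram_step.R3')
  next
    case R3'
    then show ?thesis
      by (intro step) (simp add: diagram_step.R3)
  qed
qed

lemma isotopic_mirror_image:
  assumes "isotopic D E"
  shows "isotopic (mirror_image D) (mirror_image E)"
  using assms[unfolded isotopic_def]
proof (induction rule: equivclp_induct)
  case base
  show ?case by (rule isotopic_refl)
next
  case (step y z)
  then have "isotopic (mirror_image y) (mirror_image z)"
    using isotopic_mirror_step isotopic_sym by blast
  with step.IH show ?case
    by (rule isotopic_trans)
qed

section \<open>Removing all marked points\<close>

fun is_Arc :: "'e piece \<Rightarrow> bool" where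
  "is_Arc (Arc a b) = True"
| "is_Arc (Cross a b c d) = False"

text \<open>The order of the arcs matters for the labels that survive, but not for the diagram.\<close>

function unmark_arcs :: "diagram \<Rightarrow> diagram \<Rightarrow> diagram" where
  "unmark_arcs [] C = C"
| "unmark_arcs (Cross a b c d # As) C = unmark_arcs As (Cross a b c d # C)"
| "unmark_arcs (Arc a b # As) C = (if a = b then unmark_arcs As (Arc a b # C)
    else unmark_arcs (map (map_piece (id(b := a))) As) (map (map_piece (id(b := a))) C))"
  by pat_completeness auto
termination
  by (relation "measure (\<lambda>(As, C). length As)") auto

lemma mset_all_ends: "mset (all_ends D) = (\<Sum>p \<in># mset D. mset (piece_ends p))"
  by (induction D) (simp_all add: all_ends_def)

lemma closed_diagram_reorder:
  assumes "mset D = mset E" "closed_diagram D"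
  shows "closed_diagram E"
proof -
  have eq: "mset (all_ends D) = mset (all_ends E)"
    unfolding mset_all_ends assms(1) ..
  have "edges D = edges E"
    using eq by (rule mset_eq_setD)
  moreover have "count_list (all_ends D) a = count_list (all_ends E) a" for a
    unfolding count_mset[symmetric] eq ..
  ultimately show ?thesis
    using assms(2) by (simp add: closed_diagram_def)
qed

text \<open>Closedness of the marked diagram can be checked by evaluation, while sphericity and
  connectedness are known for the unmarked one. The equivalence transfers them back.\<close>

lemma unmark_arcs:
  assumes "closed_diagram (As @ C)"
  shows "(knot_diagram (As @ C) \<longleftrightarrow> knot_diagram (unmark_arcs As C)) \<and>
    (knot_diagram (As @ C) \<longrightarrow> isotopic (As @ C) (unmark_arcs As C))"
proof -
  have *: "closed_diagram (As @ p # C) \<and> (knot_diagram (p # As @ C) \<longleftrightarrow> knot_diagram (As @ p # C)) \<and>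
      (knot_diagram (p # As @ C) \<longrightarrow> isotopic (p # As @ C) (As @ p # C))"
    if "closed_diagram (p # As @ C)" for p As C
  proof (intro conjI impI)
    have eq: "mset (p # As @ C) = mset (As @ p # C)"
      by simp
    show "closed_diagram (As @ p # C)"
      by (rule closed_diagram_reorder[OF eq that])
    show "knot_diagram (p # As @ C) \<longleftrightarrow> knot_diagram (As @ p # C)"
      using knot_diagram_reorder[OF eq] knot_diagram_reorder[OF eq[symmetric]] by (rule iffI)
    show "isotopic (p # As @ C) (As @ p # C)" if "knot_diagram (p # As @ C)"
      by (rule isotopic_reorder[OF eq that])
  qed
  show ?thesis
    using assms
  proof (induction As C rule: unmark_arcs.induct)
    case (1 C)
    show ?case by (simp add: isotopic_refl)
  next
    case (2 a b c d As C)
    with *[of "Cross a b c d" As C] show ?case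
      by (auto intro: isotopic_trans)
  next
    case (3 a b As C)
    show ?case
    proof (cases "a = b")
      case True
      with 3 *[of "Arc a b" As C] show ?thesis
        by (auto intro: isotopic_trans)
    next
      case False
      let ?D = "Arc a b # As @ C" and ?E = "map (map_piece (id(b := a))) (As @ C)"
      have closed: "closed_diagram ?D"
        using 3 by simp
      have "closed_diagram ?E"
        by (rule closed_unmark[OF closed False])
      then have IH: "(knot_diagram ?E \<longleftrightarrow> knot_diagram (unmark_arcs (Arc a b # As) C)) \<and>
          (knot_diagram ?E \<longrightarrow> isotopic ?E (unmark_arcs (Arc a b # As) C))"
        using 3(2)[OF False] False by simp
      moreover have "knot_diagram ?E \<longleftrightarrow> knot_diagram ?D"
        by (rule knot_diagram_unmark_iff[OF closed False])
      moreover have "isotopic ?D ?E" if "knot_diagram ?D" "knot_diagram ?E"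
        using that by (intro diagram_step_imp_isotopic[OF diagram_step.unmark[OF False]])
      ultimately show ?thesis
        by (auto intro: isotopic_trans simp del: map_append)
    qed
  qed
qed

section \<open>The diagrams with a given DT code\<close>

definition next_label :: "nat \<Rightarrow> nat \<Rightarrow> nat" where
  "next_label n m = (if m = 2 * n then 1 else m + 1)"

text \<open>
  The edge arriving at the passage labelled \<open>m\<close> is called \<open>m\<close>. The code does not tell whether the
  even passage crosses the odd one from right to left (\<open>s\<close>) or from left to right (\<open>\<not> s\<close>).
\<close>

definition dt_piece :: "nat \<Rightarrow> nat \<Rightarrow> int \<Rightarrow> bool \<Rightarrow> nat piece" where
  "dt_piece n i x s =
     (let j = nat \<bar>x\<bar>; i' = next_label n i; j' = next_label n j
      in if x < 0 then (if s then Cross j i' j' i else Cross j i j' i')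
         else (if s then Cross i j i' j' else Cross i j' i' j))"

definition dt_diagram :: "int list \<Rightarrow> (nat \<Rightarrow> bool) \<Rightarrow> diagram" where
  "dt_diagram c \<sigma> = map (\<lambda>k. dt_piece (length c) (2 * k + 1) (c ! k) (\<sigma> k)) [0..<length c]"

definition valid_dt_code :: "int list \<Rightarrow> bool" where
  "valid_dt_code c \<longleftrightarrow> c \<noteq> [] \<and> distinct (map (\<lambda>x. nat \<bar>x\<bar>) c) \<and>
     set (map (\<lambda>x. nat \<bar>x\<bar>) c) = {m \<in> {1..2 * length c}. even m}"

lemma valid_dt_code_nth:
  assumes "valid_dt_code c" "k < length c"
  shows "1 \<le> nat \<bar>c ! k\<bar>" "nat \<bar>c ! k\<bar> \<le> 2 * length c" "even (nat \<bar>c ! k\<bar>)"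
proof -
  have "nat \<bar>c ! k\<bar> \<in> set (map (\<lambda>x. nat \<bar>x\<bar>) c)"
    using assms(2) by simp
  then show "1 \<le> nat \<bar>c ! k\<bar>" "nat \<bar>c ! k\<bar> \<le> 2 * length c" "even (nat \<bar>c ! k\<bar>)"
    using assms(1) unfolding valid_dt_code_def by simp_all
qed

lemma length_dt_diagram [simp]: "length (dt_diagram c \<sigma>) = length c"
  by (simp add: dt_diagram_def)

lemma nth_dt_diagram:
  "k < length c \<Longrightarrow> dt_diagram c \<sigma> ! k = dt_piece (length c) (2 * k + 1) (c ! k) (\<sigma> k)"
  by (simp add: dt_diagram_def)

lemma mirror_image_dt_diagram: "mirror_image (dt_diagram c \<sigma>) = dt_diagram c (\<lambda>k. \<not> \<sigma> k)"
  by (simp add: mirror_image_def dt_diagram_def dt_piece_def Let_def)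

lemma set_piece_ends_dt_piece:
  "set (piece_ends (dt_piece n i x s)) = {i, nat \<bar>x\<bar>, next_label n i, next_label n (nat \<bar>x\<bar>)}"
  by (auto simp: dt_piece_def Let_def)

lemma next_label_range: "1 \<le> m \<Longrightarrow> m \<le> 2 * n \<Longrightarrow> next_label n m \<in> {1..2 * n}"
  by (auto simp: next_label_def)

lemma edges_dt_diagram_subset:
  assumes "valid_dt_code c"
  shows "edges (dt_diagram c \<sigma>) \<subseteq> {1..2 * length c}"
proof
  fix a assume "a \<in> edges (dt_diagram c \<sigma>)"
  then obtain k where k: "k < length c"
      "a \<in> set (piece_ends (dt_piece (length c) (2 * k + 1) (c ! k) (\<sigma> k)))"
    by (auto simp: all_ends_def dt_diagram_def)
  have "1 \<le> 2 * k + 1" "2 * k + 1 \<le> 2 * length c"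
    using k(1) by auto
  with k valid_dt_code_nth[OF assms k(1)] next_label_range show "a \<in> {1..2 * length c}"
    unfolding set_piece_ends_dt_piece by auto
qed

text \<open>The code fixes which two edges form the under strand and which two the over strand. Of
  the four ways to order both pairs, two at a time differ by a half turn, so a single bit
  \<open>s\<close> remains.\<close>

lemma dt_crossing_imp_dt_piece:
  assumes "dt_crossing e i x p" and e: "e (i + 1) = e (next_label n i)"
    "e (nat \<bar>x\<bar> + 1) = e (next_label n (nat \<bar>x\<bar>))"
  shows "\<exists>s. map_piece e (dt_piece n i x s) = p \<or> map_piece e (dt_piece n i x s) = turn_piece p"
proof (cases p)
  case (Cross a b c d)
  show ?thesis
  proof (cases "x < 0")
    case True
    then have "{a, c} = {e (nat \<bar>x\<bar>), e (next_label n (nat \<bar>x\<bar>))}" "{b, d} = {e i, e (next_label n i)}"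
      using assms by (simp_all add: Cross Let_def)
    then show ?thesis
      by (auto simp: Cross dt_piece_def Let_def True doubleton_eq_iff ex_bool_eq)
  next
    case False
    then have "{a, c} = {e i, e (next_label n i)}" "{b, d} = {e (nat \<bar>x\<bar>), e (next_label n (nat \<bar>x\<bar>))}"
      using assms by (simp_all add: Cross Let_def)
    then show ?thesis
      by (auto simp: Cross dt_piece_def Let_def False doubleton_eq_iff ex_bool_eq)
  qed
next
  case (Arc a b)
  then show ?thesis
    using assms(1) by simp
qed

text \<open>Names of edges, order of pieces and half turns do not matter up to isotopy. This reduces
  all diagrams with the code to finitely many standard ones, one for each choice of the
  bits.\<close>

lemma has_dt_code_imp_isotopic:
  assumes "has_dt_code D c" "valid_dt_code c"
  shows "\<exists>\<sigma>. knot_diagram (dt_diagram c \<sigma>) \<and> isotopic D (dt_diagram c \<sigma>)"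
proof -
  let ?n = "length c"
  obtain e E where knot: "knot_diagram D" and e: "inj_on e {1..2 * ?n}" "e (2 * ?n + 1) = e 1"
    and E: "mset E = mset D" "length E = ?n"
    and crossing: "\<And>k. k < ?n \<Longrightarrow> dt_crossing e (2 * k + 1) (c ! k) (E ! k)"
    using assms(1) unfolding has_dt_code_def by auto
  have e_next: "e (m + 1) = e (next_label ?n m)" for m
    using e(2) by (simp add: next_label_def)
  have "\<forall>k. k < ?n \<longrightarrow> (\<exists>s. map_piece e (dt_piece ?n (2 * k + 1) (c ! k) s) = E ! k \<or>
      map_piece e (dt_piece ?n (2 * k + 1) (c ! k) s) = turn_piece (E ! k))"
    using dt_crossing_imp_dt_piece[OF crossing e_next e_next] by blast
  then obtain \<sigma> where \<sigma>: "\<And>k. k < ?n \<Longrightarrow> map_piece e (dt_piece ?n (2 * k + 1) (c ! k) (\<sigma> k)) = E ! k \<or>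
      map_piece e (dt_piece ?n (2 * k + 1) (c ! k) (\<sigma> k)) = turn_piece (E ! k)"
    by metis
  let ?F = "map (map_piece e) (dt_diagram c \<sigma>)"
  have "knot_diagram E"
    using knot_diagram_reorder[OF E(1)[symmetric] knot] .
  moreover have turns: "list_all2 (\<lambda>p q. q = p \<or> q = turn_piece p) E ?F"
    using \<sigma> E(2) by (auto simp: list_all2_conv_all_nth nth_dt_diagram)
  ultimately have F: "isotopic E ?F" "knot_diagram ?F"
    using isotopic_turns knot_diagram_turns by blast+
  have inj: "inj_on e (edges (dt_diagram c \<sigma>))"
    using e(1) edges_dt_diagram_subset[OF assms(2)] by (rule inj_on_subset)
  have dt: "knot_diagram (dt_diagram c \<sigma>)"
    using F(2) by (simp only: knot_diagram_relabel_iff[OF inj])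
  have "isotopic D E"
    by (rule isotopic_reorder[OF E(1)[symmetric] knot])
  also have "isotopic E ?F" by fact
  also have "isotopic ?F (dt_diagram c \<sigma>)"
    by (rule isotopic_sym, rule isotopic_relabel[OF inj dt])
  finally show ?thesis
    using dt by blast
qed

text \<open>A negative entry gives the standard crossing a quarter turn, which sphericity does not
  see. Which \<sigma> are possible can therefore be studied for the code without signs.\<close>

lemma knot_diagram_dt_diagram_abs:
  assumes "knot_diagram (dt_diagram c \<sigma>)"
  shows "knot_diagram (dt_diagram (map abs c) \<sigma>)"
proof (rule knot_diagram_rotate[OF _ assms])
  have r1: "rotate 1 xs = rotate1 xs" and r3: "rotate 3 xs = rotate1 (rotate1 (rotate1 xs))" for xs :: "nat list"
    by (simp_all add: rotate_def numeral_3_eq_3)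
  have "\<exists>r. piece_ends (dt_piece n i x s) = rotate r (piece_ends (dt_piece n i \<bar>x\<bar> s))" for n i x s
  proof (cases "x < 0")
    case True
    show ?thesis
    proof (cases s)
      case True
      then show ?thesis
        using \<open>x < 0\<close> by (intro exI[of _ 1]) (simp add: dt_piece_def Let_def)
    next
      case False
      then show ?thesis
        using \<open>x < 0\<close> by (intro exI[of _ 3]) (simp add: dt_piece_def Let_def r3)
    qed
  next
    case False
    then show ?thesis
      by (intro exI[of _ 0]) simp
  qed
  then show "list_all2 (\<lambda>p q. \<exists>r. piece_ends q = rotate r (piece_ends p))
      (dt_diagram (map abs c) \<sigma>) (dt_diagram c \<sigma>)"
    by (simp add: list_all2_conv_all_nth nth_dt_diagram)
qed

text \<open>The quarter turns in the other direction: a list of faces found for an alternating code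
  also serves the codes that differ from it only by signs.\<close>

lemma knot_diagram_dt_diagram_of_abs:
  assumes "knot_diagram (dt_diagram (map abs c) \<sigma>)"
  shows "knot_diagram (dt_diagram c \<sigma>)"
proof (rule knot_diagram_rotate[OF _ assms])
  have r3: "rotate 3 xs = rotate1 (rotate1 (rotate1 xs))" for xs :: "nat list"
    by (simp add: rotate_def numeral_3_eq_3)
  have "\<exists>r. piece_ends (dt_piece n i \<bar>x\<bar> s) = rotate r (piece_ends (dt_piece n i x s))" for n i x s
  proof (cases "x < 0")
    case True
    show ?thesis
    proof (cases s)
      case True
      then show ?thesis
        using \<open>x < 0\<close> by (intro exI[of _ 3]) (simp add: dt_piece_def Let_def r3)
    next
      case False
      then show ?thesis
        using \<open>x < 0\<close> by (intro exI[of _ 1]) (simp add: dt_piece_def Let_def)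
    qed
  next
    case False
    then show ?thesis
      by (intro exI[of _ 0]) simp
  qed
  then show "list_all2 (\<lambda>p q. \<exists>r. piece_ends q = rotate r (piece_ends p))
      (dt_diagram c \<sigma>) (dt_diagram (map abs c) \<sigma>)"
    by (simp add: list_all2_conv_all_nth nth_dt_diagram)
qed

section \<open>Planarity determines the crossings\<close>

text \<open>The fibres have at most two elements. In the application \<delta> is the boundary of a
  set of faces and \<open>g\<close> the complement.\<close>

lemma card_le_twice_card_image:
  assumes "finite V" and "\<And>x y. x \<in> V \<Longrightarrow> y \<in> V \<Longrightarrow> \<delta> x = \<delta> y \<Longrightarrow> y = x \<or> y = g x"
  shows "card V \<le> 2 * card (\<delta> ` V)"
proof -
  have "card (V \<inter> \<delta> -` {z}) \<le> 2" if z: "z \<in> \<delta> ` V" for z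
  proof -
    obtain x where x: "x \<in> V" "z = \<delta> x"
      using z by blast
    have "V \<inter> \<delta> -` {z} \<subseteq> {x, g x}"
    proof
      fix y assume "y \<in> V \<inter> \<delta> -` {z}"
      then show "y \<in> {x, g x}"
        using assms(2)[OF x(1), of y] x(2) by simp
    qed
    then have "card (V \<inter> \<delta> -` {z}) \<le> card {x, g x}"
      by (intro card_mono) simp_all
    also have "\<dots> \<le> 2"
      by (simp add: card_insert_if)
    finally show ?thesis .
  qed
  then have "(\<Sum>z \<in> \<delta> ` V. card (V \<inter> \<delta> -` {z})) \<le> (\<Sum>z \<in> \<delta> ` V. 2)"
    by (intro sum_mono) simp
  moreover have "card V = (\<Sum>z \<in> \<delta> ` V. card (V \<inter> \<delta> -` {z}))"
    using assms(1) by (subst card_UN_disjoint[symmetric]) (auto intro!: arg_cong[of _ _ card])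
  ultimately show ?thesis
    by simp
qed

text \<open>Unions of faces, with a face represented by the orbit of darts running around
  it.\<close>

definition face_sets :: "diagram \<Rightarrow> (nat \<times> nat) set set" where
  "face_sets D = {U. U \<subseteq> darts D \<and> (\<forall>x \<in> darts D. next_end D (other_dart D x) \<in> U \<longleftrightarrow> x \<in> U)}"

text \<open>Faces are nonempty and disjoint, so different sets of faces have different
  unions.\<close>

lemma card_face_sets_ge:
  assumes "closed_diagram D"
  shows "2 ^ num_faces D \<le> card (face_sets D)"
proof -
  let ?R = "(face_step D)\<^sup>*" and ?Q = "darts D // (face_step D)\<^sup>*"
  have R: "equiv UNIV ?R"
    using sym_face_step_rtrancl[OF assms] by (simp add: equiv_def refl_rtrancl trans_rtrancl)
  have closed: "y \<in> darts D" if "(x, y) \<in> ?R" "x \<in> darts D" for x y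
    using that face_step_subset by (induction rule: rtrancl_induct) auto
  have quot: "x \<in> A \<longleftrightarrow> A = ?R `` {x}" if "A \<in> ?Q" for x A
    using that R by (auto elim!: quotientE simp: equiv_class_eq_iff)
  have "inj_on Union (Pow ?Q)"
  proof (rule inj_onI)
    have "A \<subseteq> B" if AB: "A \<subseteq> ?Q" "B \<subseteq> ?Q" "\<Union>A = \<Union>B" for A B
    proof
      fix X assume X: "X \<in> A"
      then have "X \<in> ?Q"
        using AB(1) by blast
      then obtain x where x: "x \<in> X"
        by (auto elim!: quotientE)
      then have "x \<in> \<Union>B"
        unfolding AB(3)[symmetric] using X by (rule UnionI[rotated])
      then obtain Y where Y: "Y \<in> B" "x \<in> Y"
        by (elim UnionE)
      have "X = ?R `` {x}" "Y = ?R `` {x}"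
        using quot[of X x] quot[of Y x] x X Y AB(1,2) by (simp_all only: subsetD simp_thms)
      then show "X \<in> B"
        using Y(1) by simp
    qed
    then show "A = B" if "A \<in> Pow ?Q" "B \<in> Pow ?Q" "\<Union>A = \<Union>B" for A B
      using that by (metis Pow_iff subset_antisym)
  qed
  moreover have "Union ` Pow ?Q \<subseteq> face_sets D"
  proof (rule image_subsetI)
    fix A assume "A \<in> Pow ?Q"
    then have A: "X \<in> ?Q" if "X \<in> A" for X
      using that by blast
    have "\<Union>A \<subseteq> darts D"
    proof
      fix x assume "x \<in> \<Union>A"
      then obtain X where "X \<in> ?Q" "x \<in> X"
        using A by blast
      then obtain y where y: "y \<in> darts D" "x \<in> ?R `` {y}"
        by (metis quotientE)
      then have "(y, x) \<in> ?R"
        by simp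
      then show "x \<in> darts D"
        using closed y(1) by simp
    qed
    moreover have "next_end D (other_dart D x) \<in> \<Union>A \<longleftrightarrow> x \<in> \<Union>A" if "x \<in> darts D" for x
    proof -
      have "(x, next_end D (other_dart D x)) \<in> ?R"
        using that by (simp add: face_step_iff[OF assms] r_into_rtrancl)
      then have "?R `` {next_end D (other_dart D x)} = ?R `` {x}"
        using R by (metis equiv_class_eq)
      then have "next_end D (other_dart D x) \<in> X \<longleftrightarrow> x \<in> X" if "X \<in> A" for X
        using quot A[OF that] by simp
      then show ?thesis by blast
    qed
    ultimately show "\<Union>A \<in> face_sets D"
      by (simp add: face_sets_def)
  qed
  moreover have "finite (face_sets D)"
    by (rule finite_subset[of _ "Pow (darts D)"]) (auto simp: face_sets_def)
  ultimately have "card (Pow ?Q) \<le> card (face_sets D)"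
    by (rule card_inj_on_le)
  moreover have "finite ?Q"
    by (simp add: quotient_def)
  ultimately show ?thesis
    by (simp add: num_faces_def card_Pow)
qed

text \<open>
  On the sphere every cycle of edges modulo 2 bounds a set of faces: there are as many cycles as
  sets of faces up to complement. Below, \<open>f m\<close> and \<open>a m\<close> tell whether the face to the right
  and to the left, respectively, of the edge \<open>m\<close> belongs to the set.
\<close>

context
  fixes c :: "int list" and \<sigma> :: "nat \<Rightarrow> bool" and n D J nx
  assumes valid: "valid_dt_code c" and pos: "\<forall>x \<in> set c. 0 < x"
    and knot: "knot_diagram (dt_diagram c \<sigma>)"
  defines "n \<equiv> length c" and "D \<equiv> dt_diagram c \<sigma>" and "J \<equiv> \<lambda>k. nat (c ! k)"
    and "nx \<equiv> next_label (length c)"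
begin

definition crossing_of :: "nat \<Rightarrow> nat" where
  "crossing_of m = (if odd m then m div 2 else (THE k. k < n \<and> J k = m))"

definition arrive :: "nat \<Rightarrow> nat \<times> nat" where
  "arrive m = (crossing_of m, if odd m then 0 else if \<sigma> (crossing_of m) then 1 else 3)"

text \<open>This dart lies on the edge \<open>nx m\<close>, not on \<open>m\<close>. The edge
  \<open>m\<close> runs from \<open>depart (prev_label m)\<close> to
  \<open>arrive m\<close>.\<close>

definition depart :: "nat \<Rightarrow> nat \<times> nat" where
  "depart m = (crossing_of m, if odd m then 2 else if \<sigma> (crossing_of m) then 3 else 1)"

definition prev_label :: "nat \<Rightarrow> nat" where
  "prev_label m = (if m = 1 then 2 * n else m - 1)"

lemma closed_D: "closed_diagram D"
  using knot by (simp add: knot_diagram_def D_def)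

lemma nat_abs_c: "k < n \<Longrightarrow> nat \<bar>c ! k\<bar> = J k"
  using bspec[OF pos nth_mem, of k] by (simp add: n_def J_def)

lemma J: "k < n \<Longrightarrow> J k \<in> {1..2 * n}" "k < n \<Longrightarrow> even (J k)"
  using valid_dt_code_nth[OF valid, of k] nat_abs_c[of k] by (simp_all add: n_def)

lemma inj_J: "k < n \<Longrightarrow> k' < n \<Longrightarrow> J k = J k' \<Longrightarrow> k = k'"
  using valid nat_abs_c[of k] nat_abs_c[of k']
    nth_eq_iff_index_eq[of "map (\<lambda>x. nat \<bar>x\<bar>) c" k k']
  by (simp add: n_def valid_dt_code_def)

lemma surj_J:
  assumes "m \<in> {1..2 * n}" "even m"
  obtains k where "k < n" "J k = m"
proof -
  have "m \<in> set (map (\<lambda>x. nat \<bar>x\<bar>) c)"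
    using assms valid by (simp add: valid_dt_code_def n_def)
  then obtain k where "k < n" "m = nat \<bar>c ! k\<bar>"
    by (auto simp: in_set_conv_nth n_def)
  then show ?thesis
    using that nat_abs_c by simp
qed

lemma crossing_of_odd [simp]: "crossing_of (Suc (2 * k)) = k"
  by (simp add: crossing_of_def)

lemma crossing_of_J [simp]: "k < n \<Longrightarrow> crossing_of (J k) = k"
  using J(2)[of k] inj_J by (auto simp: crossing_of_def intro!: the_equality)

lemma label_cases:
  assumes "m \<in> {1..2 * n}"
  obtains (odd) k where "k < n" "m = Suc (2 * k)" | (even) k where "k < n" "m = J k"
proof (cases "odd m")
  case True
  then show ?thesis
    using that(1)[of "m div 2"] assms by (auto elim!: oddE)
next
  case False
  then show ?thesis
    using that(2) surj_J[OF assms] by metis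
qed

lemma nx: "m \<in> {1..2 * n} \<Longrightarrow> nx m \<in> {1..2 * n}" "m \<in> {1..2 * n} \<Longrightarrow> prev_label (nx m) = m"
  and prev_label: "m \<in> {1..2 * n} \<Longrightarrow> prev_label m \<in> {1..2 * n}" "m \<in> {1..2 * n} \<Longrightarrow> nx (prev_label m) = m"
  by (auto simp: nx_def next_label_def prev_label_def n_def)

lemma D_nth:
  "k < n \<Longrightarrow> D ! k = (if \<sigma> k then Cross (Suc (2 * k)) (J k) (nx (Suc (2 * k))) (nx (J k))
    else Cross (Suc (2 * k)) (nx (J k)) (nx (Suc (2 * k))) (J k))"
  using bspec[OF pos nth_mem, of k] nat_abs_c[of k]
  by (simp add: D_def nth_dt_diagram n_def dt_piece_def Let_def nx_def not_less order_less_imp_le)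

lemma mem_darts: "x \<in> darts D \<longleftrightarrow> fst x < n \<and> snd x < 4"
proof -
  have "length D = n"
    by (simp add: D_def n_def)
  then show ?thesis
    by (auto simp: in_darts_iff D_nth split: if_splits)
qed

lemma arrive_depart_nth:
  assumes "k < n"
  shows "arrive (Suc (2 * k)) = (k, 0)" "depart (Suc (2 * k)) = (k, 2)"
    "arrive (J k) = (k, if \<sigma> k then 1 else 3)" "depart (J k) = (k, if \<sigma> k then 3 else 1)"
  using assms J(2)[OF assms] by (simp_all add: arrive_def depart_def)

lemma arrive_depart:
  assumes "m \<in> {1..2 * n}"
  shows "arrive m \<in> darts D" "depart m \<in> darts D"
    "dart_edge D (arrive m) = m" "dart_edge D (depart m) = nx m" "arrive m \<noteq> depart m"
  using assms
  by (cases rule: label_cases; simp add: arrive_depart_nth mem_darts dart_edge_eq D_nth)+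

lemma inj_arrive_depart:
  assumes "m \<in> {1..2 * n}" "m' \<in> {1..2 * n}"
  shows "arrive m \<noteq> depart m'"
proof
  assume eq: "arrive m = depart m'"
  show False
    using assms(1)
  proof (cases rule: label_cases)
    case (odd k)
    note k = this
    show ?thesis
      using assms(2)
      by (cases rule: label_cases) (use k eq in \<open>auto simp: arrive_depart_nth split: if_splits\<close>)
  next
    case (even k)
    note k = this
    show ?thesis
      using assms(2)
      by (cases rule: label_cases) (use k eq in \<open>auto simp: arrive_depart_nth split: if_splits\<close>)
  qed
qed

lemma other_arrive: "m \<in> {1..2 * n} \<Longrightarrow> other_dart D (arrive (nx m)) = depart m"
  by (rule other_dart_eqI[OF closed_D])
    (simp_all only: arrive_depart nx inj_arrive_depart not_False_eq_True)

lemma other_depart: "m \<in> {1..2 * n} \<Longrightarrow> other_dart D (depart m) = arrive (nx m)"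
  using other_dart_other_dart[OF closed_D, of "arrive (nx m)"] other_arrive arrive_depart(1) nx by metis

lemma crossing_next_end:
  assumes "k < n"
  defines "i \<equiv> Suc (2 * k)"
  shows "\<sigma> k \<Longrightarrow> next_end D (arrive i) = arrive (J k)" "\<sigma> k \<Longrightarrow> next_end D (arrive (J k)) = depart i"
    "\<sigma> k \<Longrightarrow> next_end D (depart i) = depart (J k)" "\<sigma> k \<Longrightarrow> next_end D (depart (J k)) = arrive i"
    "\<not> \<sigma> k \<Longrightarrow> next_end D (arrive i) = depart (J k)" "\<not> \<sigma> k \<Longrightarrow> next_end D (depart (J k)) = depart i"
    "\<not> \<sigma> k \<Longrightarrow> next_end D (depart i) = arrive (J k)" "\<not> \<sigma> k \<Longrightarrow> next_end D (arrive (J k)) = arrive i"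
  using assms by (simp_all add: arrive_depart_nth next_end_eq D_nth)

text \<open>One equation for each corner of the crossing: the two edges that bound the corner see
  the same face there. The bit \<open>\<sigma> k\<close> decides which edges are neighbours.\<close>

definition crossing_eqs :: "(nat \<Rightarrow> bool) \<Rightarrow> (nat \<Rightarrow> bool) \<Rightarrow> nat \<Rightarrow> bool" where
  "crossing_eqs f a k \<longleftrightarrow> (let i = Suc (2 * k); j = J k in
     if \<sigma> k then f i = a j \<and> f j = f (nx i) \<and> a (nx i) = f (nx j) \<and> a (nx j) = a i
     else f i = f (nx j) \<and> a (nx j) = f (nx i) \<and> a (nx i) = a j \<and> f j = a i)"

text \<open>The orbit of a dart traces the face on the left of its edge when the edge is run through
  towards the dart. Hence \<open>arrive m\<close> stands for the left of \<open>m\<close> and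
  \<open>depart (prev_label m)\<close> for the right.\<close>

lemma face_sets_crossing_eqs:
  assumes "U \<in> face_sets D" "k < n"
  shows "crossing_eqs (\<lambda>m. depart (prev_label m) \<in> U) (\<lambda>m. arrive m \<in> U) k"
proof -
  have face: "next_end D (other_dart D x) \<in> U \<longleftrightarrow> x \<in> U" if "x \<in> darts D" for x
    using assms(1) that unfolding face_sets_def by blast
  have dep: "next_end D (arrive (nx m)) \<in> U \<longleftrightarrow> depart m \<in> U" if "m \<in> {1..2 * n}" for m
    using face[OF arrive_depart(2)[OF that]] by (simp only: other_depart[OF that])
  have dep': "next_end D (arrive m) \<in> U \<longleftrightarrow> depart (prev_label m) \<in> U" if "m \<in> {1..2 * n}" for m
    using dep[OF prev_label(1)[OF that]] by (simp only: prev_label(2)[OF that])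
  have arr: "next_end D (depart m) \<in> U \<longleftrightarrow> arrive (nx m) \<in> U" if "m \<in> {1..2 * n}" for m
    using face[OF arrive_depart(1)[OF nx(1)[OF that]]] by (simp only: other_arrive[OF that])
  have i: "Suc (2 * k) \<in> {1..2 * n}"
    using assms(2) by auto
  note j = J(1)[OF assms(2)]
  show ?thesis
    using crossing_next_end[OF assms(2)] dep'[OF i] dep'[OF j] arr[OF i] arr[OF j] nx(2)[OF i] nx(2)[OF j]
    by (cases "\<sigma> k") (simp_all add: crossing_eqs_def Let_def)
qed

definition boundary :: "(nat \<times> nat) set \<Rightarrow> nat set" where
  "boundary U = {m \<in> {1..2 * n}. (depart (prev_label m) \<in> U) \<noteq> (arrive m \<in> U)}"

text \<open>An even number of the four edges at each crossing. The condition is written passage by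
  passage: membership changes along the odd passage iff it changes along the even one.\<close>

definition cycles :: "nat set set" where
  "cycles = {z. z \<subseteq> {1..2 * n} \<and> (\<forall>k<n. ((Suc (2 * k) \<in> z) \<noteq> (nx (Suc (2 * k)) \<in> z)) =
     ((J k \<in> z) \<noteq> (nx (J k) \<in> z)))}"

lemma boundary_in_cycles:
  assumes "U \<in> face_sets D"
  shows "boundary U \<in> cycles"
proof -
  have "((Suc (2 * k) \<in> boundary U) \<noteq> (nx (Suc (2 * k)) \<in> boundary U)) =
      ((J k \<in> boundary U) \<noteq> (nx (J k) \<in> boundary U))" if k: "k < n" for k
  proof -
    have i: "Suc (2 * k) \<in> {1..2 * n}"
      using k by auto
    note j = J(1)[OF k]
    have "m \<in> boundary U \<longleftrightarrow> (depart (prev_label m) \<in> U) \<noteq> (arrive m \<in> U)" if "m \<in> {1..2 * n}" for m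
      unfolding boundary_def using that by blast
    note b = this[OF i] this[OF j] this[OF nx(1)[OF i]] this[OF nx(1)[OF j]]
    show ?thesis
      using face_sets_crossing_eqs[OF assms k] unfolding b crossing_eqs_def Let_def
      by (cases "\<sigma> k") (simp_all only: if_True if_False simp_thms, blast+)
  qed
  then show ?thesis
    by (auto simp: cycles_def boundary_def)
qed

text \<open>A cycle is determined by whether it contains edge 1 and by the crossings where
  membership changes along the odd passage. The even passage follows suit, so walking along the knot
  recovers all edges.\<close>

lemma card_cycles_le: "finite cycles" "card cycles \<le> 2 ^ Suc n"
proof -
  show "finite cycles"
    by (rule finite_subset[of _ "Pow {1..2 * n}"]) (auto simp: cycles_def)
  let ?w = "\<lambda>z m. (m \<in> z) \<noteq> (nx m \<in> z)"
  let ?h = "\<lambda>z. (1 \<in> z, {k. k < n \<and> ?w z (Suc (2 * k))})"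
  have "inj_on ?h cycles"
  proof (rule inj_onI)
    fix z z' assume z: "z \<in> cycles" "z' \<in> cycles" and eq: "?h z = ?h z'"
    have odd: "?w z (Suc (2 * k)) = ?w z' (Suc (2 * k))" if "k < n" for k
      using eq that by auto
    have w: "?w z m = ?w z' m" if "m \<in> {1..2 * n}" for m
      using that
    proof (cases rule: label_cases)
      case (even k)
      then show ?thesis
        using z odd[of k] by (simp add: cycles_def)
    qed (use odd in simp)
    have mem: "Suc m \<in> z \<longleftrightarrow> Suc m \<in> z'" if "Suc m \<le> 2 * n" for m
      using that
    proof (induction m)
      case 0
      then show ?case
        using eq by simp
    next
      case (Suc m)
      then show ?case
        using w[of "Suc m"] by (auto simp: nx_def next_label_def n_def)
    qed
    have "m \<in> z \<longleftrightarrow> m \<in> z'" for m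
    proof (cases "m \<in> {1..2 * n}")
      case True
      then show ?thesis
        using mem[of "m - 1"] by simp
    next
      case False
      then show ?thesis
        using z by (auto simp: cycles_def)
    qed
    then show "z = z'" by blast
  qed
  moreover have "?h ` cycles \<subseteq> UNIV \<times> Pow {..<n}"
    by auto
  ultimately have "card cycles \<le> card ((UNIV :: bool set) \<times> Pow {..<n})"
    by (intro card_inj_on_le) simp_all
  then show "card cycles \<le> 2 ^ Suc n"
    by (simp add: card_cartesian_product card_Pow)
qed

text \<open>Whether the two sets agree at a face passes across every edge, because the boundaries
  are equal, and around every crossing; so it is constant on the whole diagram.\<close>

lemma boundary_eqD:
  assumes "U \<in> face_sets D" "U' \<in> face_sets D" "boundary U = boundary U'"
  shows "U' = U \<or> U' = darts D - U"
proof -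
  let ?w = "\<lambda>x. (x \<in> U) = (x \<in> U')"
  have edge: "?w (depart m) = ?w (arrive (nx m))" if "m \<in> {1..2 * n}" for m
  proof -
    have "nx m \<in> boundary U \<longleftrightarrow> nx m \<in> boundary U'"
      using assms(3) by simp
    then show ?thesis
      using nx[OF that] by (auto simp: boundary_def simp del: atLeastAtMost_iff)
  qed
  have crossing: "?w (depart (Suc (2 * k))) = ?w (arrive (Suc (2 * k)))" "?w (arrive (J k)) = ?w (arrive (Suc (2 * k)))"
    "?w (depart (J k)) = ?w (arrive (Suc (2 * k)))" if k: "k < n" for k
  proof -
    have i: "Suc (2 * k) \<in> {1..2 * n}"
      using k by auto
    note j = J(1)[OF k]
    show "?w (depart (Suc (2 * k))) = ?w (arrive (Suc (2 * k)))" "?w (arrive (J k)) = ?w (arrive (Suc (2 * k)))"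
      "?w (depart (J k)) = ?w (arrive (Suc (2 * k)))"
      using face_sets_crossing_eqs[OF assms(1) k] face_sets_crossing_eqs[OF assms(2) k]
        edge[OF i] edge[OF j] edge[OF prev_label(1)[OF i]] edge[OF prev_label(1)[OF j]]
      by (auto simp: crossing_eqs_def Let_def nx(2)[OF i] nx(2)[OF j] prev_label(2)[OF i] prev_label(2)[OF j] split: if_splits)
  qed
  have passage: "?w (depart m) = ?w (arrive m)" if "m \<in> {1..2 * n}" for m
    using that by (cases rule: label_cases) (use crossing in simp_all)
  have arr: "?w (arrive (Suc m)) = ?w (arrive 1)" if "Suc m \<le> 2 * n" for m
    using that
  proof (induction m)
    case (Suc m)
    then show ?case
      using edge[of "Suc m"] passage[of "Suc m"] by (auto simp: nx_def next_label_def n_def)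
  qed simp
  have "?w x = ?w (arrive 1)" if "x \<in> darts D" for x
  proof -
    obtain k r where x: "x = (k, r)" "k < n" "r < 4"
      using \<open>x \<in> darts D\<close> mem_darts by (cases x) auto
    then have "x \<in> {arrive (Suc (2 * k)), depart (Suc (2 * k)), arrive (J k), depart (J k)}"
      by (auto simp: arrive_depart_nth)
    then show ?thesis
      using crossing[OF x(2)] arr[of "2 * k"] x(2) by auto
  qed
  then show ?thesis
    using assms(1,2) by (cases "?w (arrive 1)") (auto simp: face_sets_def)
qed

lemma num_faces_dt_diagram: "num_faces D = n + 2"
proof -
  have "edges D = {1..2 * n}"
  proof
    show "edges D \<subseteq> {1..2 * n}"
      using edges_dt_diagram_subset[OF valid] by (simp add: D_def n_def)
    show "{1..2 * n} \<subseteq> edges D"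
    proof
      fix m assume "m \<in> {1..2 * n}"
      then show "m \<in> edges D"
        using dart_in_edges[OF arrive_depart(1)] arrive_depart(3) by metis
    qed
  qed
  then have "n + num_faces D = card {1..2 * n} + 2"
    using knot by (simp add: knot_diagram_def D_def n_def)
  then show ?thesis by simp
qed

text \<open>The bounds on sets of faces and on cycles meet, so the boundary map is onto. The left
  sides of the edges are not separate unknowns: they differ from the right sides exactly on
  \<open>z\<close>.\<close>

lemma cycle_bounds:
  assumes "z \<in> cycles"
  shows "\<exists>f. \<forall>k<n. crossing_eqs f (\<lambda>m. f m \<noteq> (m \<in> z)) k"
proof -
  have fin: "finite (face_sets D)"
    by (rule finite_subset[of _ "Pow (darts D)"]) (auto simp: face_sets_def)
  have "2 ^ (n + 2) \<le> card (face_sets D)"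
    using card_face_sets_ge[OF closed_D] by (simp add: num_faces_dt_diagram)
  also have "\<dots> \<le> 2 * card (boundary ` face_sets D)"
    by (rule card_le_twice_card_image[OF fin]) (rule boundary_eqD)
  finally have "card cycles \<le> card (boundary ` face_sets D)"
    using card_cycles_le(2) by simp
  then have "boundary ` face_sets D = cycles"
    using boundary_in_cycles card_cycles_le(1) by (intro card_seteq) blast+
  then have "z \<in> boundary ` face_sets D"
    using assms by simp
  then obtain U where U: "U \<in> face_sets D" "boundary U = z"
    by (elim imageE) simp
  have arrive: "arrive m \<in> U \<longleftrightarrow> (depart (prev_label m) \<in> U) \<noteq> (m \<in> z)" if "m \<in> {1..2 * n}" for m
    unfolding U(2)[symmetric] boundary_def using that by blast
  have "crossing_eqs (\<lambda>m. depart (prev_label m) \<in> U) (\<lambda>m. (depart (prev_label m) \<in> U) \<noteq> (m \<in> z)) k" if k: "k < n" for k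
  proof -
    have i: "Suc (2 * k) \<in> {1..2 * n}"
      using k by auto
    note j = J(1)[OF k]
    show ?thesis
      using face_sets_crossing_eqs[OF U(1) k]
      unfolding crossing_eqs_def Let_def arrive[OF i] arrive[OF j] arrive[OF nx(1)[OF i]] arrive[OF nx(1)[OF j]] .
  qed
  then show ?thesis by blast
qed

end

section \<open>Signs forced by a DT code\<close>

lemma planar_cycle_bounds:
  assumes "valid_dt_code c" "\<forall>x \<in> set c. 0 < x" "knot_diagram (dt_diagram c \<sigma>)"
    and "z \<subseteq> {1..2 * length c}"
    and "\<forall>k<length c. ((Suc (2 * k) \<in> z) \<noteq> (next_label (length c) (Suc (2 * k)) \<in> z)) =
      ((nat (c ! k) \<in> z) \<noteq> (next_label (length c) (nat (c ! k)) \<in> z))"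
  shows "\<exists>f. \<forall>k<length c. let i = Suc (2 * k); i' = next_label (length c) i;
      j = nat (c ! k); j' = next_label (length c) j; a = (\<lambda>m. f m \<noteq> (m \<in> z))
    in (\<sigma> k \<longrightarrow> f i = a j \<and> f j = f i' \<and> a i' = f j' \<and> a j' = a i) \<and>
       (\<not> \<sigma> k \<longrightarrow> f i = f j' \<and> a j' = f i' \<and> a i' = a j \<and> f j = a i)"
  using cycle_bounds[OF assms(1-3), of z] assms(4,5)
  by (simp only: crossing_eqs_def[OF assms(1-3)] cycles_def[OF assms(1-3)] Let_def mem_Collect_eq simp_thms
      if_bool_eq_conj)

text \<open>As many distinct even numbers between 1 and 2n as there are such numbers must be all of
  them, so the set equation reduces to simple checks of the entries.\<close>

lemma valid_dt_codeI:
  assumes "c \<noteq> []" "distinct (map (\<lambda>x. nat \<bar>x\<bar>) c)"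
    and "\<forall>x \<in> set c. x \<noteq> 0 \<and> \<bar>x\<bar> \<le> 2 * int (length c) \<and> even x"
  shows "valid_dt_code c"
proof -
  let ?L = "map (\<lambda>x. nat \<bar>x\<bar>) c" and ?E = "{m \<in> {1..2 * length c}. even m}"
  have "?E = (*) 2 ` {1..length c}"
    by (auto elim!: evenE)
  then have "card ?E = length c"
    by (simp add: card_image inj_on_def)
  then have "card ?E = card (set ?L)"
    using distinct_card[OF assms(2)] by simp
  moreover have "set ?L \<subseteq> ?E"
    using assms(3) by (auto simp: even_nat_iff nat_le_iff Suc_le_eq)
  ultimately have "set ?L = ?E"
    by (intro card_subset_eq) simp_all
  then show ?thesis
    using assms(1,2) by (simp add: valid_dt_code_def)
qed

text \<open>\<open>S\<close> consists of the crossings whose bit equals that of crossing 0; the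
  others have the opposite bit. So at most two choices of bits are spherical, and they are negations
  of each other.\<close>

definition signs_forced :: "int list \<Rightarrow> nat set \<Rightarrow> bool" where
  "signs_forced c S \<longleftrightarrow> (\<forall>\<sigma>. knot_diagram (dt_diagram c \<sigma>) \<longrightarrow>
     (\<forall>k<length c. \<sigma> k = (\<sigma> 0 = (k \<in> S))))"

lemma has_dt_code_unique:
  assumes "valid_dt_code c" "signs_forced (map abs c) S" and D: "has_dt_code D c" and E: "has_dt_code E c"
  shows "same_knot D E"
proof -
  obtain \<sigma> where \<sigma>: "knot_diagram (dt_diagram c \<sigma>)" "isotopic D (dt_diagram c \<sigma>)"
    using has_dt_code_imp_isotopic[OF D assms(1)] by blast
  obtain \<tau> where \<tau>: "knot_diagram (dt_diagram c \<tau>)" "isotopic E (dt_diagram c \<tau>)"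
    using has_dt_code_imp_isotopic[OF E assms(1)] by blast
  have forced: "\<rho> k = (\<rho> 0 = (k \<in> S))" if "knot_diagram (dt_diagram c \<rho>)" "k < length c" for \<rho> k
    using assms(2) knot_diagram_dt_diagram_abs[OF that(1)] that(2) by (simp add: signs_forced_def)
  show ?thesis
  proof (cases "\<sigma> 0 = \<tau> 0")
    case True
    then have "\<sigma> k = \<tau> k" if "k < length c" for k
      using forced[OF \<sigma>(1) that] forced[OF \<tau>(1) that] by simp
    then have "dt_diagram c \<sigma> = dt_diagram c \<tau>"
      by (simp add: dt_diagram_def)
    then have "isotopic D E"
      using \<sigma>(2) isotopic_sym[OF \<tau>(2)] by (simp add: isotopic_trans)
    then show ?thesis
      by (simp add: same_knot_def)
  next
    case False
    then have "\<sigma> k = (\<not> \<tau> k)" if "k < length c" for k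
      using forced[OF \<sigma>(1) that] forced[OF \<tau>(1) that] by auto
    then have "dt_diagram c \<sigma> = mirror_image (dt_diagram c \<tau>)"
      unfolding mirror_image_dt_diagram by (simp add: dt_diagram_def)
    then have "isotopic D (mirror_image E)"
      using \<sigma>(2) isotopic_sym[OF isotopic_mirror_image[OF \<tau>(2)]] by (simp add: isotopic_trans)
    then show ?thesis
      by (simp add: same_knot_def)
  qed
qed

lemma next_label_11: "next_label 11 m = (if m = 22 then 1 else m + 1)"
  by (simp add: next_label_def)

lemma all_less_11: "(\<forall>k<11::nat. P k) \<longleftrightarrow>
    P 0 \<and> P 1 \<and> P 2 \<and> P 3 \<and> P 4 \<and> P 5 \<and> P 6 \<and> P 7 \<and> P 8 \<and> P 9 \<and> P 10"
proof -
  have "k < 11 \<longleftrightarrow> k = 0 \<or> k = 1 \<or> k = 2 \<or> k = 3 \<or> k = 4 \<or> k = 5 \<or> k = 6 \<or> k = 7 \<or> k = 8 \<or> k = 9 \<or> k = 10"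
    for k :: nat
    by arith
  then show ?thesis
    by (simp only: imp_disjL all_conj_distrib simp_thms)
qed

text \<open>
  In each of the following lemmas, \<open>{l..h}\<close> is the loop of the knot that starts and ends at one
  crossing. Following its two sides around the knot gives the relative signs of that crossing and
  those where the loop crosses the rest of the knot.
\<close>

lemma signs_forced_K11a43: "signs_forced K11a43 UNIV"
  unfolding signs_forced_def
proof (intro allI impI)
  fix \<sigma> k assume knot: "knot_diagram (dt_diagram K11a43 \<sigma>)" and k: "k < length K11a43"
  have len: "length K11a43 = 11" and pos: "\<forall>x \<in> set K11a43. 0 < x" and valid: "valid_dt_code K11a43"
    by (simp_all add: K11a43_def valid_dt_codeI)
  note bounds = planar_cycle_bounds[OF valid pos knot, unfolded len all_less_11 next_label_11]
  \<comment> \<open>Crossing 1 carries the labels 3 and 8. Passage 3 is left on edge 4 and passage 8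
    is entered on edge 8, which gives the loop of the edges 4 to 8. The bits follow propositionally
    from the corner equations.\<close>
  have loop1: "\<sigma> 0 = \<sigma> 1 \<and> \<sigma> 2 = \<sigma> 1 \<and> \<sigma> 3 = \<sigma> 1 \<and> \<sigma> 6 = \<sigma> 1"
    using bounds[of "{4..8}"]
    by (simp add: K11a43_def Let_def) (elim exE, sat)
  have loop2: "\<sigma> 2 = \<sigma> 4 \<and> \<sigma> 6 = \<sigma> 4 \<and> \<sigma> 9 = \<sigma> 4 \<and> \<sigma> 10 = \<sigma> 4"
    using bounds[of "{10..20}"]
    by (simp add: K11a43_def Let_def) (elim exE, sat)
  have loop3: "\<sigma> 2 = \<sigma> 5 \<and> \<sigma> 6 = \<sigma> 5 \<and> \<sigma> 7 = \<sigma> 5 \<and> \<sigma> 8 = \<sigma> 5"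
    using bounds[of "{12..16}"]
    by (simp add: K11a43_def Let_def) (elim exE, sat)
  \<comment> \<open>The loops are based at the crossings 1, 4 and 5. All three are compared with the
    crossings 2 and 6, which links everything to crossing 0.\<close>
  have "\<forall>k<11. \<sigma> k = (\<sigma> 0 = (k \<in> UNIV))"
    unfolding all_less_11 using loop1 loop2 loop3 by (simp (no_asm) del: One_nat_def) argo
  with k show "\<sigma> k = (\<sigma> 0 = (k \<in> UNIV))"
    unfolding len by blast
qed

lemma signs_forced_K11a44: "signs_forced K11a44 {0, 1, 3, 4, 9, 10}"
  unfolding signs_forced_def
proof (intro allI impI)
  fix \<sigma> k assume knot: "knot_diagram (dt_diagram K11a44 \<sigma>)" and k: "k < length K11a44"
  have len: "length K11a44 = 11" and pos: "\<forall>x \<in> set K11a44. 0 < x" and valid: "valid_dt_code K11a44"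
    by (simp_all add: K11a44_def valid_dt_codeI)
  note bounds = planar_cycle_bounds[OF valid pos knot, unfolded len all_less_11 next_label_11]
  have loop1: "\<sigma> 1 = \<sigma> 0 \<and> \<sigma> 3 = \<sigma> 0"
    using bounds[of "{2..4}"]
    by (simp add: K11a44_def Let_def) (elim exE, sat)
  have loop2: "\<sigma> 1 = (\<not> \<sigma> 2) \<and> \<sigma> 3 = (\<not> \<sigma> 2) \<and> \<sigma> 4 = (\<not> \<sigma> 2) \<and> \<sigma> 5 = \<sigma> 2 \<and> \<sigma> 6 = \<sigma> 2 \<and> \<sigma> 7 = \<sigma> 2 \<and> \<sigma> 8 = \<sigma> 2 \<and> \<sigma> 10 = (\<not> \<sigma> 2)"
    using bounds[of "{6..14}"]
    by (simp add: K11a44_def Let_def) (elim exE, sat)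
  have loop3: "\<sigma> 2 = (\<not> \<sigma> 4) \<and> \<sigma> 7 = (\<not> \<sigma> 4) \<and> \<sigma> 9 = \<sigma> 4 \<and> \<sigma> 10 = \<sigma> 4"
    using bounds[of "{10..20}"]
    by (simp add: K11a44_def Let_def) (elim exE, sat)
  have "\<forall>k<11. \<sigma> k = (\<sigma> 0 = (k \<in> {0, 1, 3, 4, 9, 10}))"
    unfolding all_less_11 using loop1 loop2 loop3 by (simp (no_asm) del: One_nat_def) argo
  with k show "\<sigma> k = (\<sigma> 0 = (k \<in> {0, 1, 3, 4, 9, 10}))"
    unfolding len by blast
qed

lemma signs_forced_K11a47: "signs_forced K11a47 {0, 1, 3, 6, 8, 9}"
  unfolding signs_forced_def
proof (intro allI impI)
  fix \<sigma> k assume knot: "knot_diagram (dt_diagram K11a47 \<sigma>)" and k: "k < length K11a47"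
  have len: "length K11a47 = 11" and pos: "\<forall>x \<in> set K11a47. 0 < x" and valid: "valid_dt_code K11a47"
    by (simp_all add: K11a47_def valid_dt_codeI)
  note bounds = planar_cycle_bounds[OF valid pos knot, unfolded len all_less_11 next_label_11]
  have loop1: "\<sigma> 1 = \<sigma> 0 \<and> \<sigma> 3 = \<sigma> 0"
    using bounds[of "{2..4}"]
    by (simp add: K11a47_def Let_def) (elim exE, sat)
  have loop2: "\<sigma> 1 = (\<not> \<sigma> 2) \<and> \<sigma> 3 = (\<not> \<sigma> 2) \<and> \<sigma> 4 = \<sigma> 2 \<and> \<sigma> 5 = \<sigma> 2 \<and> \<sigma> 6 = (\<not> \<sigma> 2) \<and> \<sigma> 7 = \<sigma> 2 \<and> \<sigma> 8 = (\<not> \<sigma> 2) \<and> \<sigma> 10 = \<sigma> 2"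
    using bounds[of "{6..14}"]
    by (simp add: K11a47_def Let_def) (elim exE, sat)
  have loop3: "\<sigma> 2 = (\<not> \<sigma> 6) \<and> \<sigma> 7 = (\<not> \<sigma> 6) \<and> \<sigma> 8 = \<sigma> 6 \<and> \<sigma> 9 = \<sigma> 6"
    using bounds[of "{14..18}"]
    by (simp add: K11a47_def Let_def) (elim exE, sat)
  have "\<forall>k<11. \<sigma> k = (\<sigma> 0 = (k \<in> {0, 1, 3, 6, 8, 9}))"
    unfolding all_less_11 using loop1 loop2 loop3 by (simp (no_asm) del: One_nat_def) argo
  with k show "\<sigma> k = (\<sigma> 0 = (k \<in> {0, 1, 3, 6, 8, 9}))"
    unfolding len by blast
qed

lemma signs_forced_K11a57: "signs_forced K11a57 {0, 1, 2, 3, 7}"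
  unfolding signs_forced_def
proof (intro allI impI)
  fix \<sigma> k assume knot: "knot_diagram (dt_diagram K11a57 \<sigma>)" and k: "k < length K11a57"
  have len: "length K11a57 = 11" and pos: "\<forall>x \<in> set K11a57. 0 < x" and valid: "valid_dt_code K11a57"
    by (simp_all add: K11a57_def valid_dt_codeI)
  note bounds = planar_cycle_bounds[OF valid pos knot, unfolded len all_less_11 next_label_11]
  have loop1: "\<sigma> 0 = \<sigma> 1 \<and> \<sigma> 2 = \<sigma> 1 \<and> \<sigma> 3 = \<sigma> 1 \<and> \<sigma> 7 = \<sigma> 1"
    using bounds[of "{4..8}"]
    by (simp add: K11a57_def Let_def) (elim exE, sat)
  have loop2: "\<sigma> 1 = \<sigma> 2 \<and> \<sigma> 3 = \<sigma> 2 \<and> \<sigma> 4 = (\<not> \<sigma> 2) \<and> \<sigma> 5 = (\<not> \<sigma> 2) \<and> \<sigma> 6 = (\<not> \<sigma> 2) \<and> \<sigma> 8 = (\<not> \<sigma> 2) \<and> \<sigma> 9 = (\<not> \<sigma> 2) \<and> \<sigma> 10 = (\<not> \<sigma> 2)"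
    using bounds[of "{6..16}"]
    by (simp add: K11a57_def Let_def) (elim exE, sat)
  have "\<forall>k<11. \<sigma> k = (\<sigma> 0 = (k \<in> {0, 1, 2, 3, 7}))"
    unfolding all_less_11 using loop1 loop2 by (simp (no_asm) del: One_nat_def) argo
  with k show "\<sigma> k = (\<sigma> 0 = (k \<in> {0, 1, 2, 3, 7}))"
    unfolding len by blast
qed

lemma signs_forced_K11a231: "signs_forced K11a231 {0, 1, 4, 6, 9}"
  unfolding signs_forced_def
proof (intro allI impI)
  fix \<sigma> k assume knot: "knot_diagram (dt_diagram K11a231 \<sigma>)" and k: "k < length K11a231"
  have len: "length K11a231 = 11" and pos: "\<forall>x \<in> set K11a231. 0 < x" and valid: "valid_dt_code K11a231"
    by (simp_all add: K11a231_def valid_dt_codeI)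
  note bounds = planar_cycle_bounds[OF valid pos knot, unfolded len all_less_11 next_label_11]
  have loop1: "\<sigma> 0 = \<sigma> 1 \<and> \<sigma> 4 = \<sigma> 1 \<and> \<sigma> 6 = \<sigma> 1 \<and> \<sigma> 9 = \<sigma> 1"
    using bounds[of "{4..14}"]
    by (simp add: K11a231_def Let_def) (elim exE, sat)
  have loop2: "\<sigma> 1 = \<sigma> 4 \<and> \<sigma> 2 = (\<not> \<sigma> 4) \<and> \<sigma> 3 = (\<not> \<sigma> 4) \<and> \<sigma> 5 = (\<not> \<sigma> 4) \<and> \<sigma> 6 = \<sigma> 4 \<and> \<sigma> 7 = (\<not> \<sigma> 4) \<and> \<sigma> 8 = (\<not> \<sigma> 4) \<and> \<sigma> 10 = (\<not> \<sigma> 4)"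
    using bounds[of "{10..18}"]
    by (simp add: K11a231_def Let_def) (elim exE, sat)
  have "\<forall>k<11. \<sigma> k = (\<sigma> 0 = (k \<in> {0, 1, 4, 6, 9}))"
    unfolding all_less_11 using loop1 loop2 by (simp (no_asm) del: One_nat_def) argo
  with k show "\<sigma> k = (\<sigma> 0 = (k \<in> {0, 1, 4, 6, 9}))"
    unfolding len by blast
qed

lemma signs_forced_K11a263: "signs_forced K11a263 UNIV"
  unfolding signs_forced_def
proof (intro allI impI)
  fix \<sigma> k assume knot: "knot_diagram (dt_diagram K11a263 \<sigma>)" and k: "k < length K11a263"
  have len: "length K11a263 = 11" and pos: "\<forall>x \<in> set K11a263. 0 < x" and valid: "valid_dt_code K11a263"
    by (simp_all add: K11a263_def valid_dt_codeI)
  note bounds = planar_cycle_bounds[OF valid pos knot, unfolded len all_less_11 next_label_11]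
  \<comment> \<open>The base is crossing 2 with the labels 5 and 16. Each of the ten other crossings
    has exactly one label between 6 and 15, so the rest of the knot meets this loop at all of them
    and one loop is enough.\<close>
  have loop1: "\<sigma> 0 = \<sigma> 2 \<and> \<sigma> 1 = \<sigma> 2 \<and> \<sigma> 3 = \<sigma> 2 \<and> \<sigma> 4 = \<sigma> 2 \<and> \<sigma> 5 = \<sigma> 2 \<and> \<sigma> 6 = \<sigma> 2 \<and> \<sigma> 7 = \<sigma> 2 \<and> \<sigma> 8 = \<sigma> 2 \<and> \<sigma> 9 = \<sigma> 2 \<and> \<sigma> 10 = \<sigma> 2"
    using bounds[of "{6..16}"]
    by (simp add: K11a263_def Let_def) (elim exE, sat)
  have "\<forall>k<11. \<sigma> k = (\<sigma> 0 = (k \<in> UNIV))"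
    unfolding all_less_11 using loop1 by (simp (no_asm) del: One_nat_def) argo
  with k show "\<sigma> k = (\<sigma> 0 = (k \<in> UNIV))"
    unfolding len by blast
qed

section \<open>Recognising knot diagrams\<close>

text \<open>A list of closed walks under the face permutation that uses every dart exactly once is
  the list of its orbits.\<close>

lemma num_faces_eq_length:
  assumes "distinct (concat Fs)" "set (concat Fs) = darts D" "[] \<notin> set Fs"
    and step: "\<forall>F \<in> set Fs. \<forall>(x, y) \<in> set (zip F (rotate1 F)). (x, y) \<in> face_step D"
    and closed: "closed_diagram D"
  shows "num_faces D = length Fs"
proof -
  let ?R = "(face_step D)\<^sup>*"
  have face: "?R `` {x} = set F" if F: "F \<in> set Fs" and x: "x \<in> set F" for F x
  proof -
    let ?l = "length F"
    have "0 < ?l"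
      using x by (cases F) auto
    have nth_step: "(F ! i, F ! (Suc i mod ?l)) \<in> face_step D" if "i < ?l" for i
    proof -
      have "zip F (rotate1 F) ! i \<in> set (zip F (rotate1 F))"
        using that by (intro nth_mem) simp
      then show ?thesis
        using step F that by (auto simp: nth_rotate1)
    qed
    have sub: "?R `` {x} \<subseteq> set F"
    proof -
      have "y \<in> set F" if "(x, y) \<in> ?R" for y
        using that
      proof (induction rule: rtrancl_induct)
        case (step y z)
        then obtain i where i: "i < ?l" "y = F ! i"
          by (auto simp: in_set_conv_nth)
        then have "z = F ! (Suc i mod ?l)"
          using step.hyps(2) nth_step[OF i(1)] by (simp add: face_step_iff[OF closed])
        then show ?case
          using \<open>0 < ?l\<close> by (simp add: nth_mem)
      qed (rule x)
      then show ?thesis by auto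
    qed
    have reach0: "(F ! 0, F ! i) \<in> ?R" if "i < ?l" for i
      using that
    proof (induction i)
      case (Suc i)
      then show ?case
        using nth_step[of i] by (auto intro: rtrancl_into_rtrancl)
    qed simp
    have "set F \<subseteq> ?R `` {x}"
    proof
      fix y assume "y \<in> set F"
      then have "(F ! 0, y) \<in> ?R" "(F ! 0, x) \<in> ?R"
        using reach0 x by (auto simp: in_set_conv_nth)
      then have "(x, y) \<in> ?R"
        using sym_face_step_rtrancl[OF closed] by (meson rtrancl_trans symD)
      then show "y \<in> ?R `` {x}" by simp
    qed
    with sub show ?thesis by blast
  qed
  have "darts D // ?R = set ` set Fs"
  proof (intro equalityI subsetI)
    fix X assume "X \<in> darts D // ?R"
    then obtain x where x: "x \<in> darts D" "X = ?R `` {x}"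
      by (metis quotientE)
    then obtain F where "F \<in> set Fs" "x \<in> set F"
      using assms(2) by auto
    with face x(2) show "X \<in> set ` set Fs"
      by (intro image_eqI[of _ _ F]) simp_all
  next
    fix X assume "X \<in> set ` set Fs"
    then obtain F where F: "F \<in> set Fs" "X = set F"
      by (elim imageE)
    moreover have "F \<noteq> []"
      using F(1) assms(3) by auto
    ultimately have hd: "hd F \<in> darts D" "X = ?R `` {hd F}"
      using face[of F "hd F"] assms(2) by auto
    show "X \<in> darts D // ?R"
      unfolding hd(2) using hd(1) by (rule quotientI)
  qed
  moreover have "inj_on set (set Fs)"
  proof (rule inj_onI)
    fix F G assume FG: "F \<in> set Fs" "G \<in> set Fs" "set F = set G"
    then show "F = G"
      using assms(1,3) unfolding distinct_concat_iff
      by (metis inf.idem set_empty)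
  qed
  moreover have "distinct Fs"
    using assms(1,3) unfolding distinct_concat_iff by (metis removeAll_id)
  ultimately show ?thesis
    by (simp add: num_faces_def card_image distinct_card)
qed

lemma one_component_walkI:
  assumes "D \<noteq> []" "edges D \<subseteq> {1..N}"
    and walk: "\<And>m. 1 \<le> m \<Longrightarrow> m < N \<Longrightarrow> (m, Suc m) \<in> (\<Union>p \<in> set D. strand_pairs p)"
  shows "one_component D"
proof -
  let ?R = "\<Union>p \<in> set D. strand_pairs p"
  have "sym (strand_pairs p)" for p :: "nat piece"
    by (cases p) (auto simp: sym_def)
  then have sym: "sym (?R\<^sup>*)"
    by (intro sym_rtrancl) (auto simp: sym_def)
  have reach: "(1, Suc m) \<in> ?R\<^sup>*" if "Suc m \<le> N" for m
    using that
  proof (induction m)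
    case (Suc m)
    then show ?case
      using walk[of "Suc m"] by (auto intro: rtrancl_into_rtrancl)
  qed simp
  have "(a, b) \<in> ?R\<^sup>*" if "a \<in> edges D" "b \<in> edges D" for a b
  proof -
    have "(1, a) \<in> ?R\<^sup>*" "(1, b) \<in> ?R\<^sup>*"
      using reach[of "a - 1"] reach[of "b - 1"] that assms(2) by auto
    then show ?thesis
      using sym by (meson rtrancl_trans symD)
  qed
  then show ?thesis
    using assms(1) by (simp add: one_component_def)
qed

text \<open>A form of the face step that evaluates on concrete lists. Adding 3 modulo 4 goes one
  place back about a crossing, so \<open>z\<close> is the end just before \<open>y\<close>; it must
  be the other end of the edge of \<open>x\<close>.\<close>

definition face_arrow :: "diagram \<Rightarrow> nat \<times> nat \<Rightarrow> nat \<times> nat \<Rightarrow> bool" where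
  "face_arrow D x y \<longleftrightarrow> (let z = (fst y, (snd y + 3) mod 4) in x \<noteq> z \<and>
     piece_ends (D ! fst x) ! snd x = piece_ends (D ! fst z) ! snd z)"

lemma strand_pairs_dt_diagram:
  assumes "valid_dt_code c" "m \<in> {1..2 * length c}"
  shows "(m, next_label (length c) m) \<in> (\<Union>p \<in> set (dt_diagram c \<sigma>). strand_pairs p)"
proof -
  let ?n = "length c"
  have pairs: "(i, next_label ?n i) \<in> strand_pairs (dt_piece ?n i x s)"
    "(nat \<bar>x\<bar>, next_label ?n (nat \<bar>x\<bar>)) \<in> strand_pairs (dt_piece ?n i x s)" for i x s
    by (auto simp: dt_piece_def Let_def)
  obtain k where k: "k < ?n" "m = 2 * k + 1 \<or> m = nat \<bar>c ! k\<bar>"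
  proof (cases "odd m")
    case True
    then show ?thesis
      using that[of "m div 2"] assms(2) by (auto elim!: oddE)
  next
    case False
    then have "m \<in> set (map (\<lambda>x. nat \<bar>x\<bar>) c)"
      using assms by (simp add: valid_dt_code_def)
    then show ?thesis
      using that by (auto simp: in_set_conv_nth)
  qed
  then have "(m, next_label ?n m) \<in> strand_pairs (dt_diagram c \<sigma> ! k)"
    using pairs by (auto simp: nth_dt_diagram)
  then show ?thesis
    using nth_mem[of k "dt_diagram c \<sigma>"] k(1) by auto
qed

lemma edges_dt_diagram:
  assumes "valid_dt_code c"
  shows "edges (dt_diagram c \<sigma>) = {1..2 * length c}"
proof
  have ends: "a \<in> set (piece_ends p)" if "(a, b) \<in> strand_pairs p" for a b :: nat and p
    using that by (cases p) auto
  show "{1..2 * length c} \<subseteq> edges (dt_diagram c \<sigma>)"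
  proof
    fix m assume "m \<in> {1..2 * length c}"
    then obtain p where "p \<in> set (dt_diagram c \<sigma>)" "(m, next_label (length c) m) \<in> strand_pairs p"
      using strand_pairs_dt_diagram[OF assms] by blast
    then show "m \<in> edges (dt_diagram c \<sigma>)"
      using ends piece_ends_subset_edges by blast
  qed
qed (rule edges_dt_diagram_subset[OF assms])

text \<open>\<open>Fs\<close> is a certificate for the Euler characteristic: 4n distinct darts are
  all the darts of n crossings, so the n + 2 given cycles are all the faces. Connectedness comes
  from following the labels.\<close>

lemma knot_diagram_dt_diagramI:
  assumes c: "valid_dt_code c" and D: "D = dt_diagram c \<sigma>" "closed_diagram D"
    and Fs: "distinct (concat Fs)" "\<forall>(i, k) \<in> set (concat Fs). i < length c \<and> k < 4"
      "length (concat Fs) = 4 * length c" "[] \<notin> set Fs" "length Fs = length c + 2"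
    and arrows: "\<forall>F \<in> set Fs. \<forall>(x, y) \<in> set (zip F (rotate1 F)). face_arrow D x y"
  shows "knot_diagram D"
proof -
  have length: "length D = length c"
    by (simp add: D)
  have len: "length (piece_ends (D ! i)) = 4" if "i < length D" for i
    using that by (auto simp: D nth_dt_diagram dt_piece_def Let_def)
  have darts: "darts D = {..<length D} \<times> {..<4}"
    using len by (auto simp: darts_def)
  have sub: "set (concat Fs) \<subseteq> darts D"
    using Fs(2) unfolding darts length by auto
  moreover have "card (set (concat Fs)) = card (darts D)"
    using distinct_card[OF Fs(1)] Fs(3) by (simp add: darts length)
  ultimately have set: "set (concat Fs) = darts D"
    by (intro card_subset_eq) simp_all
  have "(x, y) \<in> face_step D" if F: "F \<in> set Fs" "(x, y) \<in> set (zip F (rotate1 F))" for F x y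
  proof -
    have "x \<in> set F" "y \<in> set F"
      using set_zip_leftD[OF F(2)] set_zip_rightD[OF F(2)] by simp_all
    then have xy: "x \<in> darts D" "y \<in> darts D"
      using F(1) set by auto
    define z where "z = (fst y, (snd y + 3) mod 4)"
    have z: "z \<in> darts D"
      using xy(2) by (auto simp: z_def darts)
    have "snd y < 4"
      using xy(2) by (auto simp: darts)
    then have "Suc ((snd y + 3) mod 4) mod 4 = snd y"
      by (simp add: mod_Suc_eq)
    then have "next_end D z = y"
      using z len by (simp add: next_end_eq z_def in_darts_iff)
    moreover have "face_arrow D x y"
      using bspec[OF bspec[OF arrows F(1)] F(2)] by simp
    then have "x \<noteq> z" "dart_edge D x = dart_edge D z"
      by (simp_all add: face_arrow_def Let_def z_def dart_edge_eq)
    ultimately show ?thesis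
      using xy(1) z unfolding face_step_def by blast
  qed
  then have "num_faces D = length Fs"
    using set by (intro num_faces_eq_length Fs D(2)) auto
  moreover have edges: "edges D = {1..2 * length c}"
    unfolding D(1) by (rule edges_dt_diagram[OF c])
  moreover have "one_component D"
  proof (rule one_component_walkI)
    show "D \<noteq> []"
      using c length by (auto simp: valid_dt_code_def)
    show "edges D \<subseteq> {1..2 * length c}"
      by (simp add: edges)
    show "(m, Suc m) \<in> (\<Union>p \<in> set D. strand_pairs p)" if "1 \<le> m" "m < 2 * length c" for m
      using strand_pairs_dt_diagram[OF c, of m \<sigma>] that by (simp add: D next_label_def)
  qed
  ultimately show ?thesis
    using D(2) Fs(5) by (simp add: knot_diagram_def length)
qed

section \<open>Realising a code by a diagram\<close>

lemma dt_crossing_dt_piece: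
  assumes "p = dt_piece n i x s \<or> p = turn_piece (dt_piece n i x s)" "even (nat \<bar>x\<bar>)"
    and "e i = i" "e (i + 1) = next_label n i"
    and "e (nat \<bar>x\<bar>) = nat \<bar>x\<bar>" "e (nat \<bar>x\<bar> + 1) = next_label n (nat \<bar>x\<bar>)"
  shows "dt_crossing e i x p"
proof (cases "x < 0")
  case True
  with assms(1) show ?thesis
    by (cases s; elim disjE)
      (simp_all only: dt_piece_def Let_def turn_piece.simps dt_crossing.simps if_True if_False
        assms(2-) insert_commute simp_thms)
next
  case False
  with assms(1) show ?thesis
    by (cases s; elim disjE)
      (simp_all only: dt_piece_def Let_def turn_piece.simps dt_crossing.simps if_True if_False
        assms(2-) insert_commute simp_thms)
qed

text \<open>\<open>E\<close> lists the crossings by odd label, \<open>D\<close> in the order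
  produced by a construction. Sphericity is required for the code without signs, so that codes with
  equal absolute values share it.\<close>

lemma has_dt_codeI:
  assumes c: "valid_dt_code c" and knot: "knot_diagram (dt_diagram (map abs c) \<sigma>)"
    and turns: "list_all2 (\<lambda>p q. q = p \<or> q = turn_piece p) (dt_diagram c \<sigma>) E"
    and D: "mset E = mset D"
  shows "has_dt_code D c"
proof -
  let ?n = "length c"
  \<comment> \<open>The last passage leaves on the edge on which the first one arrives, so only the
    label 2n + 1 has to be sent back to 1.\<close>
  let ?e = "\<lambda>m. if m = 2 * ?n + 1 then 1 else m"
  have "knot_diagram D"
    by (rule knot_diagram_reorder[OF D knot_diagram_turns[OF turns knot_diagram_dt_diagram_of_abs[OF knot]]])
  moreover have "inj_on ?e {1..2 * ?n}"
    by (auto simp: inj_on_def)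
  moreover have "?e (2 * ?n + 1) = ?e 1"
    by simp
  moreover have "length E = ?n"
    using list_all2_lengthD[OF turns] by simp
  moreover have "dt_crossing ?e (2 * k + 1) (c ! k) (E ! k)" if k: "k < ?n" for k
  proof -
    have e: "?e m = m" "?e (m + 1) = next_label ?n m" if "m \<le> 2 * ?n" for m
      using that by (auto simp: next_label_def)
    have "E ! k = dt_piece ?n (2 * k + 1) (c ! k) (\<sigma> k) \<or>
        E ! k = turn_piece (dt_piece ?n (2 * k + 1) (c ! k) (\<sigma> k))"
      using list_all2_nthD[OF turns] k by (simp add: nth_dt_diagram)
    then show ?thesis
      using k valid_dt_code_nth[OF c k] by (intro dt_crossing_dt_piece[where n = ?n] e) simp_all
  qed
  ultimately show ?thesis
    unfolding has_dt_code_def using D by blast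
qed

section \<open>Montesinos diagrams\<close>

text \<open>The history of a rational tangle as data, from which both its diagram and its fraction
  can be evaluated.\<close>

datatype tangle_op = Pos nat nat | Neg nat nat | Rot

fun apply_op :: "tangle_op \<Rightarrow> tangle \<Rightarrow> tangle" where
  "apply_op (Pos n s) T = pos_twist n s T"
| "apply_op (Neg n s) T = neg_twist n s T"
| "apply_op Rot T = rotate_mirror T"

fun op_fraction :: "tangle_op \<Rightarrow> rat option \<Rightarrow> rat option" where
  "op_fraction (Pos n s) q = map_option (\<lambda>x. x + 1) q"
| "op_fraction (Neg n s) q = map_option (\<lambda>x. x - 1) q"
| "op_fraction Rot q = invert_fraction q"

fun new_ends :: "tangle_op \<Rightarrow> nat list" where
  "new_ends (Pos n s) = [n, s]"
| "new_ends (Neg n s) = [n, s]"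
| "new_ends Rot = []"

definition build_tangle :: "nat \<Rightarrow> nat \<Rightarrow> nat \<Rightarrow> nat \<Rightarrow> tangle_op list \<Rightarrow> tangle" where
  "build_tangle nw ne sw se ops = fold apply_op ops (Tangle [Arc nw ne, Arc sw se] nw ne sw se)"

lemma edges_switch: "edges (map switch_piece D) = edges D"
proof -
  have "set (piece_ends (switch_piece p)) = set (piece_ends p)" for p :: "nat piece"
    by (cases p) auto
  then show ?thesis
    by (simp add: all_ends_def)
qed

abbreviation tangle_ends :: "tangle \<Rightarrow> nat set" where
  "tangle_ends T \<equiv> {NW T, NE T, SW T, SE T}"

text \<open>The invariant that the endpoints are edges of the tangle ensures that an operation adds
  exactly its new ends to the edges.\<close>

lemma apply_op_step:
  assumes T: "rational_tangle T q" "tangle_ends T \<subseteq> edges (pieces T)"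
    and op: "distinct (new_ends x)" "set (new_ends x) \<inter> edges (pieces T) = {}"
  shows "rational_tangle (apply_op x T) (op_fraction x q)"
    and "edges (pieces (apply_op x T)) = edges (pieces T) \<union> set (new_ends x)"
    and "tangle_ends (apply_op x T) \<subseteq> edges (pieces (apply_op x T))"
proof -
  obtain D nw ne sw se where TD: "T = Tangle D nw ne sw se"
    by (cases T)
  show "rational_tangle (apply_op x T) (op_fraction x q)"
    using op rational_tangle.pos_twist[OF T(1)] rational_tangle.neg_twist[OF T(1)]
      rational_tangle.rotate_mirror[OF T(1)]
    by (cases x) simp_all
  show edges: "edges (pieces (apply_op x T)) = edges (pieces T) \<union> set (new_ends x)"
    using T(2) by (cases x) (auto simp: TD all_ends_Cons edges_switch)
  show "tangle_ends (apply_op x T) \<subseteq> edges (pieces (apply_op x T))"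
    unfolding edges using T(2) by (cases x) (simp_all add: TD)
qed

lemma rational_tangle_fold:
  assumes "rational_tangle T q" "tangle_ends T \<subseteq> edges (pieces T)"
    and "distinct (concat (map new_ends ops))" "set (concat (map new_ends ops)) \<inter> edges (pieces T) = {}"
  shows "rational_tangle (fold apply_op ops T) (fold op_fraction ops q)"
  using assms
proof (induction ops arbitrary: T q)
  case (Cons x ops)
  have x: "distinct (new_ends x)" "set (new_ends x) \<inter> edges (pieces T) = {}"
    using Cons.prems(3,4) by auto
  note step = apply_op_step[OF Cons.prems(1,2) x]
  have "rational_tangle (fold apply_op ops (apply_op x T)) (fold op_fraction ops (op_fraction x q))"
  proof (rule Cons.IH[OF step(1,3)])
    show "distinct (concat (map new_ends ops))"
      using Cons.prems(3) by simp
    show "set (concat (map new_ends ops)) \<inter> edges (pieces (apply_op x T)) = {}"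
      using Cons.prems(3,4) unfolding step(2) by auto
  qed
  then show ?case by simp
qed simp

text \<open>Distinctness of all labels ever introduced gives the freshness conditions of all twists
  at once.\<close>

lemma rational_build_tangle:
  assumes "distinct ([nw, ne, sw, se] @ concat (map new_ends ops))"
    and "fold op_fraction ops (Some 0) = q"
  shows "rational_tangle (build_tangle nw ne sw se ops) q"
  unfolding build_tangle_def assms(2)[symmetric]
  by (rule rational_tangle_fold[OF rational_tangle.horizontal])
    (use assms(1) in \<open>auto simp: all_ends_def\<close>)

text \<open>Sufficient here, because all non-integer tangles used below have fractions 1/2, 1/3, 2/3
  or their negatives.\<close>

lemma not_Ints_if_proper:
  fixes q :: "'a :: linordered_idom"
  assumes "0 < \<bar>q\<bar>" "\<bar>q\<bar> < 1"
  shows "q \<notin> \<int>"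
  using assms by (metis Ints_nonzero_abs_less1 abs_0 less_irrefl)

text \<open>One Montesinos diagram with the code settles all diagrams with that code, because the
  code determines the knot up to mirror image. The integer tangle is always the trivial one.\<close>

lemma montesinos_if_dt_code:
  assumes c: "valid_dt_code c" "signs_forced (map abs c) S"
    and tangles: "list_all2 (\<lambda>T q. rational_tangle T (Some q)) Ts qs" "disjoint_tangles (T\<^sub>0 # Ts)"
      "rational_tangle T\<^sub>0 (Some 0)" "\<forall>q \<in> set qs. 0 < \<bar>q\<bar> \<and> \<bar>q\<bar> < 1" "length qs = r"
    and M: "closed_diagram (annular_closure (T\<^sub>0 # Ts))"
      "has_dt_code (unmark_arcs (annular_closure (T\<^sub>0 # Ts)) []) c"
  shows "(\<exists>D. has_dt_code D c) \<and> (\<forall>D. has_dt_code D c \<longrightarrow> montesinos_knot r D)"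
proof (intro conjI allI impI)
  let ?M = "annular_closure (T\<^sub>0 # Ts)"
  show "\<exists>D. has_dt_code D c"
    using M(2) ..
  fix D assume D: "has_dt_code D c"
  have "knot_diagram (unmark_arcs ?M [])"
    using M(2) by (simp add: has_dt_code_def)
  \<comment> \<open>Here the properties of the diagram without marked points are carried back to the
    annular closure.\<close>
  then have knot: "knot_diagram ?M" and iso: "isotopic ?M (unmark_arcs ?M [])"
    using unmark_arcs[of ?M "[]"] M(1) by simp_all
  have "same_knot D (unmark_arcs ?M [])"
    by (rule has_dt_code_unique[OF c D M(2)])
  then have same: "same_knot D ?M"
    using isotopic_sym[OF iso] isotopic_sym[OF isotopic_mirror_image[OF iso]]
    unfolding same_knot_def by (meson isotopic_trans)
  have "montesinos_diagram 0 qs ?M"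
    unfolding montesinos_diagram_def
  proof (intro conjI exI)
    show "\<forall>q \<in> set qs. q \<notin> \<int>"
      using tangles(4) not_Ints_if_proper by blast
  qed (use tangles knot in simp_all)
  with same tangles(5) show "montesinos_knot r D"
    unfolding montesinos_knot_def by blast
qed

lemma dt_diagram_11:
  assumes "length c = 11"
  shows "dt_diagram c \<sigma> = [dt_piece 11 1 (c ! 0) (\<sigma> 0), dt_piece 11 3 (c ! 1) (\<sigma> 1), dt_piece 11 5 (c ! 2) (\<sigma> 2),
    dt_piece 11 7 (c ! 3) (\<sigma> 3), dt_piece 11 9 (c ! 4) (\<sigma> 4), dt_piece 11 11 (c ! 5) (\<sigma> 5),
    dt_piece 11 13 (c ! 6) (\<sigma> 6), dt_piece 11 15 (c ! 7) (\<sigma> 7), dt_piece 11 17 (c ! 8) (\<sigma> 8),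
    dt_piece 11 19 (c ! 9) (\<sigma> 9), dt_piece 11 21 (c ! 10) (\<sigma> 10)]"
proof -
  have "[0..<11] = [0, 1, 2, 3, 4, 5, 6, 7, 8, 9, 10]"
    by (simp add: upt_rec)
  then show ?thesis
    by (simp add: dt_diagram_def assms)
qed

lemmas eval_dt_diagram = dt_diagram_11 dt_piece_def Let_def next_label_11

text \<open>
  The lists \<open>?Fs\<close> give the faces as cycles of darts. In the tangles, a label \<open>m + 22 * t\<close> with
  \<open>m \<le> 22\<close> is another segment of the edge \<open>m\<close>; the arcs are directed such that the labels of
  the DT code survive when the marked points are removed.
\<close>

lemma knot_diagram_K11a43: "knot_diagram (dt_diagram K11a43 (\<lambda>k. k \<in> UNIV))"
proof -
  let ?D = "[Cross 1 4 2 5, Cross 3 8 4 9, Cross 5 14 6 15, Cross 7 2 8 3, Cross 9 20 10 21,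
      Cross 11 16 12 17, Cross 13 6 14 7, Cross 15 18 16 19, Cross 17 12 18 13, Cross 19 22 20 1,
      Cross 21 10 22 11]"
  let ?Fs = "[[(0, 0), (9, 0), (7, 0), (2, 0)],
    [(0, 1), (1, 3), (4, 1), (9, 3)],
    [(0, 2), (3, 2), (1, 2)],
    [(0, 3), (2, 1), (6, 3), (3, 1)],
    [(1, 0), (3, 0), (6, 0), (8, 0), (5, 0), (10, 0), (4, 0)],
    [(1, 1), (3, 3)],
    [(2, 2), (6, 2)],
    [(2, 3), (7, 1), (8, 3), (6, 1)],
    [(4, 2), (10, 2), (9, 2)],
    [(4, 3), (10, 1)],
    [(5, 1), (7, 3), (9, 1), (10, 3)],
    [(5, 2), (8, 2), (7, 2)],
    [(5, 3), (8, 1)]]"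
  have D: "?D = dt_diagram K11a43 (\<lambda>k. k \<in> UNIV)"
    by (simp add: eval_dt_diagram K11a43_def)
  have "knot_diagram ?D"
  proof (rule knot_diagram_dt_diagramI[OF _ D, where Fs = ?Fs])
    show "valid_dt_code K11a43"
      by (simp add: K11a43_def valid_dt_codeI)
    show "closed_diagram ?D"
      by (simp add: closed_diagram_def all_ends_def)
    show "\<forall>F \<in> set ?Fs. \<forall>(x, y) \<in> set (zip F (rotate1 F)). face_arrow ?D x y"
      by (simp add: face_arrow_def)
  qed (simp_all add: K11a43_def)
  then show ?thesis
    unfolding D .
qed

lemma knot_diagram_K11a44: "knot_diagram (dt_diagram K11a44 (\<lambda>k. k \<in> {0, 1, 3, 4, 9, 10}))"
proof -
  let ?D = "[Cross 1 4 2 5, Cross 3 8 4 9, Cross 5 15 6 14, Cross 7 2 8 3, Cross 9 20 10 21,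
      Cross 11 17 12 16, Cross 13 19 14 18, Cross 15 7 16 6, Cross 17 13 18 12, Cross 19 22 20 1,
      Cross 21 10 22 11]"
  let ?Fs = "[[(0, 0), (9, 0), (6, 2), (2, 0)],
    [(0, 1), (1, 3), (4, 1), (9, 3)],
    [(0, 2), (3, 2), (1, 2)],
    [(0, 3), (2, 1), (7, 1), (3, 1)],
    [(1, 0), (3, 0), (7, 2), (5, 0), (10, 0), (4, 0)],
    [(1, 1), (3, 3)],
    [(2, 2), (7, 0)],
    [(2, 3), (6, 3), (8, 3), (5, 3), (7, 3)],
    [(4, 2), (10, 2), (9, 2)],
    [(4, 3), (10, 1)],
    [(5, 1), (8, 1), (6, 1), (9, 1), (10, 3)],
    [(5, 2), (8, 0)],
    [(6, 0), (8, 2)]]"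
  have D: "?D = dt_diagram K11a44 (\<lambda>k. k \<in> {0, 1, 3, 4, 9, 10})"
    by (simp add: eval_dt_diagram K11a44_def)
  have "knot_diagram ?D"
  proof (rule knot_diagram_dt_diagramI[OF _ D, where Fs = ?Fs])
    show "valid_dt_code K11a44"
      by (simp add: K11a44_def valid_dt_codeI)
    show "closed_diagram ?D"
      by (simp add: closed_diagram_def all_ends_def)
    show "\<forall>F \<in> set ?Fs. \<forall>(x, y) \<in> set (zip F (rotate1 F)). face_arrow ?D x y"
      by (simp add: face_arrow_def)
  qed (simp_all add: K11a44_def)
  then show ?thesis
    unfolding D .
qed

lemma knot_diagram_K11a47: "knot_diagram (dt_diagram K11a47 (\<lambda>k. k \<in> {0, 1, 3, 6, 8, 9}))"
proof -
  let ?D = "[Cross 1 4 2 5, Cross 3 8 4 9, Cross 5 15 6 14, Cross 7 2 8 3, Cross 9 21 10 20,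
      Cross 11 1 12 22, Cross 13 18 14 19, Cross 15 7 16 6, Cross 17 12 18 13, Cross 19 16 20 17,
      Cross 21 11 22 10]"
  let ?Fs = "[[(0, 0), (5, 2), (8, 2), (6, 2), (2, 0)],
    [(0, 1), (1, 3), (4, 1), (10, 1), (5, 1)],
    [(0, 2), (3, 2), (1, 2)],
    [(0, 3), (2, 1), (7, 1), (3, 1)],
    [(1, 0), (3, 0), (7, 2), (9, 2), (4, 0)],
    [(1, 1), (3, 3)],
    [(2, 2), (7, 0)],
    [(2, 3), (6, 3), (9, 1), (7, 3)],
    [(4, 2), (10, 0)],
    [(4, 3), (9, 3), (8, 1), (5, 3), (10, 3)],
    [(5, 0), (10, 2)],
    [(6, 0), (8, 0), (9, 0)],
    [(6, 1), (8, 3)]]"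
  have D: "?D = dt_diagram K11a47 (\<lambda>k. k \<in> {0, 1, 3, 6, 8, 9})"
    by (simp add: eval_dt_diagram K11a47_def)
  have "knot_diagram ?D"
  proof (rule knot_diagram_dt_diagramI[OF _ D, where Fs = ?Fs])
    show "valid_dt_code K11a47"
      by (simp add: K11a47_def valid_dt_codeI)
    show "closed_diagram ?D"
      by (simp add: closed_diagram_def all_ends_def)
    show "\<forall>F \<in> set ?Fs. \<forall>(x, y) \<in> set (zip F (rotate1 F)). face_arrow ?D x y"
      by (simp add: face_arrow_def)
  qed (simp_all add: K11a47_def)
  then show ?thesis
    unfolding D .
qed

lemma knot_diagram_K11a57: "knot_diagram (dt_diagram K11a57 (\<lambda>k. k \<in> {0, 1, 2, 3, 7}))"
proof -
  let ?D = "[Cross 1 4 2 5, Cross 3 8 4 9, Cross 5 16 6 17, Cross 7 2 8 3, Cross 9 21 10 20,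
      Cross 11 1 12 22, Cross 13 19 14 18, Cross 15 6 16 7, Cross 17 13 18 12, Cross 19 15 20 14,
      Cross 21 11 22 10]"
  let ?Fs = "[[(0, 0), (5, 2), (8, 0), (2, 0)],
    [(0, 1), (1, 3), (4, 1), (10, 1), (5, 1)],
    [(0, 2), (3, 2), (1, 2)],
    [(0, 3), (2, 1), (7, 3), (3, 1)],
    [(1, 0), (3, 0), (7, 0), (9, 2), (4, 0)],
    [(1, 1), (3, 3)],
    [(2, 2), (7, 2)],
    [(2, 3), (8, 1), (6, 1), (9, 1), (7, 1)],
    [(4, 2), (10, 0)],
    [(4, 3), (9, 3), (6, 3), (8, 3), (5, 3), (10, 3)],
    [(5, 0), (10, 2)],
    [(6, 0), (8, 2)],
    [(6, 2), (9, 0)]]"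
  have D: "?D = dt_diagram K11a57 (\<lambda>k. k \<in> {0, 1, 2, 3, 7})"
    by (simp add: eval_dt_diagram K11a57_def)
  have "knot_diagram ?D"
  proof (rule knot_diagram_dt_diagramI[OF _ D, where Fs = ?Fs])
    show "valid_dt_code K11a57"
      by (simp add: K11a57_def valid_dt_codeI)
    show "closed_diagram ?D"
      by (simp add: closed_diagram_def all_ends_def)
    show "\<forall>F \<in> set ?Fs. \<forall>(x, y) \<in> set (zip F (rotate1 F)). face_arrow ?D x y"
      by (simp add: face_arrow_def)
  qed (simp_all add: K11a57_def)
  then show ?thesis
    unfolding D .
qed

lemma knot_diagram_K11a231: "knot_diagram (dt_diagram K11a231 (\<lambda>k. k \<in> {0, 1, 4, 6, 9}))"
proof -
  let ?D = "[Cross 1 4 2 5, Cross 3 14 4 15, Cross 5 11 6 10, Cross 7 13 8 12, Cross 9 18 10 19,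
      Cross 11 7 12 6, Cross 13 2 14 3, Cross 15 21 16 20, Cross 17 1 18 22, Cross 19 8 20 9,
      Cross 21 17 22 16]"
  let ?Fs = "[[(0, 0), (8, 2), (4, 2), (2, 0)],
    [(0, 1), (1, 3), (7, 1), (10, 1), (8, 1)],
    [(0, 2), (6, 2), (1, 2)],
    [(0, 3), (2, 1), (5, 1), (3, 1), (6, 1)],
    [(1, 0), (6, 0), (3, 2), (9, 2), (7, 0)],
    [(1, 1), (6, 3)],
    [(2, 2), (5, 0)],
    [(2, 3), (4, 3), (9, 1), (3, 3), (5, 3)],
    [(3, 0), (5, 2)],
    [(4, 0), (9, 0)],
    [(4, 1), (8, 3), (10, 3), (7, 3), (9, 3)],
    [(7, 2), (10, 0)],
    [(8, 0), (10, 2)]]"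
  have D: "?D = dt_diagram K11a231 (\<lambda>k. k \<in> {0, 1, 4, 6, 9})"
    by (simp add: eval_dt_diagram K11a231_def)
  have "knot_diagram ?D"
  proof (rule knot_diagram_dt_diagramI[OF _ D, where Fs = ?Fs])
    show "valid_dt_code K11a231"
      by (simp add: K11a231_def valid_dt_codeI)
    show "closed_diagram ?D"
      by (simp add: closed_diagram_def all_ends_def)
    show "\<forall>F \<in> set ?Fs. \<forall>(x, y) \<in> set (zip F (rotate1 F)). face_arrow ?D x y"
      by (simp add: face_arrow_def)
  qed (simp_all add: K11a231_def)
  then show ?thesis
    unfolding D .
qed

lemma knot_diagram_K11a263: "knot_diagram (dt_diagram K11a263 (\<lambda>k. k \<in> UNIV))"
proof -
  let ?D = "[Cross 1 6 2 7, Cross 3 8 4 9, Cross 5 16 6 17, Cross 7 2 8 3, Cross 9 20 10 21,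
      Cross 11 22 12 1, Cross 13 18 14 19, Cross 15 4 16 5, Cross 17 12 18 13, Cross 19 14 20 15,
      Cross 21 10 22 11]"
  let ?Fs = "[[(0, 0), (5, 0), (10, 0), (4, 0), (1, 0), (3, 0)],
    [(0, 1), (2, 3), (8, 1), (5, 3)],
    [(0, 2), (3, 2), (1, 2), (7, 2), (2, 2)],
    [(0, 3), (3, 1)],
    [(1, 1), (3, 3)],
    [(1, 3), (4, 1), (9, 3), (7, 1)],
    [(2, 0), (7, 0), (9, 0), (6, 0), (8, 0)],
    [(2, 1), (7, 3)],
    [(4, 2), (10, 2), (5, 2), (8, 2), (6, 2), (9, 2)],
    [(4, 3), (10, 1)],
    [(5, 1), (10, 3)],
    [(6, 1), (8, 3)],
    [(6, 3), (9, 1)]]"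
  have D: "?D = dt_diagram K11a263 (\<lambda>k. k \<in> UNIV)"
    by (simp add: eval_dt_diagram K11a263_def)
  have "knot_diagram ?D"
  proof (rule knot_diagram_dt_diagramI[OF _ D, where Fs = ?Fs])
    show "valid_dt_code K11a263"
      by (simp add: K11a263_def valid_dt_codeI)
    show "closed_diagram ?D"
      by (simp add: closed_diagram_def all_ends_def)
    show "\<forall>F \<in> set ?Fs. \<forall>(x, y) \<in> set (zip F (rotate1 F)). face_arrow ?D x y"
      by (simp add: face_arrow_def)
  qed (simp_all add: K11a263_def)
  then show ?thesis
    unfolding D .
qed

section \<open>The six alternating codes\<close>

lemma montesinos_K11a43:
  "(\<exists>D. has_dt_code D K11a43) \<and> (\<forall>D. has_dt_code D K11a43 \<longrightarrow> montesinos_knot 4 D)"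
proof (rule montesinos_if_dt_code)
  \<comment> \<open>The trivial tangle is inserted on the edges 1 and 9, which run from the last of
    the four boxes back to the first; 23 and 45 are segments of edge 1, 31 and 53 of edge 9.\<close>
  let ?T = "build_tangle 23 45 31 53 []"
  \<comment> \<open>The fraction of the first tangle evolves as 0, 1, 2, 1/2, 3/2, 2/3. Two
    consecutive \<open>Rot\<close> are a half turn of the box: the fraction stays and the next twist
    is applied on the opposite side. Such turns put the crossings where the coded diagram has
    them.\<close>
  let ?Ts = "[build_tangle 7 29 2 24 [Pos 3 8, Pos 75 4, Rot, Pos 67 5, Rot],
    build_tangle 13 35 6 28 [Pos 51 14, Rot, Pos 27 15, Rot],
    build_tangle 17 39 12 34 [Pos 57 18, Rot, Rot, Pos 16 11, Rot, Rot, Rot, Pos 37 19, Rot],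
    build_tangle 21 43 10 32 [Pos 33 22, Rot, Rot, Pos 20 9, Rot, Rot, Rot, Pos 41 1, Rot]]"
  have abs: "map abs K11a43 = K11a43"
    by (simp add: K11a43_def)
  show valid: "valid_dt_code K11a43"
    by (simp add: K11a43_def valid_dt_codeI)
  show "signs_forced (map abs K11a43) UNIV"
    unfolding abs by (rule signs_forced_K11a43)
  show "list_all2 (\<lambda>T q. rational_tangle T (Some q)) ?Ts [2/3, 1/2, 2/3, 2/3]"
    by (simp add: rational_build_tangle)
  show "rational_tangle ?T (Some 0)"
    by (simp add: rational_build_tangle)
  have M: "annular_closure (?T # ?Ts) = [Arc 23 45, Arc 31 53, Cross 2 5 67 4, Cross 4 75 3 8,
      Cross 8 3 29 24, Arc 7 29, Arc 2 24, Cross 6 15 27 14, Cross 14 51 35 28, Arc 13 35,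
      Arc 6 28, Cross 16 19 37 18, Cross 12 17 11 16, Cross 18 57 39 34, Arc 17 39, Arc 12 34,
      Cross 20 1 41 22, Cross 10 21 9 20, Cross 22 33 43 32, Arc 21 43, Arc 10 32, Arc 45 67,
      Arc 53 75, Arc 5 27, Arc 7 51, Arc 15 37, Arc 13 57, Arc 19 41, Arc 11 33, Arc 1 23,
      Arc 9 31]"
    by (simp add: build_tangle_def annular_closure_def join_boxes_def)
  show "disjoint_tangles (?T # ?Ts)"
    by (simp add: build_tangle_def all_ends_def)
  show "closed_diagram (annular_closure (?T # ?Ts))"
    unfolding M by (simp add: closed_diagram_def all_ends_def)
  \<comment> \<open>The crossings appear in reverse order because \<open>unmark_arcs\<close> pushes
    each of them onto its accumulator.\<close>
  have "has_dt_code [Cross 22 11 21 10, Cross 10 21 9 20, Cross 20 1 19 22, Cross 18 13 17 12,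
      Cross 12 17 11 16, Cross 16 19 15 18, Cross 14 7 13 6, Cross 6 15 5 14, Cross 8 3 7 2,
      Cross 4 9 3 8, Cross 2 5 1 4] K11a43"
  proof (rule has_dt_codeI[OF valid])
    show "knot_diagram (dt_diagram (map abs K11a43) (\<lambda>k. k \<in> UNIV))"
      unfolding abs by (rule knot_diagram_K11a43)
    show "list_all2 (\<lambda>p q. q = p \<or> q = turn_piece p) (dt_diagram K11a43 (\<lambda>k. k \<in> UNIV))
        [Cross 2 5 1 4, Cross 4 9 3 8, Cross 6 15 5 14, Cross 8 3 7 2, Cross 10 21 9 20,
            Cross 12 17 11 16, Cross 14 7 13 6, Cross 16 19 15 18, Cross 18 13 17 12,
            Cross 20 1 19 22, Cross 22 11 21 10]"
      by (simp add: eval_dt_diagram K11a43_def)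
  qed simp
  then show "has_dt_code (unmark_arcs (annular_closure (?T # ?Ts)) []) K11a43"
    unfolding M by simp
qed simp_all

lemma montesinos_K11a44:
  "(\<exists>D. has_dt_code D K11a44) \<and> (\<forall>D. has_dt_code D K11a44 \<longrightarrow> montesinos_knot 4 D)"
proof (rule montesinos_if_dt_code)
  let ?T = "build_tangle 23 45 31 53 []"
  let ?Ts = "[build_tangle 7 29 2 24 [Pos 3 8, Pos 75 4, Rot, Pos 67 5, Rot],
    build_tangle 15 37 51 73 [Pos 6 16, Rot, Rot, Rot, Pos 27 14, Rot],
    build_tangle 17 39 13 35 [Pos 12 18, Rot, Rot, Rot, Pos 11 38, Rot, Rot, Pos 36 19, Rot],
    build_tangle 21 43 10 32 [Pos 33 22, Rot, Rot, Pos 20 9, Rot, Rot, Rot, Pos 41 1, Rot]]"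
  have abs: "map abs K11a44 = K11a44"
    by (simp add: K11a44_def)
  show valid: "valid_dt_code K11a44"
    by (simp add: K11a44_def valid_dt_codeI)
  show "signs_forced (map abs K11a44) {0, 1, 3, 4, 9, 10}"
    unfolding abs by (rule signs_forced_K11a44)
  show "list_all2 (\<lambda>T q. rational_tangle T (Some q)) ?Ts [2/3, 1/2, 1/3, 2/3]"
    by (simp add: rational_build_tangle)
  show "rational_tangle ?T (Some 0)"
    by (simp add: rational_build_tangle)
  have M: "annular_closure (?T # ?Ts) = [Arc 23 45, Arc 31 53, Cross 2 5 67 4, Cross 4 75 3 8,
      Cross 8 3 29 24, Arc 7 29, Arc 2 24, Cross 6 14 27 15, Cross 37 73 16 6, Arc 15 37,
      Arc 51 73, Cross 13 19 36 18, Cross 11 17 12 38, Cross 18 12 39 35, Arc 17 39, Arc 13 35,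
      Cross 20 1 41 22, Cross 10 21 9 20, Cross 22 33 43 32, Arc 21 43, Arc 10 32, Arc 45 67,
      Arc 53 75, Arc 5 27, Arc 7 51, Arc 14 36, Arc 16 38, Arc 19 41, Arc 11 33, Arc 1 23,
      Arc 9 31]"
    by (simp add: build_tangle_def annular_closure_def join_boxes_def)
  show "disjoint_tangles (?T # ?Ts)"
    by (simp add: build_tangle_def all_ends_def)
  show "closed_diagram (annular_closure (?T # ?Ts))"
    unfolding M by (simp add: closed_diagram_def all_ends_def)
  have "has_dt_code [Cross 22 11 21 10, Cross 10 21 9 20, Cross 20 1 19 22, Cross 18 12 17 13,
      Cross 11 17 12 16, Cross 13 19 14 18, Cross 15 7 16 6, Cross 6 14 5 15, Cross 8 3 7 2,
      Cross 4 9 3 8, Cross 2 5 1 4] K11a44"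
  proof (rule has_dt_codeI[OF valid])
    show "knot_diagram (dt_diagram (map abs K11a44) (\<lambda>k. k \<in> {0, 1, 3, 4, 9, 10}))"
      unfolding abs by (rule knot_diagram_K11a44)
    show "list_all2 (\<lambda>p q. q = p \<or> q = turn_piece p) (dt_diagram K11a44 (\<lambda>k. k \<in> {0, 1, 3, 4, 9, 10}))
        [Cross 2 5 1 4, Cross 4 9 3 8, Cross 6 14 5 15, Cross 8 3 7 2, Cross 10 21 9 20,
            Cross 11 17 12 16, Cross 13 19 14 18, Cross 15 7 16 6, Cross 18 12 17 13,
            Cross 20 1 19 22, Cross 22 11 21 10]"
      by (simp add: eval_dt_diagram K11a44_def)
  qed simp
  then show "has_dt_code (unmark_arcs (annular_closure (?T # ?Ts)) []) K11a44"
    unfolding M by simp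
qed simp_all

lemma montesinos_K11a47:
  "(\<exists>D. has_dt_code D K11a47) \<and> (\<forall>D. has_dt_code D K11a47 \<longrightarrow> montesinos_knot 4 D)"
proof (rule montesinos_if_dt_code)
  let ?T = "build_tangle 23 45 31 53 []"
  let ?Ts = "[build_tangle 7 29 2 24 [Pos 3 8, Pos 75 4, Rot, Pos 67 5, Rot],
    build_tangle 15 37 51 73 [Pos 6 16, Rot, Rot, Rot, Pos 27 14, Rot],
    build_tangle 17 39 12 34 [Pos 13 18, Pos 19 36, Rot, Rot, Rot, Pos 20 38, Rot, Rot, Rot],
    build_tangle 21 43 11 33 [Pos 10 22, Rot, Rot, Rot, Pos 9 42, Rot, Rot, Pos 56 1, Rot]]"
  have abs: "map abs K11a47 = K11a47"
    by (simp add: K11a47_def)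
  show valid: "valid_dt_code K11a47"
    by (simp add: K11a47_def valid_dt_codeI)
  show "signs_forced (map abs K11a47) {0, 1, 3, 6, 8, 9}"
    unfolding abs by (rule signs_forced_K11a47)
  show "list_all2 (\<lambda>T q. rational_tangle T (Some q)) ?Ts [2/3, 1/2, 2/3, 1/3]"
    by (simp add: rational_build_tangle)
  show "rational_tangle ?T (Some 0)"
    by (simp add: rational_build_tangle)
  have M: "annular_closure (?T # ?Ts) = [Arc 23 45, Arc 31 53, Cross 2 5 67 4, Cross 4 75 3 8,
      Cross 8 3 29 24, Arc 7 29, Arc 2 24, Cross 6 14 27 15, Cross 37 73 16 6, Arc 15 37,
      Arc 51 73, Cross 20 17 19 38, Cross 36 19 13 18, Cross 18 13 39 34, Arc 17 39, Arc 12 34,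
      Cross 11 1 56 22, Cross 9 21 10 42, Cross 22 10 43 33, Arc 21 43, Arc 11 33, Arc 45 67,
      Arc 53 75, Arc 5 27, Arc 7 51, Arc 14 36, Arc 16 38, Arc 12 56, Arc 20 42, Arc 1 23,
      Arc 9 31]"
    by (simp add: build_tangle_def annular_closure_def join_boxes_def)
  show "disjoint_tangles (?T # ?Ts)"
    by (simp add: build_tangle_def all_ends_def)
  show "closed_diagram (annular_closure (?T # ?Ts))"
    unfolding M by (simp add: closed_diagram_def all_ends_def)
  have "has_dt_code [Cross 22 10 21 11, Cross 9 21 10 20, Cross 11 1 12 22, Cross 18 13 17 12,
      Cross 14 19 13 18, Cross 20 17 19 16, Cross 15 7 16 6, Cross 6 14 5 15, Cross 8 3 7 2,
      Cross 4 9 3 8, Cross 2 5 1 4] K11a47"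
  proof (rule has_dt_codeI[OF valid])
    show "knot_diagram (dt_diagram (map abs K11a47) (\<lambda>k. k \<in> {0, 1, 3, 6, 8, 9}))"
      unfolding abs by (rule knot_diagram_K11a47)
    show "list_all2 (\<lambda>p q. q = p \<or> q = turn_piece p) (dt_diagram K11a47 (\<lambda>k. k \<in> {0, 1, 3, 6, 8, 9}))
        [Cross 2 5 1 4, Cross 4 9 3 8, Cross 6 14 5 15, Cross 8 3 7 2, Cross 9 21 10 20,
            Cross 11 1 12 22, Cross 14 19 13 18, Cross 15 7 16 6, Cross 18 13 17 12,
            Cross 20 17 19 16, Cross 22 10 21 11]"
      by (simp add: eval_dt_diagram K11a47_def)
  qed simp
  then show "has_dt_code (unmark_arcs (annular_closure (?T # ?Ts)) []) K11a47"
    unfolding M by simp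
qed simp_all

lemma montesinos_K11a57:
  "(\<exists>D. has_dt_code D K11a57) \<and> (\<forall>D. has_dt_code D K11a57 \<longrightarrow> montesinos_knot 4 D)"
proof (rule montesinos_if_dt_code)
  let ?T = "build_tangle 23 45 31 53 []"
  let ?Ts = "[build_tangle 7 29 2 24 [Pos 3 8, Pos 75 4, Rot, Pos 67 5, Rot],
    build_tangle 15 37 6 28 [Pos 51 16, Rot, Pos 27 17, Rot],
    build_tangle 19 41 59 81 [Pos 14 20, Rot, Rot, Rot, Pos 13 18, Pos 39 12, Rot],
    build_tangle 21 43 11 33 [Pos 10 22, Rot, Rot, Rot, Pos 9 42, Rot, Rot, Pos 34 1, Rot]]"
  have abs: "map abs K11a57 = K11a57"
    by (simp add: K11a57_def)
  show valid: "valid_dt_code K11a57"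
    by (simp add: K11a57_def valid_dt_codeI)
  show "signs_forced (map abs K11a57) {0, 1, 2, 3, 7}"
    unfolding abs by (rule signs_forced_K11a57)
  show "list_all2 (\<lambda>T q. rational_tangle T (Some q)) ?Ts [2/3, 1/2, 1/3, 1/3]"
    by (simp add: rational_build_tangle)
  show "rational_tangle ?T (Some 0)"
    by (simp add: rational_build_tangle)
  have M: "annular_closure (?T # ?Ts) = [Arc 23 45, Arc 31 53, Cross 2 5 67 4, Cross 4 75 3 8,
      Cross 8 3 29 24, Arc 7 29, Arc 2 24, Cross 6 17 27 16, Cross 16 51 37 28, Arc 15 37,
      Arc 6 28, Cross 18 12 39 13, Cross 14 18 13 19, Cross 41 81 20 14, Arc 19 41, Arc 59 81,
      Cross 11 1 34 22, Cross 9 21 10 42, Cross 22 10 43 33, Arc 21 43, Arc 11 33, Arc 45 67,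
      Arc 53 75, Arc 5 27, Arc 7 51, Arc 17 39, Arc 15 59, Arc 12 34, Arc 20 42, Arc 1 23,
      Arc 9 31]"
    by (simp add: build_tangle_def annular_closure_def join_boxes_def)
  show "disjoint_tangles (?T # ?Ts)"
    by (simp add: build_tangle_def all_ends_def)
  show "closed_diagram (annular_closure (?T # ?Ts))"
    unfolding M by (simp add: closed_diagram_def all_ends_def)
  have "has_dt_code [Cross 22 10 21 11, Cross 9 21 10 20, Cross 11 1 12 22, Cross 19 15 20 14,
      Cross 14 18 13 19, Cross 18 12 17 13, Cross 16 7 15 6, Cross 6 17 5 16, Cross 8 3 7 2,
      Cross 4 9 3 8, Cross 2 5 1 4] K11a57"
  proof (rule has_dt_codeI[OF valid])
    show "knot_diagram (dt_diagram (map abs K11a57) (\<lambda>k. k \<in> {0, 1, 2, 3, 7}))"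
      unfolding abs by (rule knot_diagram_K11a57)
    show "list_all2 (\<lambda>p q. q = p \<or> q = turn_piece p) (dt_diagram K11a57 (\<lambda>k. k \<in> {0, 1, 2, 3, 7}))
        [Cross 2 5 1 4, Cross 4 9 3 8, Cross 6 17 5 16, Cross 8 3 7 2, Cross 9 21 10 20,
            Cross 11 1 12 22, Cross 14 18 13 19, Cross 16 7 15 6, Cross 18 12 17 13,
            Cross 19 15 20 14, Cross 22 10 21 11]"
      by (simp add: eval_dt_diagram K11a57_def)
  qed simp
  then show "has_dt_code (unmark_arcs (annular_closure (?T # ?Ts)) []) K11a57"
    unfolding M by simp
qed simp_all

lemma montesinos_K11a231:
  "(\<exists>D. has_dt_code D K11a231) \<and> (\<forall>D. has_dt_code D K11a231 \<longrightarrow> montesinos_knot 4 D)"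
proof (rule montesinos_if_dt_code)
  let ?T = "build_tangle 23 45 37 59 []"
  let ?Ts = "[build_tangle 13 35 2 24 [Pos 3 14, Pos 81 4, Rot, Pos 67 5, Rot],
    build_tangle 11 33 7 29 [Pos 6 12, Rot, Rot, Rot, Pos 27 10, Rot, Rot, Pos 8 57, Rot, Rot, Rot],
    build_tangle 19 41 30 52 [Pos 9 20, Rot, Rot, Rot, Pos 32 18, Rot],
    build_tangle 21 43 17 39 [Pos 16 22, Rot, Rot, Rot, Pos 15 42, Rot, Rot, Pos 40 1, Rot]]"
  have abs: "map abs K11a231 = K11a231"
    by (simp add: K11a231_def)
  show valid: "valid_dt_code K11a231"
    by (simp add: K11a231_def valid_dt_codeI)
  show "signs_forced (map abs K11a231) {0, 1, 4, 6, 9}"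
    unfolding abs by (rule signs_forced_K11a231)
  show "list_all2 (\<lambda>T q. rational_tangle T (Some q)) ?Ts [2/3, 1/3, 1/2, 1/3]"
    by (simp add: rational_build_tangle)
  show "rational_tangle ?T (Some 0)"
    by (simp add: rational_build_tangle)
  have M: "annular_closure (?T # ?Ts) = [Arc 23 45, Arc 37 59, Cross 2 5 67 4, Cross 4 81 3 14,
      Cross 14 3 35 24, Arc 13 35, Arc 2 24, Cross 8 12 7 57, Cross 6 10 27 11, Cross 33 29 12 6,
      Arc 11 33, Arc 7 29, Cross 9 18 32 19, Cross 41 52 20 9, Arc 19 41, Arc 30 52,
      Cross 17 1 40 22, Cross 15 21 16 42, Cross 22 16 43 39, Arc 21 43, Arc 17 39, Arc 45 67,
      Arc 59 81, Arc 5 27, Arc 13 57, Arc 10 32, Arc 8 30, Arc 18 40, Arc 20 42, Arc 1 23,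
      Arc 15 37]"
    by (simp add: build_tangle_def annular_closure_def join_boxes_def)
  show "disjoint_tangles (?T # ?Ts)"
    by (simp add: build_tangle_def all_ends_def)
  show "closed_diagram (annular_closure (?T # ?Ts))"
    unfolding M by (simp add: closed_diagram_def all_ends_def)
  have "has_dt_code [Cross 22 16 21 17, Cross 15 21 16 20, Cross 17 1 18 22, Cross 19 8 20 9,
      Cross 9 18 10 19, Cross 11 7 12 6, Cross 6 10 5 11, Cross 8 12 7 13, Cross 14 3 13 2,
      Cross 4 15 3 14, Cross 2 5 1 4] K11a231"
  proof (rule has_dt_codeI[OF valid])
    show "knot_diagram (dt_diagram (map abs K11a231) (\<lambda>k. k \<in> {0, 1, 4, 6, 9}))"
      unfolding abs by (rule knot_diagram_K11a231)
    show "list_all2 (\<lambda>p q. q = p \<or> q = turn_piece p) (dt_diagram K11a231 (\<lambda>k. k \<in> {0, 1, 4, 6, 9}))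
        [Cross 2 5 1 4, Cross 4 15 3 14, Cross 6 10 5 11, Cross 8 12 7 13, Cross 9 18 10 19,
            Cross 11 7 12 6, Cross 14 3 13 2, Cross 15 21 16 20, Cross 17 1 18 22, Cross 19 8 20 9,
            Cross 22 16 21 17]"
      by (simp add: eval_dt_diagram K11a231_def)
  qed simp
  then show "has_dt_code (unmark_arcs (annular_closure (?T # ?Ts)) []) K11a231"
    unfolding M by simp
qed simp_all

lemma montesinos_K11a263:
  "(\<exists>D. has_dt_code D K11a263) \<and> (\<forall>D. has_dt_code D K11a263 \<longrightarrow> montesinos_knot 4 D)"
proof (rule montesinos_if_dt_code)
  let ?T = "build_tangle 28 50 26 48 []"
  \<comment> \<open>The standard diagram whose bits are all true requires negative twists here. The
    reflected diagram has the same code and the opposite fractions.\<close>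
  let ?Ts = "[build_tangle 7 29 2 24 [Neg 3 8, Neg 9 70, Rot, Rot, Neg 72 1, Rot],
    build_tangle 21 43 10 32 [Neg 11 22, Neg 23 12, Rot, Rot, Neg 20 31, Rot, Rot, Rot],
    build_tangle 19 41 14 36 [Neg 15 42, Rot, Rot, Neg 18 13, Neg 34 17, Rot],
    build_tangle 37 59 4 92 [Neg 5 16, Neg 39 6, Rot]]"
  have abs: "map abs K11a263 = K11a263"
    by (simp add: K11a263_def)
  show valid: "valid_dt_code K11a263"
    by (simp add: K11a263_def valid_dt_codeI)
  show "signs_forced (map abs K11a263) UNIV"
    unfolding abs by (rule signs_forced_K11a263)
  show "list_all2 (\<lambda>T q. rational_tangle T (Some q)) ?Ts [-1/3, -1/3, -1/3, -1/2]"
    by (simp add: rational_build_tangle)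
  show "rational_tangle ?T (Some 0)"
    by (simp add: rational_build_tangle)
  have M: "annular_closure (?T # ?Ts) = [Arc 28 50, Arc 26 48, Cross 1 72 2 7, Cross 3 8 70 9,
      Cross 29 24 8 3, Arc 7 29, Arc 2 24, Cross 10 21 31 20, Cross 12 23 11 22, Cross 22 11 43 32,
      Arc 21 43, Arc 10 32, Cross 17 34 18 13, Cross 13 18 14 19, Cross 41 36 42 15, Arc 19 41,
      Arc 14 36, Cross 6 39 5 16, Cross 16 5 59 92, Arc 37 59, Arc 4 92, Arc 50 72, Arc 48 70,
      Arc 1 23, Arc 9 31, Arc 12 34, Arc 20 42, Arc 17 39, Arc 15 37, Arc 6 28, Arc 4 26]"
    by (simp add: build_tangle_def annular_closure_def join_boxes_def)
  show "disjoint_tangles (?T # ?Ts)"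
    by (simp add: build_tangle_def all_ends_def)
  show "closed_diagram (annular_closure (?T # ?Ts))"
    unfolding M by (simp add: closed_diagram_def all_ends_def)
  have "has_dt_code [Cross 16 5 15 4, Cross 6 17 5 16, Cross 19 14 20 15, Cross 13 18 14 19,
      Cross 17 12 18 13, Cross 22 11 21 10, Cross 12 1 11 22, Cross 10 21 9 20, Cross 7 2 8 3,
      Cross 3 8 4 9, Cross 1 6 2 7] K11a263"
  proof (rule has_dt_codeI[OF valid])
    show "knot_diagram (dt_diagram (map abs K11a263) (\<lambda>k. k \<in> UNIV))"
      unfolding abs by (rule knot_diagram_K11a263)
    show "list_all2 (\<lambda>p q. q = p \<or> q = turn_piece p) (dt_diagram K11a263 (\<lambda>k. k \<in> UNIV))
        [Cross 1 6 2 7, Cross 3 8 4 9, Cross 6 17 5 16, Cross 7 2 8 3, Cross 10 21 9 20,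
            Cross 12 1 11 22, Cross 13 18 14 19, Cross 16 5 15 4, Cross 17 12 18 13,
            Cross 19 14 20 15, Cross 22 11 21 10]"
      by (simp add: eval_dt_diagram K11a263_def)
  qed simp
  then show "has_dt_code (unmark_arcs (annular_closure (?T # ?Ts)) []) K11a263"
    unfolding M by simp
qed simp_all

section \<open>The nine non-alternating codes\<close>

lemma montesinos_K11n71:
  "(\<exists>D. has_dt_code D K11n71) \<and> (\<forall>D. has_dt_code D K11n71 \<longrightarrow> montesinos_knot 4 D)"
proof (rule montesinos_if_dt_code)
  let ?T = "build_tangle 23 45 31 53 []"
  let ?Ts = "[build_tangle 7 29 2 24 [Pos 3 8, Pos 75 4, Rot, Pos 67 5, Rot],
    build_tangle 13 35 6 28 [Pos 51 14, Rot, Pos 27 15, Rot],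
    build_tangle 17 39 12 34 [Pos 57 18, Rot, Rot, Pos 16 11, Rot, Rot, Rot, Pos 37 19, Rot],
    build_tangle 10 32 22 44 [Neg 21 33, Rot, Rot, Rot, Neg 20 9, Rot, Rot, Rot, Neg 41 1, Rot]]"
  \<comment> \<open>The projection is that of \<open>K11a43\<close>. The negative entries belong to
    the three crossings of the fourth tangle; changing all crossings of a tangle negates its
    fraction. The other codes with this projection change other choices among the second, third and
    fourth tangle.\<close>
  have abs: "map abs K11n71 = K11a43"
    by (simp add: K11n71_def K11a43_def)
  show valid: "valid_dt_code K11n71"
    by (simp add: K11n71_def valid_dt_codeI)
  show "signs_forced (map abs K11n71) UNIV"
    unfolding abs by (rule signs_forced_K11a43)
  show "list_all2 (\<lambda>T q. rational_tangle T (Some q)) ?Ts [2/3, 1/2, 2/3, -2/3]"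
    by (simp add: rational_build_tangle)
  show "rational_tangle ?T (Some 0)"
    by (simp add: rational_build_tangle)
  have M: "annular_closure (?T # ?Ts) = [Arc 23 45, Arc 31 53, Cross 2 5 67 4, Cross 4 75 3 8,
      Cross 8 3 29 24, Arc 7 29, Arc 2 24, Cross 6 15 27 14, Cross 14 51 35 28, Arc 13 35,
      Arc 6 28, Cross 16 19 37 18, Cross 12 17 11 16, Cross 18 57 39 34, Arc 17 39, Arc 12 34,
      Cross 1 41 22 20, Cross 21 9 20 10, Cross 32 44 33 21, Arc 10 32, Arc 22 44, Arc 45 67,
      Arc 53 75, Arc 5 27, Arc 7 51, Arc 15 37, Arc 13 57, Arc 19 41, Arc 11 33, Arc 1 23,
      Arc 9 31]"
    by (simp add: build_tangle_def annular_closure_def join_boxes_def)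
  show "disjoint_tangles (?T # ?Ts)"
    by (simp add: build_tangle_def all_ends_def)
  show "closed_diagram (annular_closure (?T # ?Ts))"
    unfolding M by (simp add: closed_diagram_def all_ends_def)
  have "has_dt_code [Cross 10 22 11 21, Cross 21 9 20 10, Cross 1 19 22 20, Cross 18 13 17 12,
      Cross 12 17 11 16, Cross 16 19 15 18, Cross 14 7 13 6, Cross 6 15 5 14, Cross 8 3 7 2,
      Cross 4 9 3 8, Cross 2 5 1 4] K11n71"
  proof (rule has_dt_codeI[OF valid])
    show "knot_diagram (dt_diagram (map abs K11n71) (\<lambda>k. k \<in> UNIV))"
      unfolding abs by (rule knot_diagram_K11a43)
    show "list_all2 (\<lambda>p q. q = p \<or> q = turn_piece p) (dt_diagram K11n71 (\<lambda>k. k \<in> UNIV))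
        [Cross 2 5 1 4, Cross 4 9 3 8, Cross 6 15 5 14, Cross 8 3 7 2, Cross 21 9 20 10,
            Cross 12 17 11 16, Cross 14 7 13 6, Cross 16 19 15 18, Cross 18 13 17 12,
            Cross 1 19 22 20, Cross 10 22 11 21]"
      by (simp add: eval_dt_diagram K11n71_def)
  qed simp
  then show "has_dt_code (unmark_arcs (annular_closure (?T # ?Ts)) []) K11n71"
    unfolding M by simp
qed simp_all

lemma montesinos_K11n72:
  "(\<exists>D. has_dt_code D K11n72) \<and> (\<forall>D. has_dt_code D K11n72 \<longrightarrow> montesinos_knot 4 D)"
proof (rule montesinos_if_dt_code)
  let ?T = "build_tangle 23 45 31 53 []"
  let ?Ts = "[build_tangle 7 29 2 24 [Pos 3 8, Pos 75 4, Rot, Pos 67 5, Rot],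
    build_tangle 6 28 14 36 [Neg 13 51, Rot, Rot, Neg 27 15, Rot],
    build_tangle 17 39 12 34 [Pos 35 18, Rot, Rot, Pos 16 11, Rot, Rot, Rot, Pos 37 19, Rot],
    build_tangle 21 43 10 32 [Pos 33 22, Rot, Rot, Pos 20 9, Rot, Rot, Rot, Pos 41 1, Rot]]"
  have abs: "map abs K11n72 = K11a43"
    by (simp add: K11n72_def K11a43_def)
  show valid: "valid_dt_code K11n72"
    by (simp add: K11n72_def valid_dt_codeI)
  show "signs_forced (map abs K11n72) UNIV"
    unfolding abs by (rule signs_forced_K11a43)
  show "list_all2 (\<lambda>T q. rational_tangle T (Some q)) ?Ts [2/3, -1/2, 2/3, 2/3]"
    by (simp add: rational_build_tangle)
  show "rational_tangle ?T (Some 0)"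
    by (simp add: rational_build_tangle)
  have M: "annular_closure (?T # ?Ts) = [Arc 23 45, Arc 31 53, Cross 2 5 67 4, Cross 4 75 3 8,
      Cross 8 3 29 24, Arc 7 29, Arc 2 24, Cross 15 27 14 6, Cross 28 36 51 13, Arc 6 28,
      Arc 14 36, Cross 16 19 37 18, Cross 12 17 11 16, Cross 18 35 39 34, Arc 17 39, Arc 12 34,
      Cross 20 1 41 22, Cross 10 21 9 20, Cross 22 33 43 32, Arc 21 43, Arc 10 32, Arc 45 67,
      Arc 53 75, Arc 5 27, Arc 7 51, Arc 15 37, Arc 13 35, Arc 19 41, Arc 11 33, Arc 1 23,
      Arc 9 31]"
    by (simp add: build_tangle_def annular_closure_def join_boxes_def)
  show "disjoint_tangles (?T # ?Ts)"
    by (simp add: build_tangle_def all_ends_def)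
  show "closed_diagram (annular_closure (?T # ?Ts))"
    unfolding M by (simp add: closed_diagram_def all_ends_def)
  have "has_dt_code [Cross 22 11 21 10, Cross 10 21 9 20, Cross 20 1 19 22, Cross 18 13 17 12,
      Cross 12 17 11 16, Cross 16 19 15 18, Cross 6 14 7 13, Cross 15 5 14 6, Cross 8 3 7 2,
      Cross 4 9 3 8, Cross 2 5 1 4] K11n72"
  proof (rule has_dt_codeI[OF valid])
    show "knot_diagram (dt_diagram (map abs K11n72) (\<lambda>k. k \<in> UNIV))"
      unfolding abs by (rule knot_diagram_K11a43)
    show "list_all2 (\<lambda>p q. q = p \<or> q = turn_piece p) (dt_diagram K11n72 (\<lambda>k. k \<in> UNIV))
        [Cross 2 5 1 4, Cross 4 9 3 8, Cross 15 5 14 6, Cross 8 3 7 2, Cross 10 21 9 20,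
            Cross 12 17 11 16, Cross 6 14 7 13, Cross 16 19 15 18, Cross 18 13 17 12,
            Cross 20 1 19 22, Cross 22 11 21 10]"
      by (simp add: eval_dt_diagram K11n72_def)
  qed simp
  then show "has_dt_code (unmark_arcs (annular_closure (?T # ?Ts)) []) K11n72"
    unfolding M by simp
qed simp_all

lemma montesinos_K11n73:
  "(\<exists>D. has_dt_code D K11n73) \<and> (\<forall>D. has_dt_code D K11n73 \<longrightarrow> montesinos_knot 4 D)"
proof (rule montesinos_if_dt_code)
  let ?T = "build_tangle 23 45 31 53 []"
  let ?Ts = "[build_tangle 7 29 2 24 [Pos 3 8, Pos 75 4, Rot, Pos 67 5, Rot],
    build_tangle 6 28 14 36 [Neg 13 51, Rot, Rot, Neg 27 15, Rot],
    build_tangle 12 34 18 40 [Neg 17 35, Rot, Rot, Rot, Neg 16 11, Rot, Rot, Rot, Neg 37 19, Rot],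
    build_tangle 21 43 10 32 [Pos 33 22, Rot, Rot, Pos 20 9, Rot, Rot, Rot, Pos 41 1, Rot]]"
  have abs: "map abs K11n73 = K11a43"
    by (simp add: K11n73_def K11a43_def)
  show valid: "valid_dt_code K11n73"
    by (simp add: K11n73_def valid_dt_codeI)
  show "signs_forced (map abs K11n73) UNIV"
    unfolding abs by (rule signs_forced_K11a43)
  show "list_all2 (\<lambda>T q. rational_tangle T (Some q)) ?Ts [2/3, -1/2, -2/3, 2/3]"
    by (simp add: rational_build_tangle)
  show "rational_tangle ?T (Some 0)"
    by (simp add: rational_build_tangle)
  have M: "annular_closure (?T # ?Ts) = [Arc 23 45, Arc 31 53, Cross 2 5 67 4, Cross 4 75 3 8,
      Cross 8 3 29 24, Arc 7 29, Arc 2 24, Cross 15 27 14 6, Cross 28 36 51 13, Arc 6 28,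
      Arc 14 36, Cross 19 37 18 16, Cross 17 11 16 12, Cross 34 40 35 17, Arc 12 34, Arc 18 40,
      Cross 20 1 41 22, Cross 10 21 9 20, Cross 22 33 43 32, Arc 21 43, Arc 10 32, Arc 45 67,
      Arc 53 75, Arc 5 27, Arc 7 51, Arc 15 37, Arc 13 35, Arc 19 41, Arc 11 33, Arc 1 23,
      Arc 9 31]"
    by (simp add: build_tangle_def annular_closure_def join_boxes_def)
  show "disjoint_tangles (?T # ?Ts)"
    by (simp add: build_tangle_def all_ends_def)
  show "closed_diagram (annular_closure (?T # ?Ts))"
    unfolding M by (simp add: closed_diagram_def all_ends_def)
  have "has_dt_code [Cross 22 11 21 10, Cross 10 21 9 20, Cross 20 1 19 22, Cross 12 18 13 17,
      Cross 17 11 16 12, Cross 19 15 18 16, Cross 6 14 7 13, Cross 15 5 14 6, Cross 8 3 7 2,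
      Cross 4 9 3 8, Cross 2 5 1 4] K11n73"
  proof (rule has_dt_codeI[OF valid])
    show "knot_diagram (dt_diagram (map abs K11n73) (\<lambda>k. k \<in> UNIV))"
      unfolding abs by (rule knot_diagram_K11a43)
    show "list_all2 (\<lambda>p q. q = p \<or> q = turn_piece p) (dt_diagram K11n73 (\<lambda>k. k \<in> UNIV))
        [Cross 2 5 1 4, Cross 4 9 3 8, Cross 15 5 14 6, Cross 8 3 7 2, Cross 10 21 9 20,
            Cross 17 11 16 12, Cross 6 14 7 13, Cross 19 15 18 16, Cross 12 18 13 17,
            Cross 20 1 19 22, Cross 22 11 21 10]"
      by (simp add: eval_dt_diagram K11n73_def)
  qed simp
  then show "has_dt_code (unmark_arcs (annular_closure (?T # ?Ts)) []) K11n73"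
    unfolding M by simp
qed simp_all

lemma montesinos_K11n74:
  "(\<exists>D. has_dt_code D K11n74) \<and> (\<forall>D. has_dt_code D K11n74 \<longrightarrow> montesinos_knot 4 D)"
proof (rule montesinos_if_dt_code)
  let ?T = "build_tangle 23 45 31 53 []"
  let ?Ts = "[build_tangle 7 29 2 24 [Pos 3 8, Pos 75 4, Rot, Pos 67 5, Rot],
    build_tangle 6 28 14 36 [Neg 13 51, Rot, Rot, Neg 27 15, Rot],
    build_tangle 17 39 12 34 [Pos 35 18, Rot, Rot, Pos 16 11, Rot, Rot, Rot, Pos 37 19, Rot],
    build_tangle 10 32 22 44 [Neg 21 33, Rot, Rot, Rot, Neg 20 9, Rot, Rot, Rot, Neg 41 1, Rot]]"
  have abs: "map abs K11n74 = K11a43"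
    by (simp add: K11n74_def K11a43_def)
  show valid: "valid_dt_code K11n74"
    by (simp add: K11n74_def valid_dt_codeI)
  show "signs_forced (map abs K11n74) UNIV"
    unfolding abs by (rule signs_forced_K11a43)
  show "list_all2 (\<lambda>T q. rational_tangle T (Some q)) ?Ts [2/3, -1/2, 2/3, -2/3]"
    by (simp add: rational_build_tangle)
  show "rational_tangle ?T (Some 0)"
    by (simp add: rational_build_tangle)
  have M: "annular_closure (?T # ?Ts) = [Arc 23 45, Arc 31 53, Cross 2 5 67 4, Cross 4 75 3 8,
      Cross 8 3 29 24, Arc 7 29, Arc 2 24, Cross 15 27 14 6, Cross 28 36 51 13, Arc 6 28,
      Arc 14 36, Cross 16 19 37 18, Cross 12 17 11 16, Cross 18 35 39 34, Arc 17 39, Arc 12 34,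
      Cross 1 41 22 20, Cross 21 9 20 10, Cross 32 44 33 21, Arc 10 32, Arc 22 44, Arc 45 67,
      Arc 53 75, Arc 5 27, Arc 7 51, Arc 15 37, Arc 13 35, Arc 19 41, Arc 11 33, Arc 1 23,
      Arc 9 31]"
    by (simp add: build_tangle_def annular_closure_def join_boxes_def)
  show "disjoint_tangles (?T # ?Ts)"
    by (simp add: build_tangle_def all_ends_def)
  show "closed_diagram (annular_closure (?T # ?Ts))"
    unfolding M by (simp add: closed_diagram_def all_ends_def)
  have "has_dt_code [Cross 10 22 11 21, Cross 21 9 20 10, Cross 1 19 22 20, Cross 18 13 17 12,
      Cross 12 17 11 16, Cross 16 19 15 18, Cross 6 14 7 13, Cross 15 5 14 6, Cross 8 3 7 2,
      Cross 4 9 3 8, Cross 2 5 1 4] K11n74"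
  proof (rule has_dt_codeI[OF valid])
    show "knot_diagram (dt_diagram (map abs K11n74) (\<lambda>k. k \<in> UNIV))"
      unfolding abs by (rule knot_diagram_K11a43)
    show "list_all2 (\<lambda>p q. q = p \<or> q = turn_piece p) (dt_diagram K11n74 (\<lambda>k. k \<in> UNIV))
        [Cross 2 5 1 4, Cross 4 9 3 8, Cross 15 5 14 6, Cross 8 3 7 2, Cross 21 9 20 10,
            Cross 12 17 11 16, Cross 6 14 7 13, Cross 16 19 15 18, Cross 18 13 17 12,
            Cross 1 19 22 20, Cross 10 22 11 21]"
      by (simp add: eval_dt_diagram K11n74_def)
  qed simp
  then show "has_dt_code (unmark_arcs (annular_closure (?T # ?Ts)) []) K11n74"
    unfolding M by simp
qed simp_all

lemma montesinos_K11n75: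
  "(\<exists>D. has_dt_code D K11n75) \<and> (\<forall>D. has_dt_code D K11n75 \<longrightarrow> montesinos_knot 4 D)"
proof (rule montesinos_if_dt_code)
  let ?T = "build_tangle 23 45 31 53 []"
  let ?Ts = "[build_tangle 7 29 2 24 [Pos 3 8, Pos 75 4, Rot, Pos 67 5, Rot],
    build_tangle 6 28 14 36 [Neg 13 51, Rot, Rot, Neg 27 15, Rot],
    build_tangle 12 34 18 40 [Neg 17 35, Rot, Rot, Rot, Neg 16 11, Rot, Rot, Rot, Neg 37 19, Rot],
    build_tangle 10 32 22 44 [Neg 21 33, Rot, Rot, Rot, Neg 20 9, Rot, Rot, Rot, Neg 41 1, Rot]]"
  have abs: "map abs K11n75 = K11a43"
    by (simp add: K11n75_def K11a43_def)
  show valid: "valid_dt_code K11n75"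
    by (simp add: K11n75_def valid_dt_codeI)
  show "signs_forced (map abs K11n75) UNIV"
    unfolding abs by (rule signs_forced_K11a43)
  show "list_all2 (\<lambda>T q. rational_tangle T (Some q)) ?Ts [2/3, -1/2, -2/3, -2/3]"
    by (simp add: rational_build_tangle)
  show "rational_tangle ?T (Some 0)"
    by (simp add: rational_build_tangle)
  have M: "annular_closure (?T # ?Ts) = [Arc 23 45, Arc 31 53, Cross 2 5 67 4, Cross 4 75 3 8,
      Cross 8 3 29 24, Arc 7 29, Arc 2 24, Cross 15 27 14 6, Cross 28 36 51 13, Arc 6 28,
      Arc 14 36, Cross 19 37 18 16, Cross 17 11 16 12, Cross 34 40 35 17, Arc 12 34, Arc 18 40,
      Cross 1 41 22 20, Cross 21 9 20 10, Cross 32 44 33 21, Arc 10 32, Arc 22 44, Arc 45 67,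
      Arc 53 75, Arc 5 27, Arc 7 51, Arc 15 37, Arc 13 35, Arc 19 41, Arc 11 33, Arc 1 23,
      Arc 9 31]"
    by (simp add: build_tangle_def annular_closure_def join_boxes_def)
  show "disjoint_tangles (?T # ?Ts)"
    by (simp add: build_tangle_def all_ends_def)
  show "closed_diagram (annular_closure (?T # ?Ts))"
    unfolding M by (simp add: closed_diagram_def all_ends_def)
  have "has_dt_code [Cross 10 22 11 21, Cross 21 9 20 10, Cross 1 19 22 20, Cross 12 18 13 17,
      Cross 17 11 16 12, Cross 19 15 18 16, Cross 6 14 7 13, Cross 15 5 14 6, Cross 8 3 7 2,
      Cross 4 9 3 8, Cross 2 5 1 4] K11n75"
  proof (rule has_dt_codeI[OF valid])
    show "knot_diagram (dt_diagram (map abs K11n75) (\<lambda>k. k \<in> UNIV))"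
      unfolding abs by (rule knot_diagram_K11a43)
    show "list_all2 (\<lambda>p q. q = p \<or> q = turn_piece p) (dt_diagram K11n75 (\<lambda>k. k \<in> UNIV))
        [Cross 2 5 1 4, Cross 4 9 3 8, Cross 15 5 14 6, Cross 8 3 7 2, Cross 21 9 20 10,
            Cross 17 11 16 12, Cross 6 14 7 13, Cross 19 15 18 16, Cross 12 18 13 17,
            Cross 1 19 22 20, Cross 10 22 11 21]"
      by (simp add: eval_dt_diagram K11n75_def)
  qed simp
  then show "has_dt_code (unmark_arcs (annular_closure (?T # ?Ts)) []) K11n75"
    unfolding M by simp
qed simp_all

lemma montesinos_K11n76:
  "(\<exists>D. has_dt_code D K11n76) \<and> (\<forall>D. has_dt_code D K11n76 \<longrightarrow> montesinos_knot 4 D)"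
proof (rule montesinos_if_dt_code)
  let ?T = "build_tangle 23 45 31 53 []"
  let ?Ts = "[build_tangle 7 29 2 24 [Pos 3 8, Pos 75 4, Rot, Pos 67 5, Rot],
    build_tangle 15 37 51 73 [Pos 6 16, Rot, Rot, Rot, Pos 27 14, Rot],
    build_tangle 17 39 13 35 [Pos 12 18, Rot, Rot, Rot, Pos 11 38, Rot, Rot, Pos 36 19, Rot],
    build_tangle 10 32 22 44 [Neg 21 33, Rot, Rot, Rot, Neg 20 9, Rot, Rot, Rot, Neg 41 1, Rot]]"
  \<comment> \<open>The projection is that of \<open>K11a44\<close>, with all crossings of the
    fourth tangle changed.\<close>
  have abs: "map abs K11n76 = K11a44"
    by (simp add: K11n76_def K11a44_def)
  show valid: "valid_dt_code K11n76"
    by (simp add: K11n76_def valid_dt_codeI)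
  show "signs_forced (map abs K11n76) {0, 1, 3, 4, 9, 10}"
    unfolding abs by (rule signs_forced_K11a44)
  show "list_all2 (\<lambda>T q. rational_tangle T (Some q)) ?Ts [2/3, 1/2, 1/3, -2/3]"
    by (simp add: rational_build_tangle)
  show "rational_tangle ?T (Some 0)"
    by (simp add: rational_build_tangle)
  have M: "annular_closure (?T # ?Ts) = [Arc 23 45, Arc 31 53, Cross 2 5 67 4, Cross 4 75 3 8,
      Cross 8 3 29 24, Arc 7 29, Arc 2 24, Cross 6 14 27 15, Cross 37 73 16 6, Arc 15 37,
      Arc 51 73, Cross 13 19 36 18, Cross 11 17 12 38, Cross 18 12 39 35, Arc 17 39, Arc 13 35,
      Cross 1 41 22 20, Cross 21 9 20 10, Cross 32 44 33 21, Arc 10 32, Arc 22 44, Arc 45 67,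
      Arc 53 75, Arc 5 27, Arc 7 51, Arc 14 36, Arc 16 38, Arc 19 41, Arc 11 33, Arc 1 23,
      Arc 9 31]"
    by (simp add: build_tangle_def annular_closure_def join_boxes_def)
  show "disjoint_tangles (?T # ?Ts)"
    by (simp add: build_tangle_def all_ends_def)
  show "closed_diagram (annular_closure (?T # ?Ts))"
    unfolding M by (simp add: closed_diagram_def all_ends_def)
  have "has_dt_code [Cross 10 22 11 21, Cross 21 9 20 10, Cross 1 19 22 20, Cross 18 12 17 13,
      Cross 11 17 12 16, Cross 13 19 14 18, Cross 15 7 16 6, Cross 6 14 5 15, Cross 8 3 7 2,
      Cross 4 9 3 8, Cross 2 5 1 4] K11n76"
  proof (rule has_dt_codeI[OF valid])
    show "knot_diagram (dt_diagram (map abs K11n76) (\<lambda>k. k \<in> {0, 1, 3, 4, 9, 10}))"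
      unfolding abs by (rule knot_diagram_K11a44)
    show "list_all2 (\<lambda>p q. q = p \<or> q = turn_piece p) (dt_diagram K11n76 (\<lambda>k. k \<in> {0, 1, 3, 4, 9, 10}))
        [Cross 2 5 1 4, Cross 4 9 3 8, Cross 6 14 5 15, Cross 8 3 7 2, Cross 21 9 20 10,
            Cross 11 17 12 16, Cross 13 19 14 18, Cross 15 7 16 6, Cross 18 12 17 13,
            Cross 1 19 22 20, Cross 10 22 11 21]"
      by (simp add: eval_dt_diagram K11n76_def)
  qed simp
  then show "has_dt_code (unmark_arcs (annular_closure (?T # ?Ts)) []) K11n76"
    unfolding M by simp
qed simp_all

lemma montesinos_K11n77:
  "(\<exists>D. has_dt_code D K11n77) \<and> (\<forall>D. has_dt_code D K11n77 \<longrightarrow> montesinos_knot 4 D)"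
proof (rule montesinos_if_dt_code)
  let ?T = "build_tangle 23 45 31 53 []"
  let ?Ts = "[build_tangle 7 29 2 24 [Pos 3 8, Pos 75 4, Rot, Pos 67 5, Rot],
    build_tangle 6 28 15 37 [Neg 16 51, Rot, Rot, Neg 27 14, Rot],
    build_tangle 12 34 17 39 [Neg 18 13, Neg 36 19, Rot, Rot, Neg 11 38, Rot, Rot, Rot],
    build_tangle 21 43 10 32 [Pos 33 22, Rot, Rot, Pos 20 9, Rot, Rot, Rot, Pos 41 1, Rot]]"
  \<comment> \<open>Here the second and the third tangle of \<open>K11a44\<close> are
    changed.\<close>
  have abs: "map abs K11n77 = K11a44"
    by (simp add: K11n77_def K11a44_def)
  show valid: "valid_dt_code K11n77"
    by (simp add: K11n77_def valid_dt_codeI)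
  show "signs_forced (map abs K11n77) {0, 1, 3, 4, 9, 10}"
    unfolding abs by (rule signs_forced_K11a44)
  show "list_all2 (\<lambda>T q. rational_tangle T (Some q)) ?Ts [2/3, -1/2, -1/3, 2/3]"
    by (simp add: rational_build_tangle)
  show "rational_tangle ?T (Some 0)"
    by (simp add: rational_build_tangle)
  have M: "annular_closure (?T # ?Ts) = [Arc 23 45, Arc 31 53, Cross 2 5 67 4, Cross 4 75 3 8,
      Cross 8 3 29 24, Arc 7 29, Arc 2 24, Cross 14 27 15 6, Cross 28 37 51 16, Arc 6 28,
      Arc 15 37, Cross 17 12 38 11, Cross 19 36 18 13, Cross 13 18 34 39, Arc 12 34, Arc 17 39,
      Cross 20 1 41 22, Cross 10 21 9 20, Cross 22 33 43 32, Arc 21 43, Arc 10 32, Arc 45 67,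
      Arc 53 75, Arc 5 27, Arc 7 51, Arc 14 36, Arc 16 38, Arc 19 41, Arc 11 33, Arc 1 23,
      Arc 9 31]"
    by (simp add: build_tangle_def annular_closure_def join_boxes_def)
  show "disjoint_tangles (?T # ?Ts)"
    by (simp add: build_tangle_def all_ends_def)
  show "closed_diagram (annular_closure (?T # ?Ts))"
    unfolding M by (simp add: closed_diagram_def all_ends_def)
  have "has_dt_code [Cross 22 11 21 10, Cross 10 21 9 20, Cross 20 1 19 22, Cross 13 18 12 17,
      Cross 19 14 18 13, Cross 17 12 16 11, Cross 6 15 7 16, Cross 14 5 15 6, Cross 8 3 7 2,
      Cross 4 9 3 8, Cross 2 5 1 4] K11n77"
  proof (rule has_dt_codeI[OF valid])
    show "knot_diagram (dt_diagram (map abs K11n77) (\<lambda>k. k \<in> {0, 1, 3, 4, 9, 10}))"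
      unfolding abs by (rule knot_diagram_K11a44)
    show "list_all2 (\<lambda>p q. q = p \<or> q = turn_piece p) (dt_diagram K11n77 (\<lambda>k. k \<in> {0, 1, 3, 4, 9, 10}))
        [Cross 2 5 1 4, Cross 4 9 3 8, Cross 14 5 15 6, Cross 8 3 7 2, Cross 10 21 9 20,
            Cross 17 12 16 11, Cross 19 14 18 13, Cross 6 15 7 16, Cross 13 18 12 17,
            Cross 20 1 19 22, Cross 22 11 21 10]"
      by (simp add: eval_dt_diagram K11n77_def)
  qed simp
  then show "has_dt_code (unmark_arcs (annular_closure (?T # ?Ts)) []) K11n77"
    unfolding M by simp
qed simp_all

lemma montesinos_K11n78:
  "(\<exists>D. has_dt_code D K11n78) \<and> (\<forall>D. has_dt_code D K11n78 \<longrightarrow> montesinos_knot 4 D)"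
proof (rule montesinos_if_dt_code)
  let ?T = "build_tangle 23 45 31 53 []"
  let ?Ts = "[build_tangle 7 29 2 24 [Pos 3 8, Pos 75 4, Rot, Pos 67 5, Rot],
    build_tangle 6 28 15 37 [Neg 16 51, Rot, Rot, Neg 27 14, Rot],
    build_tangle 12 34 17 39 [Neg 18 13, Neg 36 19, Rot, Rot, Neg 11 38, Rot, Rot, Rot],
    build_tangle 10 32 22 44 [Neg 21 33, Rot, Rot, Rot, Neg 20 9, Rot, Rot, Rot, Neg 41 1, Rot]]"
  have abs: "map abs K11n78 = K11a44"
    by (simp add: K11n78_def K11a44_def)
  show valid: "valid_dt_code K11n78"
    by (simp add: K11n78_def valid_dt_codeI)
  show "signs_forced (map abs K11n78) {0, 1, 3, 4, 9, 10}"
    unfolding abs by (rule signs_forced_K11a44)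
  show "list_all2 (\<lambda>T q. rational_tangle T (Some q)) ?Ts [2/3, -1/2, -1/3, -2/3]"
    by (simp add: rational_build_tangle)
  show "rational_tangle ?T (Some 0)"
    by (simp add: rational_build_tangle)
  have M: "annular_closure (?T # ?Ts) = [Arc 23 45, Arc 31 53, Cross 2 5 67 4, Cross 4 75 3 8,
      Cross 8 3 29 24, Arc 7 29, Arc 2 24, Cross 14 27 15 6, Cross 28 37 51 16, Arc 6 28,
      Arc 15 37, Cross 17 12 38 11, Cross 19 36 18 13, Cross 13 18 34 39, Arc 12 34, Arc 17 39,
      Cross 1 41 22 20, Cross 21 9 20 10, Cross 32 44 33 21, Arc 10 32, Arc 22 44, Arc 45 67,
      Arc 53 75, Arc 5 27, Arc 7 51, Arc 14 36, Arc 16 38, Arc 19 41, Arc 11 33, Arc 1 23,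
      Arc 9 31]"
    by (simp add: build_tangle_def annular_closure_def join_boxes_def)
  show "disjoint_tangles (?T # ?Ts)"
    by (simp add: build_tangle_def all_ends_def)
  show "closed_diagram (annular_closure (?T # ?Ts))"
    unfolding M by (simp add: closed_diagram_def all_ends_def)
  have "has_dt_code [Cross 10 22 11 21, Cross 21 9 20 10, Cross 1 19 22 20, Cross 13 18 12 17,
      Cross 19 14 18 13, Cross 17 12 16 11, Cross 6 15 7 16, Cross 14 5 15 6, Cross 8 3 7 2,
      Cross 4 9 3 8, Cross 2 5 1 4] K11n78"
  proof (rule has_dt_codeI[OF valid])
    show "knot_diagram (dt_diagram (map abs K11n78) (\<lambda>k. k \<in> {0, 1, 3, 4, 9, 10}))"
      unfolding abs by (rule knot_diagram_K11a44)
    show "list_all2 (\<lambda>p q. q = p \<or> q = turn_piece p) (dt_diagram K11n78 (\<lambda>k. k \<in> {0, 1, 3, 4, 9, 10}))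
        [Cross 2 5 1 4, Cross 4 9 3 8, Cross 14 5 15 6, Cross 8 3 7 2, Cross 21 9 20 10,
            Cross 17 12 16 11, Cross 19 14 18 13, Cross 6 15 7 16, Cross 13 18 12 17,
            Cross 1 19 22 20, Cross 10 22 11 21]"
      by (simp add: eval_dt_diagram K11n78_def)
  qed simp
  then show "has_dt_code (unmark_arcs (annular_closure (?T # ?Ts)) []) K11n78"
    unfolding M by simp
qed simp_all

lemma montesinos_K11n81:
  "(\<exists>D. has_dt_code D K11n81) \<and> (\<forall>D. has_dt_code D K11n81 \<longrightarrow> montesinos_knot 4 D)"
proof (rule montesinos_if_dt_code)
  let ?T = "build_tangle 23 45 31 53 []"
  let ?Ts = "[build_tangle 7 29 2 24 [Pos 3 8, Pos 75 4, Rot, Pos 67 5, Rot],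
    build_tangle 6 28 16 38 [Neg 15 51, Rot, Rot, Neg 27 17, Rot],
    build_tangle 14 36 19 41 [Neg 20 37, Rot, Rot, Neg 13 18, Neg 39 12, Rot],
    build_tangle 10 32 21 43 [Neg 22 11, Neg 34 1, Rot, Rot, Neg 9 42, Rot, Rot, Rot]]"
  \<comment> \<open>The projection is that of \<open>K11a57\<close>, with all crossings outside the
    first tangle changed.\<close>
  have abs: "map abs K11n81 = K11a57"
    by (simp add: K11n81_def K11a57_def)
  show valid: "valid_dt_code K11n81"
    by (simp add: K11n81_def valid_dt_codeI)
  show "signs_forced (map abs K11n81) {0, 1, 2, 3, 7}"
    unfolding abs by (rule signs_forced_K11a57)
  show "list_all2 (\<lambda>T q. rational_tangle T (Some q)) ?Ts [2/3, -1/2, -1/3, -1/3]"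
    by (simp add: rational_build_tangle)
  show "rational_tangle ?T (Some 0)"
    by (simp add: rational_build_tangle)
  have M: "annular_closure (?T # ?Ts) = [Arc 23 45, Arc 31 53, Cross 2 5 67 4, Cross 4 75 3 8,
      Cross 8 3 29 24, Arc 7 29, Arc 2 24, Cross 17 27 16 6, Cross 28 38 51 15, Arc 6 28,
      Arc 16 38, Cross 12 39 13 18, Cross 18 13 19 14, Cross 36 41 37 20, Arc 14 36, Arc 19 41,
      Cross 21 10 42 9, Cross 1 34 22 11, Cross 11 22 32 43, Arc 10 32, Arc 21 43, Arc 45 67,
      Arc 53 75, Arc 5 27, Arc 7 51, Arc 17 39, Arc 15 37, Arc 12 34, Arc 20 42, Arc 1 23,
      Arc 9 31]"
    by (simp add: build_tangle_def annular_closure_def join_boxes_def)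
  show "disjoint_tangles (?T # ?Ts)"
    by (simp add: build_tangle_def all_ends_def)
  show "closed_diagram (annular_closure (?T # ?Ts))"
    unfolding M by (simp add: closed_diagram_def all_ends_def)
  have "has_dt_code [Cross 11 22 10 21, Cross 1 12 22 11, Cross 21 10 20 9, Cross 14 19 15 20,
      Cross 18 13 19 14, Cross 12 17 13 18, Cross 6 16 7 15, Cross 17 5 16 6, Cross 8 3 7 2,
      Cross 4 9 3 8, Cross 2 5 1 4] K11n81"
  proof (rule has_dt_codeI[OF valid])
    show "knot_diagram (dt_diagram (map abs K11n81) (\<lambda>k. k \<in> {0, 1, 2, 3, 7}))"
      unfolding abs by (rule knot_diagram_K11a57)
    show "list_all2 (\<lambda>p q. q = p \<or> q = turn_piece p) (dt_diagram K11n81 (\<lambda>k. k \<in> {0, 1, 2, 3, 7}))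
        [Cross 2 5 1 4, Cross 4 9 3 8, Cross 17 5 16 6, Cross 8 3 7 2, Cross 21 10 20 9,
            Cross 1 12 22 11, Cross 18 13 19 14, Cross 6 16 7 15, Cross 12 17 13 18,
            Cross 14 19 15 20, Cross 11 22 10 21]"
      by (simp add: eval_dt_diagram K11n81_def)
  qed simp
  then show "has_dt_code (unmark_arcs (annular_closure (?T # ?Ts)) []) K11n81"
    unfolding M by simp
qed simp_all

theorem mainTheorem2:
  assumes "c \<in> {K11a43, K11a44, K11a47, K11a57, K11a231, K11a263,
    K11n71, K11n72, K11n73, K11n74, K11n75, K11n76, K11n77, K11n78, K11n81}"
  shows "(\<exists>D. has_dt_code D c) \<and> (\<forall>D. has_dt_code D c \<longrightarrow> montesinos_knot 4 D)"
  using assms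
  by (elim insertE emptyE) (simp_all only:, (rule
      montesinos_K11a43 montesinos_K11a44 montesinos_K11a47 montesinos_K11a57
      montesinos_K11a231 montesinos_K11a263 montesinos_K11n71 montesinos_K11n72
      montesinos_K11n73 montesinos_K11n74 montesinos_K11n75 montesinos_K11n76
      montesinos_K11n77 montesinos_K11n78 montesinos_K11n81)+)

end
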